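(* Let $(C,\mathcal{E})$ be a non-singular real tropical curve of strict even degree in $\mathbb{T}\mathbb{P}_\Sigma$. Assume that the Newton polygon $\Delta$ of $C$, dual to the fan $\Sigma$, is a lattice transformation of some $\Delta_{2k}$, for $k\ge1$. Then all the connected components of the real part $\mathbb{R}C_{\mathcal{E}}$ are ovals.
   Context: **Tropical curves.** A tropical polynomial is $P(x,y)=\max_{(i,j)\in A}(a_{i,j}+ix+jy)$ with $A\subset(\mathbb{Z}_{\ge 0})^2$ finite; its tropical curve in $\mathbb{R}^2$ is the locus where the maximum is attained at least twice, $\Delta=\mathrm{Conv}\{(i,j): a_{i,j}\neq-\infty\}$ is its Newton polygon, and the dual subdivision $\Delta_C$ of $\Delta$ has faces $F^\vee=\mathrm{Conv}\{(i,j): P(x_0,y_0)=a_{i,j}+ix_0+jy_0\}$ for $F$ a cell of the decomposition of $\mathbb{R}^2$ induced by the curve, $(x_0,y_0)$ in its relative interior. The curve is non-singular if $\Delta_C$ is a triangulation with all triangles of area $1/2$. $\Sigma$ is the fan dual to $\Delta$, assumed complete and unimodular; $\mathbb{T}\mathbb{P}_\Sigma$ is the corresponding tropical toric surface, a compactification of $\mathbb{R}^2$ whose strata correspond to faces of $\Delta$. A non-singular tropical curve $C$ in $\mathbb{T}\mathbb{P}_\Sigma$ is the compactification of such a curve, each unbounded edge receiving a 1-valent vertex on the boundary. $C$ is of strict even degree if every edge of $\Delta$ has even lattice length. **Real structure.** Identify the group $\mathcal{R}^2$ generated by coordinate reflections with $\mathbb{Z}_2^2$. A distribution of signs $\delta:\Delta_C\cap\mathbb{Z}^2\to\{\pm1\}$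 is extended to symmetric copies by $\delta(\varepsilon(v))=(-1)^{\varepsilon_1v_1+\varepsilon_2v_2}\delta(v)$. The associated real phase structure is $\mathcal{E}=\{\mathcal{E}_e\}_e$, $\mathcal{E}_e$ being the set of $\varepsilon$ such that the endpoints of $\varepsilon(e^\vee)$ have opposite signs; $(C,\mathcal{E})$ is a real tropical curve. $\mathbb{R}\mathbb{P}_\Sigma$ is the quotient of the disjoint union $\bigsqcup_{\varepsilon}\varepsilon(\mathbb{T}\mathbb{P}_\Sigma)$ where, for each face $\Gamma$ of $\Delta$ and each integer vector $\alpha$ orthogonal to $\Gamma$, the copies of the stratum of $\Gamma$ differing by $\alpha\bmod2$ are identified. The real part is $\mathbb{R}C_{\mathcal{E}}=\overline{\bigcup_e\bigcup_{\varepsilon\in\mathcal{E}_e}\varepsilon(e)}\subset\mathbb{R}\mathbb{P}_\Sigma$. A connected component of $\mathbb{R}C_{\mathcal{E}}$ is an oval if it divides $\mathbb{R}\mathbb{P}_\Sigma$ into two connected components. **Polytopes.** $\Delta_d=\mathrm{Conv}\{(0,0),(d,0),(0,d)\}$. A lattice polytope $\Delta$ is a lattice transformation of $\Delta'$ if it is the image of $\Delta'$ under the composition of a lattice translation with a linear map in $\mathrm{GL}(2,\mathbb{Z})$. *)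

theory Defs
  imports "HOL-Analysis.Analysis" "HOL-Library.Z2"
begin

section \<open>Lattice points and lattice polygons\<close>

type_synonym lat = "int \<times> int"
type_synonym plane = "real \<times> real"

definition emb :: "lat \<Rightarrow> plane" where
  "emb v = (real_of_int (fst v), real_of_int (snd v))"

definition lattice_transformation :: "plane set \<Rightarrow> plane set \<Rightarrow> bool" where
  "lattice_transformation D D' \<longleftrightarrow>
     (\<exists>(a::int) b c d t. \<bar>a * d - b * c\<bar> = 1 \<and>
        D = (\<lambda>(x, y). emb t + (of_int a * x + of_int b * y, of_int c * x + of_int d * y)) ` D')"

definition std_triangle :: "nat \<Rightarrow> plane set" where
  "std_triangle d = convex hull {(0, 0), (real d, 0), (0, real d)}"

text \<open>Only meaningful for segments with lattice endpoints.\<close>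
definition lattice_length :: "plane set \<Rightarrow> nat" where
  "lattice_length E = card {v. emb v \<in> E} - 1"

definition strict_even :: "plane set \<Rightarrow> bool" where
  "strict_even D \<longleftrightarrow> (\<forall>E. E edge_of D \<longrightarrow> even (lattice_length E))"


section \<open>Tropical polynomials and tropical curves\<close>

text \<open>A tropical polynomial is given by the finite set \<open>A\<close> of exponents whose coefficient is not
  \<open>-\<infinity>\<close>, and by its coefficients \<open>a\<close>; the values of \<open>a\<close> outside \<open>A\<close> are never used.\<close>

definition exponent_set :: "lat set \<Rightarrow> bool" where
  "exponent_set A \<longleftrightarrow> finite A \<and> A \<noteq> {} \<and> (\<forall>m\<in>A. 0 \<le> fst m \<and> 0 \<le> snd m)"

definition trop_monomial :: "(lat \<Rightarrow> real) \<Rightarrow> lat \<Rightarrow> plane \<Rightarrow> real" where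
  "trop_monomial a m p = a m + emb m \<bullet> p"

definition trop_poly :: "lat set \<Rightarrow> (lat \<Rightarrow> real) \<Rightarrow> plane \<Rightarrow> real" where
  "trop_poly A a p = Max ((\<lambda>m. trop_monomial a m p) ` A)"

definition active :: "lat set \<Rightarrow> (lat \<Rightarrow> real) \<Rightarrow> plane \<Rightarrow> lat set" where
  "active A a p = {m \<in> A. trop_poly A a p = trop_monomial a m p}"

definition trop_curve :: "lat set \<Rightarrow> (lat \<Rightarrow> real) \<Rightarrow> plane set" where
  "trop_curve A a = {p. \<exists>m\<in>active A a p. \<exists>n\<in>active A a p. m \<noteq> n}"

definition newton_polygon :: "lat set \<Rightarrow> plane set" where
  "newton_polygon A = convex hull (emb ` A)"

text \<open>The closed cells of the decomposition of the plane induced by the curve: the smallest cell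
  containing \<open>p\<close> is where all the monomials active at \<open>p\<close> are active, and its relative interior is
  where no other monomial is.\<close>
definition cells :: "lat set \<Rightarrow> (lat \<Rightarrow> real) \<Rightarrow> plane set set" where
  "cells A a = range (\<lambda>p. {q. active A a p \<subseteq> active A a q})"

text \<open>The set of active monomials does not depend on the point of the relative interior.\<close>
definition dual_face :: "lat set \<Rightarrow> (lat \<Rightarrow> real) \<Rightarrow> plane set \<Rightarrow> plane set" where
  "dual_face A a F = convex hull (emb ` active A a (SOME p. p \<in> rel_interior F))"

definition dual_subdivision :: "lat set \<Rightarrow> (lat \<Rightarrow> real) \<Rightarrow> plane set set" where
  "dual_subdivision A a = dual_face A a ` cells A a"

definition nonsingular :: "lat set \<Rightarrow> (lat \<Rightarrow> real) \<Rightarrow> bool" where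
  "nonsingular A a \<longleftrightarrow> triangulation (dual_subdivision A a) \<and>
     (\<forall>T\<in>dual_subdivision A a. aff_dim T = 2 \<longrightarrow> measure lebesgue T = 1/2)"

definition trop_edges :: "lat set \<Rightarrow> (lat \<Rightarrow> real) \<Rightarrow> plane set set" where
  "trop_edges A a = {F \<in> cells A a. F \<subseteq> trop_curve A a \<and> aff_dim F = 1}"


section \<open>Fans\<close>

text \<open>The fan dual to a polygon consists of the cones of \<^emph>\<open>outer\<close> normals: as tropical polynomials are
  maxima, these contain the directions of the unbounded edges of the curve.\<close>

definition normal_cone :: "plane set \<Rightarrow> plane set \<Rightarrow> plane set" where
  "normal_cone D G = {u. \<forall>x\<in>D. \<forall>y\<in>G. u \<bullet> x \<le> u \<bullet> y}"

definition dual_fan :: "plane set \<Rightarrow> plane set set" where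
  "dual_fan D = {normal_cone D G |G. G face_of D \<and> G \<noteq> {}}"

definition complete_fan :: "plane set set \<Rightarrow> bool" where
  "complete_fan \<Sigma> \<longleftrightarrow> \<Union>\<Sigma> = UNIV"

text \<open>Every cone is generated by part of a basis of the lattice.\<close>
definition unimodular_fan :: "plane set set \<Rightarrow> bool" where
  "unimodular_fan \<Sigma> \<longleftrightarrow>
     (\<forall>\<sigma>\<in>\<Sigma>. \<exists>u v B. \<bar>fst u * snd v - snd u * fst v\<bar> = 1 \<and> B \<subseteq> {u, v} \<and>
        \<sigma> = convex_cone hull (emb ` B))"


section \<open>The tropical toric surface of a fan\<close>

text \<open>The stratum of a cone \<open>\<sigma>\<close> is the quotient of the plane by the span of \<open>\<sigma>\<close>; a point of the surface
  is a cone together with a coset of its span.\<close>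

type_synonym toric_point = "plane set \<times> plane set"

definition toric_points :: "plane set set \<Rightarrow> toric_point set" where
  "toric_points \<Sigma> = {(\<sigma>, (+) x ` span \<sigma>) |\<sigma> x. \<sigma> \<in> \<Sigma>}"

text \<open>The affine chart of \<open>\<sigma>\<close> is the space of monoid homomorphisms to \<open>[-\<infinity>, \<infinity>)\<close> from the
  lattice vectors that are nonpositive on \<open>\<sigma>\<close>, with the topology of pointwise convergence. A
  point of the stratum of \<open>\<tau>\<close> sends to \<open>-\<infinity>\<close> the vectors that are not orthogonal to \<open>\<tau>\<close>.\<close>

definition toric_chart :: "plane set set \<Rightarrow> plane set \<Rightarrow> toric_point set" where
  "toric_chart \<Sigma> \<sigma> = {(\<tau>, K) \<in> toric_points \<Sigma>. \<tau> face_of \<sigma>}"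

definition chart_exponents :: "plane set \<Rightarrow> lat set" where
  "chart_exponents \<sigma> = {m. \<forall>u\<in>\<sigma>. emb m \<bullet> u \<le> 0}"

definition toric_eval :: "lat \<Rightarrow> toric_point \<Rightarrow> ereal" where
  "toric_eval m p =
     (if \<forall>u\<in>fst p. emb m \<bullet> u = 0 then ereal (emb m \<bullet> (SOME x. x \<in> snd p)) else -\<infinity>)"

definition chart_topology :: "plane set set \<Rightarrow> plane set \<Rightarrow> toric_point topology" where
  "chart_topology \<Sigma> \<sigma> =
     pullback_topology (toric_chart \<Sigma> \<sigma>) (\<lambda>p. \<lambda>m\<in>chart_exponents \<sigma>. toric_eval m p)
       (product_topology (\<lambda>_. euclidean) (chart_exponents \<sigma>))"

definition toric_surface :: "plane set set \<Rightarrow> toric_point topology" where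
  "toric_surface \<Sigma> = topology_generated_by {W. \<exists>\<sigma>\<in>\<Sigma>. openin (chart_topology \<Sigma> \<sigma>) W}"

text \<open>The inclusion of the plane as the open stratum.\<close>
definition toric_incl :: "plane \<Rightarrow> toric_point" where
  "toric_incl x = ({0}, {x})"


section \<open>The real toric surface\<close>

definition quotient_topology :: "'a topology \<Rightarrow> ('a \<Rightarrow> 'b) \<Rightarrow> 'b topology" where
  "quotient_topology X f =
     topology (\<lambda>U. U \<subseteq> f ` topspace X \<and> openin X {x \<in> topspace X. f x \<in> U})"

lemma openin_quotient_topology:
  "openin (quotient_topology X f) U \<longleftrightarrow>
     U \<subseteq> f ` topspace X \<and> openin X {x \<in> topspace X. f x \<in> U}"
proof -
  have "istopology (\<lambda>U. U \<subseteq> f ` topspace X \<and> openin X {x \<in> topspace X. f x \<in> U})"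
    unfolding istopology_def
  proof (intro conjI allI impI; (elim conjE)?)
    fix S T
    assume "openin X {x \<in> topspace X. f x \<in> S}" "openin X {x \<in> topspace X. f x \<in> T}"
    then have "openin X ({x \<in> topspace X. f x \<in> S} \<inter> {x \<in> topspace X. f x \<in> T})"
      by blast
    then show "openin X {x \<in> topspace X. f x \<in> S \<inter> T}"
      by (rule back_subst[of "openin X"]) auto
  next
    fix \<K> assume *: "\<forall>K\<in>\<K>. K \<subseteq> f ` topspace X \<and> openin X {x \<in> topspace X. f x \<in> K}"
    then have "openin X (\<Union>K\<in>\<K>. {x \<in> topspace X. f x \<in> K})"
      by blast
    then show "openin X {x \<in> topspace X. f x \<in> \<Union>\<K>}"
      by (rule back_subst[of "openin X"]) auto
  qed auto
  then show ?thesis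
    by (simp add: quotient_topology_def)
qed

lemma quotient_map_quotient_topology: "quotient_map X (quotient_topology X f) f"
proof -
  have "{x \<in> topspace X. f x \<in> f ` topspace X} = topspace X"
    by auto
  then have "topspace (quotient_topology X f) = f ` topspace X"
    by (intro antisym openin_subset subsetI)
       (auto simp: openin_quotient_topology topspace_def[of "quotient_topology X f"])
  then show ?thesis
    by (simp add: quotient_map_def openin_quotient_topology)
qed

text \<open>The group generated by the coordinate reflections.\<close>
type_synonym reflection = "bit \<times> bit"

definition mod2 :: "lat \<Rightarrow> reflection" where
  "mod2 v = (of_int (fst v), of_int (snd v))"

definition orthogonal_to_face :: "lat \<Rightarrow> plane set \<Rightarrow> bool" where
  "orthogonal_to_face \<alpha> G \<longleftrightarrow> (\<forall>x\<in>G. \<forall>y\<in>G. emb \<alpha> \<bullet> (x - y) = 0)"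

definition copies_glue :: "plane set \<Rightarrow> ((reflection \<times> toric_point) \<times> (reflection \<times> toric_point)) set" where
  "copies_glue D = {((\<epsilon>, p), (\<epsilon> + mod2 \<alpha>, p)) |\<epsilon> p \<alpha> G.
     G face_of D \<and> G \<noteq> {} \<and> p \<in> toric_points (dual_fan D) \<and>
     fst p = normal_cone D G \<and> orthogonal_to_face \<alpha> G}"

definition real_proj :: "plane set \<Rightarrow> reflection \<times> toric_point \<Rightarrow> (reflection \<times> toric_point) set" where
  "real_proj D z = copies_glue D `` {z}"

definition real_toric_surface :: "plane set \<Rightarrow> (reflection \<times> toric_point) set topology" where
  "real_toric_surface D =
     quotient_topology (sum_topology (\<lambda>\<epsilon>. toric_surface (dual_fan D)) UNIV) (real_proj D)"


section \<open>Real tropical curves\<close>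

text \<open>\<open>signs A \<delta>\<close>: \<open>\<delta>\<close> is a distribution of signs. Its values at lattice points outside the Newton
  polygon are never used.\<close>
definition signs :: "lat set \<Rightarrow> (lat \<Rightarrow> int) \<Rightarrow> bool" where
  "signs A \<delta> \<longleftrightarrow> (\<forall>v. emb v \<in> newton_polygon A \<longrightarrow> \<delta> v \<in> {1, -1})"

text \<open>\<open>sign_at \<delta> \<epsilon> v\<close> is the sign of the symmetric copy \<open>\<epsilon>(v)\<close>, that is
  \<open>(-1)^(\<epsilon>\<^sub>1 v\<^sub>1 + \<epsilon>\<^sub>2 v\<^sub>2) \<delta>(v)\<close>.\<close>
definition sign_at :: "(lat \<Rightarrow> int) \<Rightarrow> reflection \<Rightarrow> lat \<Rightarrow> int" where
  "sign_at \<delta> \<epsilon> v =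
     (if fst \<epsilon> * of_int (fst v) + snd \<epsilon> * of_int (snd v) = 0 then \<delta> v else - \<delta> v)"

definition real_phase :: "lat set \<Rightarrow> (lat \<Rightarrow> real) \<Rightarrow> (lat \<Rightarrow> int) \<Rightarrow> plane set \<Rightarrow> reflection set" where
  "real_phase A a \<delta> e = {\<epsilon>. \<exists>v w. dual_face A a e = closed_segment (emb v) (emb w) \<and>
     sign_at \<delta> \<epsilon> v \<noteq> sign_at \<delta> \<epsilon> w}"

text \<open>An edge of the compactified curve; unbounded edges acquire a vertex on the boundary.\<close>
definition compact_edge :: "plane set set \<Rightarrow> plane set \<Rightarrow> toric_point set" where
  "compact_edge \<Sigma> e = toric_surface \<Sigma> closure_of (toric_incl ` e)"

definition real_part :: "lat set \<Rightarrow> (lat \<Rightarrow> real) \<Rightarrow> (lat \<Rightarrow> int) \<Rightarrow> (reflection \<times> toric_point) set set" where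
  "real_part A a \<delta> =
     (let D = newton_polygon A in
      real_toric_surface D closure_of
        (\<Union>e\<in>trop_edges A a. \<Union>\<epsilon>\<in>real_phase A a \<delta> e.
           (\<lambda>p. real_proj D (\<epsilon>, p)) ` compact_edge (dual_fan D) e))"

definition is_oval :: "'a topology \<Rightarrow> 'a set \<Rightarrow> bool" where
  "is_oval X S \<longleftrightarrow> card (connected_components_of (subtopology X (topspace X - S))) = 2"

end

theory Submission
  imports Defs
begin

text \<open>
  The polygon is \<open>t + 2k T\<close> for a unimodular triangle \<open>T\<close> with vertices
  \<open>h\<^sub>1 = 0, h\<^sub>2, h\<^sub>3\<close>. A point \<open>p\<close> in the copy \<open>\<epsilon>\<close> of the plane gets the homogeneous coordinates
  \<open>X\<^sub>i = (-1)^(\<epsilon> \<cdot> h\<^sub>i) exp (h\<^sub>i \<cdot> p)\<close>; letting coordinates vanish adds the boundary strata, and the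
  copies of a point of a stratum are identified exactly if the signs of the surviving coordinates
  agree up to a common factor. So the real toric surface is the real projective plane, the
  quotient of \<open>\<real>\<^sup>3 - {0}\<close> by scaling (\<open>quotient_\<Psi>\<close>, \<open>\<Psi>_eq_iff\<close>).

  An exponent \<open>v\<close> of the tropical polynomial has barycentric coordinates \<open>n\<^sub>i(v)\<close> of sum \<open>2k\<close>, and
  the real monomial \<open>\<delta>(v) exp (a(v)) X^n(v)\<close> is, in every copy and up to a factor common to all
  \<open>v\<close>, the exponential of the tropical monomial with the sign of the symmetric copy of \<open>v\<close>. Let
  \<open>F\<close> be the maximum plus the minimum of these monomials. It vanishes where the largest absolute
  value is attained with both signs, and this is the real part of the curve (\<open>real_part_eq\<close>).
  Since \<open>2k\<close> is even, the sign of \<open>F\<close> is invariant under scaling: the real part is the common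
  boundary of the regions \<open>F > 0\<close> and \<open>F < 0\<close> of the projective plane. A pseudo-line cannot be
  two-sided, and this is what makes every component an oval.

  To see it directly, let \<open>Q\<close> be a component. The sign of \<open>F\<close> co-orients \<open>Q\<close>, so that collapsing the
  outside of a neighbourhood of \<open>Q\<close> gives a map from the projective plane to the circle. It lifts to a
  real function \<open>L\<close>, because \<open>\<real>\<^sup>3 - {0}\<close> is simply connected and an antipodal period would be its own
  negative (\<open>homogeneous_circle_map_lifts\<close>). Now \<open>L\<close> is constant on \<open>Q\<close>, takes that value nowhere
  else, and exceeds it on one side of \<open>Q\<close> only, so the complement is disconnected
  (\<open>not_connected_complement\<close>). It has only two components because near each point of
  \<open>Q\<close> each of the two sides is connected, and \<open>Q\<close> is connected (\<open>is_oval_component\<close>).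

  The local structure comes from nonsingularity: the exponents that are active at a point are
  among the vertices of a triangle of area 1/2 (\<open>active_subset_unimodular_triangle\<close>), so the logarithms of
  the dominant monomials are affinely independent near the point, also at the boundary. In
  logarithmic coordinates the sides of \<open>Q\<close> are then unions of convex cones with a common point
  (\<open>local_sides\<close>).\<close>

section \<open>Circle-valued maps on projective space\<close>

lemma constant_on_if_cis_eq_1:
  fixes f :: "'a::topological_space \<Rightarrow> real"
  assumes "connected S" and contf: "continuous_on S f"
    and cis1: "\<And>x. x \<in> S \<Longrightarrow> cis (f x) = 1"
  shows "f constant_on S"
proof (rule continuous_discrete_range_constant[OF assms(1) contf])
  fix x assume x: "x \<in> S"
  have int: "\<exists>n::int. f y = 2 * pi * n" if "y \<in> S" for y
    using cis1[OF that] sin_cos_eq_iff[of "f y" 0] by (simp add: complex_eq_iff)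
  have "2 * pi \<le> norm (f y - f x)" if y: "y \<in> S" "f y \<noteq> f x" for y
  proof -
    obtain m n :: int where mn: "f y = 2 * pi * m" "f x = 2 * pi * n"
      using int x y(1) by metis
    then have "m \<noteq> n" using y by auto
    then have "1 \<le> \<bar>real_of_int (m - n)\<bar>" by linarith
    moreover have "f y - f x = 2 * pi * (m - n)" using mn by (simp add: algebra_simps)
    ultimately show ?thesis by (simp add: abs_mult)
  qed
  then show "\<exists>e>0. \<forall>y. y \<in> S \<and> f y \<noteq> f x \<longrightarrow> e \<le> norm (f y - f x)"
    using pi_gt_zero by (intro exI[of _ "2 * pi"]) auto
qed

text \<open>This is the vanishing of the integral first cohomology of projective space. A lift exists
  since the punctured space is simply connected. The difference \<open>L (- x) - L x\<close> is a
  multiple of \<open>2\<pi>\<close>, hence constant, and it changes sign when \<open>x\<close> is replaced by \<open>- x\<close>; so it is 0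
  and the lift is even.\<close>
lemma homogeneous_circle_map_lifts:
  fixes \<theta> :: "'a::euclidean_space \<Rightarrow> complex"
  assumes dim: "3 \<le> DIM('a)" and cont: "continuous_on (- {0}) \<theta>"
    and circle: "\<And>x. x \<noteq> 0 \<Longrightarrow> norm (\<theta> x) = 1"
    and hom: "\<And>x c. x \<noteq> 0 \<Longrightarrow> c \<noteq> 0 \<Longrightarrow> \<theta> (c *\<^sub>R x) = \<theta> x"
  obtains L :: "'a \<Rightarrow> real" where "continuous_on (- {0}) L" "\<And>x. x \<noteq> 0 \<Longrightarrow> \<theta> x = cis (L x)"
    "\<And>x c. x \<noteq> 0 \<Longrightarrow> c \<noteq> 0 \<Longrightarrow> L (c *\<^sub>R x) = L x"
proof -
  have nz: "\<theta> x \<noteq> 0" if "x \<in> - {0}" for x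
    using circle[of x] that by auto
  obtain g where g: "continuous_on (- {0}) g" "\<And>x. x \<in> - {0} \<Longrightarrow> \<theta> x = exp (g x)"
    using continuous_logarithm_on_simply_connected[OF cont simply_connected_punctured_universe[OF dim] _ nz]
    by (metis open_imp_locally_path_connected open_Compl closed_singleton)
  define L where "L x = Im (g x)" for x
  have contL: "continuous_on (- {0}) L"
    unfolding L_def by (intro continuous_intros g)
  have lift: "\<theta> x = cis (L x)" if "x \<noteq> 0" for x
  proof -
    have "norm (exp (g x)) = 1" using circle[OF that] g(2)[of x] that by simp
    then have "Re (g x) = 0" by simp
    then show ?thesis using g(2)[of x] that by (simp add: exp_eq_polar L_def)
  qed
  have diff1: "cis (L (c *\<^sub>R x) - L x) = 1" if "x \<noteq> 0" "c \<noteq> 0" for x c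
    using hom[OF that] lift[of x] lift[of "c *\<^sub>R x"] that by (simp flip: cis_divide)
  have pos: "L (c *\<^sub>R x) = L x" if "x \<noteq> 0" "c > 0" for x c
  proof -
    have "continuous_on {0<..} (\<lambda>c. L (c *\<^sub>R x) - L x)"
      by (intro continuous_intros continuous_on_compose2[OF contL]) (use that in auto)
    then have "(\<lambda>c. L (c *\<^sub>R x) - L x) constant_on {0<..}"
      by (rule constant_on_if_cis_eq_1[rotated]) (use diff1 that in auto)
    then have "L (c *\<^sub>R x) - L x = L (1 *\<^sub>R x) - L x"
      using that unfolding constant_on_def by (metis greaterThan_iff zero_less_one)
    then show ?thesis by simp
  qed
  have neg: "L (- x) = L x" if "x \<noteq> 0" for x
  proof -
    have "connected (- {0::'a})"
      by (rule connected_punctured_universe) (use dim in auto)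
    moreover have "continuous_on (- {0}) (\<lambda>x. L (- x) - L x)"
      by (intro continuous_intros contL continuous_on_compose2[OF contL]) auto
    ultimately have "(\<lambda>x. L (- x) - L x) constant_on - {0}"
      by (rule constant_on_if_cis_eq_1) (use diff1[of _ "-1"] in auto)
    then have "L (- x) - L x = L (- (- x)) - L (- x)"
      using that unfolding constant_on_def by (metis ComplI neg_equal_0_iff_equal singletonD)
    then show ?thesis by simp
  qed
  have "L (c *\<^sub>R x) = L x" if "x \<noteq> 0" "c \<noteq> 0" for x c
    using that pos[of x c] pos[of x "-c"] neg[of "c *\<^sub>R x"] by (cases "c > 0") auto
  with contL lift that show thesis by blast
qed

section \<open>Complements of components of a two-sided hypersurface\<close>

lemma infdist_scaleR:
  fixes S :: "'a::euclidean_space set"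
  assumes S: "closed S" "S \<noteq> {}" and cone: "\<And>x c. x \<in> S \<Longrightarrow> c *\<^sub>R x \<in> S"
  shows "infdist (c *\<^sub>R x) S = \<bar>c\<bar> * infdist x S"
proof -
  have le: "infdist (c *\<^sub>R x) S \<le> \<bar>c\<bar> * infdist x S" for c x
  proof -
    obtain y where y: "y \<in> S" "infdist x S = dist x y"
      using infdist_attains_inf[OF S] by metis
    have "infdist (c *\<^sub>R x) S \<le> dist (c *\<^sub>R x) (c *\<^sub>R y)"
      using cone y by (intro infdist_le) auto
    also have "\<dots> = \<bar>c\<bar> * dist x y"
      by (simp add: dist_norm flip: scaleR_diff_right)
    finally show ?thesis using y by simp
  qed
  show ?thesis
  proof (cases "c = 0")
    case True
    then have "c *\<^sub>R x \<in> S" using S cone[of _ 0] by auto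
    then show ?thesis using True by simp
  next
    case False
    then have "infdist x S \<le> inverse \<bar>c\<bar> * infdist (c *\<^sub>R x) S"
      using le[of "inverse c" "c *\<^sub>R x"] by simp
    then show ?thesis
      using le[of c x] False by (simp add: field_simps)
  qed
qed

text \<open>The space \<open>X\<close> is a projective space with homogeneous coordinates \<open>\<Psi>\<close>, and \<open>F = 0\<close> is a
  hypersurface whose sides are globally distinguished by the sign of \<open>F\<close>. The variable \<open>s\<close> ranges
  over the two signs here and below.\<close>
locale two_sided_hypersurface =
  fixes X :: "'b topology" and \<Psi> :: "'a::euclidean_space \<Rightarrow> 'b" and F :: "'a \<Rightarrow> real"
  assumes dim: "3 \<le> DIM('a)"
    and quot: "quotient_map (top_of_set (- {0})) X \<Psi>"
    and fibre: "\<And>x y. x \<noteq> 0 \<Longrightarrow> y \<noteq> 0 \<Longrightarrow> \<Psi> x = \<Psi> y \<longleftrightarrow> (\<exists>c. y = c *\<^sub>R x)"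
    and contF: "continuous_on (- {0}) F"
    and sgnF: "\<And>x c. x \<noteq> 0 \<Longrightarrow> c \<noteq> 0 \<Longrightarrow> sgn (F (c *\<^sub>R x)) = sgn (F x)"
    and local_sides: "\<And>q V. q \<noteq> 0 \<Longrightarrow> F q = 0 \<Longrightarrow> open V \<Longrightarrow> q \<in> V \<Longrightarrow>
      \<exists>N. open N \<and> q \<in> N \<and> N \<subseteq> V \<and> connected {x \<in> N. F x = 0} \<and>
        (\<forall>s\<in>{1, -1}. connected {x \<in> N. s * F x > 0} \<and> {x \<in> N. s * F x > 0} \<noteq> {})"
begin

definition zeros :: "'a set" where "zeros = {x. x \<noteq> 0 \<and> F x = 0}"

lemma topspace_eq: "topspace X = \<Psi> ` (- {0})"
  using quotient_imp_surjective_map[OF quot] by simp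

lemma \<Psi>_scaleR: "x \<noteq> 0 \<Longrightarrow> c \<noteq> 0 \<Longrightarrow> \<Psi> (c *\<^sub>R x) = \<Psi> x"
  by (metis fibre scale_eq_0_iff)

lemma continuous_\<Psi>: "continuous_map (top_of_set (- {0})) X \<Psi>"
  by (rule quotient_imp_continuous_map[OF quot])

lemma open_image:
  assumes "open N"
  shows "openin X (\<Psi> ` (N - {0}))"
proof -
  have eq: "{x \<in> - {0}. \<Psi> x \<in> \<Psi> ` (N - {0})} = (\<Union>c\<in>-{0}. (*\<^sub>R) c ` (N - {0}))"
  proof (intro equalityI subsetI)
    fix x assume "x \<in> {x \<in> - {0}. \<Psi> x \<in> \<Psi> ` (N - {0})}"
    then have x: "x \<noteq> 0" "\<Psi> x \<in> \<Psi> ` (N - {0})" by simp_all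
    from x(2) obtain y where "\<Psi> x = \<Psi> y" "y \<in> N - {0}" by (rule imageE)
    then have y: "x \<noteq> 0" "y \<in> N" "y \<noteq> 0" "\<Psi> y = \<Psi> x" using x by auto
    then obtain c where "x = c *\<^sub>R y" using fibre by metis
    then show "x \<in> (\<Union>c\<in>-{0}. (*\<^sub>R) c ` (N - {0}))" using y by auto
  qed (auto simp: \<Psi>_scaleR)
  have "open (\<Union>c\<in>-{0}. (*\<^sub>R) c ` (N - {0}))"
    using assms by (intro open_UN ballI open_scaling open_delete) auto
  then have "openin (top_of_set (- {0})) {x \<in> - {0}. \<Psi> x \<in> \<Psi> ` (N - {0})}"
    unfolding eq by (intro openin_open_eq[THEN iffD2]) auto
  moreover have "\<Psi> ` (N - {0}) \<subseteq> topspace X" by (auto simp: topspace_eq)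
  ultimately show ?thesis
    using quot unfolding quotient_map_def by auto
qed

lemma connectedin_image:
  assumes "connected S" "0 \<notin> S"
  shows "connectedin X (\<Psi> ` S)"
  by (rule connectedin_continuous_map_image[OF continuous_\<Psi>])
     (use assms in \<open>auto simp: connectedin_subtopology\<close>)

end

locale two_sided_component = two_sided_hypersurface X \<Psi> F
  for X :: "'b topology" and \<Psi> :: "'a::euclidean_space \<Rightarrow> 'b" and F :: "'a \<Rightarrow> real" +
  fixes Q :: "'b set"
  assumes Q: "Q \<in> connected_components_of (subtopology X (\<Psi> ` zeros))"
begin

text \<open>The component \<open>Q\<close> is studied through its cone in the vector space, where the local conditions
  are stated.\<close>
definition "lift_Q = {x. x \<noteq> 0 \<and> \<Psi> x \<in> Q}"

lemma zeros_scaleR: "x \<in> zeros \<Longrightarrow> c \<noteq> 0 \<Longrightarrow> c *\<^sub>R x \<in> zeros"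
  using sgnF[of x c] by (auto simp: zeros_def sgn_0_0)

lemma connectedin_Q: "connectedin X Q"
  using connectedin_connected_components_of[OF Q] by (simp add: connectedin_subtopology)

lemma Q_subset: "Q \<subseteq> \<Psi> ` zeros"
  using connected_components_of_subset[OF Q] by auto

lemma Q_maximal: "connectedin X S \<Longrightarrow> S \<subseteq> \<Psi> ` zeros \<Longrightarrow> S \<inter> Q \<noteq> {} \<Longrightarrow> S \<subseteq> Q"
  using connected_components_of_maximal[OF Q, of S]
  by (auto simp: connectedin_subtopology disjnt_def)

lemma lift_Q_scaleR: "x \<in> lift_Q \<Longrightarrow> c \<noteq> 0 \<Longrightarrow> c *\<^sub>R x \<in> lift_Q"
  by (auto simp: lift_Q_def \<Psi>_scaleR)

lemma lift_Q_subset: "lift_Q \<subseteq> zeros"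
proof
  fix x assume "x \<in> lift_Q"
  then obtain y where y: "y \<in> zeros" "\<Psi> y = \<Psi> x" "x \<noteq> 0" "y \<noteq> 0"
    using Q_subset by (auto simp: lift_Q_def zeros_def)
  then obtain c where "x = c *\<^sub>R y" using fibre by metis
  then show "x \<in> zeros" using y zeros_scaleR[of y c] by auto
qed

lemma mem_Q: "y \<in> Q \<longleftrightarrow> (\<exists>x\<in>lift_Q. y = \<Psi> x)"
  using Q_subset by (auto simp: lift_Q_def zeros_def)

lemma lift_Q_nonempty: "lift_Q \<noteq> {}"
  using nonempty_connected_components_of[OF Q] mem_Q by auto

text \<open>Small neighbourhoods do not meet different components, because the zero set is locally
  connected. In particular \<open>Q\<close> is relatively open in the zero set.\<close>
lemma zeros_local:
  assumes q: "q \<in> zeros" and V: "open V" "q \<in> V"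
  shows "\<exists>N. open N \<and> q \<in> N \<and> N \<subseteq> V \<and> 0 \<notin> N \<and> (if q \<in> lift_Q then N \<inter> zeros \<subseteq> lift_Q else N \<inter> lift_Q = {}) \<and>
        (\<forall>s\<in>{1, -1}. connected {x \<in> N. s * F x > 0} \<and> {x \<in> N. s * F x > 0} \<noteq> {})"
proof -
  have "open (V - {0})" "q \<in> V - {0}" "q \<noteq> 0" "F q = 0"
    using q V by (auto simp: zeros_def)
  from local_sides[OF this(3,4,1,2)]
  obtain N where N: "open N" "q \<in> N" "N \<subseteq> V - {0}" "connected {x \<in> N. F x = 0}"
     "(\<forall>s\<in>{1, -1}. connected {x \<in> N. s * F x > 0} \<and> {x \<in> N. s * F x > 0} \<noteq> {})" by blast
  have eq: "{x \<in> N. F x = 0} = N \<inter> zeros" using N by (auto simp: zeros_def)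
  have con: "connectedin X (\<Psi> ` (N \<inter> zeros))"
    using N(3,4) eq by (intro connectedin_image) auto
  have sub: "N \<inter> zeros \<subseteq> lift_Q" if "N \<inter> zeros \<inter> lift_Q \<noteq> {}"
  proof -
    have "\<Psi> ` (N \<inter> zeros) \<subseteq> Q"
      by (rule Q_maximal[OF con]) (use that in \<open>auto simp: lift_Q_def\<close>)
    then show ?thesis by (auto simp: lift_Q_def zeros_def)
  qed
  have "if q \<in> lift_Q then N \<inter> zeros \<subseteq> lift_Q else N \<inter> lift_Q = {}"
    using sub q N(2) lift_Q_subset by auto
  then show ?thesis using N by (intro exI[of _ N]) auto
qed

text \<open>Connectedness of \<open>Q\<close>, in the form in which it propagates a local property along the cone over \<open>Q\<close>,
  which itself may be disconnected.\<close>
lemma saturated_clopen: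
  assumes U: "U \<subseteq> lift_Q" "U \<noteq> {}" and cone: "\<And>x c. x \<in> U \<Longrightarrow> c \<noteq> 0 \<Longrightarrow> c *\<^sub>R x \<in> U"
    and loc: "\<And>x. x \<in> lift_Q \<Longrightarrow> \<exists>N. open N \<and> x \<in> N \<and> (N \<inter> lift_Q \<subseteq> U \<or> N \<inter> U = {})"
  shows "U = lift_Q"
proof (rule ccontr)
  assume ne: "U \<noteq> lift_Q"
  \<comment> \<open>Open sets of the projective space that separate \<open>U\<close> from the rest of the cone over \<open>Q\<close>.\<close>
  define W where "W P = (\<Union>N\<in>{N. open N \<and> N \<inter> lift_Q \<subseteq> P}. \<Psi> ` (N - {0}))" for P
  have op: "openin X (W P)" for P
    unfolding W_def by (rule openin_Union) (auto intro: open_image)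
  have sub: "x \<in> P" if x: "x \<in> lift_Q" "\<Psi> x \<in> W P" and P: "P = U \<or> P = lift_Q - U" for x P
  proof -
    obtain N y where N: "N \<inter> lift_Q \<subseteq> P" "y \<in> N" "y \<noteq> 0" "\<Psi> x = \<Psi> y"
      using x(2) by (auto simp: W_def)
    then have "y \<in> lift_Q" using x(1) by (auto simp: lift_Q_def)
    then have "y \<in> P" using N by auto
    moreover obtain c where c: "x = c *\<^sub>R y" using N x(1) fibre[of y x] by (auto simp: lift_Q_def)
    moreover have "c \<noteq> 0" using c x(1) by (auto simp: lift_Q_def)
    moreover have "y = inverse c *\<^sub>R x" using c \<open>c \<noteq> 0\<close> by simp
    ultimately show ?thesis using x(1) P cone[of y c] cone[of x "inverse c"]
      by (metis DiffE DiffI inverse_nonzero_iff_nonzero)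
  qed
  have mem: "\<Psi> x \<in> W P" if P: "x \<in> P" "P = U \<or> P = lift_Q - U" for x P
  proof -
    obtain N where "open N" "x \<in> N" "N \<inter> lift_Q \<subseteq> U \<or> N \<inter> U = {}"
      using P loc[of x] U by blast
    moreover have "x \<noteq> 0" using P U by (auto simp: lift_Q_def)
    ultimately show ?thesis
      using P unfolding W_def by (intro UN_I[of N] imageI) auto
  qed
  have "\<Psi> x \<in> W U \<union> W (lift_Q - U)" if "x \<in> lift_Q" for x
    using mem[of x U] mem[of x "lift_Q - U"] that by (cases "x \<in> U") auto
  then have c1: "Q \<subseteq> W U \<union> W (lift_Q - U)"
    by (metis mem_Q subsetI)
  have c2: "W U \<inter> W (lift_Q - U) \<inter> Q = {}"
    using sub[of _ U] sub[of _ "lift_Q - U"] by (fastforce simp: mem_Q)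
  have c3: "W P \<inter> Q \<noteq> {}" if P: "P = U \<or> P = lift_Q - U" for P
  proof -
    obtain x where "x \<in> P" using P U ne by blast
    then have "\<Psi> x \<in> W P \<inter> Q" using P U mem by (auto simp: mem_Q)
    then show ?thesis by auto
  qed
  have "\<exists>E1 E2. openin X E1 \<and> openin X E2 \<and> Q \<subseteq> E1 \<union> E2 \<and> E1 \<inter> E2 \<inter> Q = {} \<and>
      E1 \<inter> Q \<noteq> {} \<and> E2 \<inter> Q \<noteq> {}"
    by (intro exI[of _ "W U"] exI[of _ "W (lift_Q - U)"] conjI op c1 c2 c3) simp_all
  then show False
    using connectedin_Q unfolding connectedin by (elim conjE) (rule notE)
qed

abbreviation "rest \<equiv> subtopology X (topspace X - Q)"

lemma closed_parts:
  shows "closed (insert 0 lift_Q)" "closed (insert 0 (zeros - lift_Q))"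
proof -
  have sep: "\<exists>N. open N \<and> x \<in> N \<and> N \<inter> P = {}"
    if "x \<noteq> 0" "x \<notin> P" "P = lift_Q \<or> P = zeros - lift_Q" for x P
  proof (cases "F x = 0")
    case True
    then have "x \<in> zeros" using that by (auto simp: zeros_def)
    from zeros_local[OF this open_UNIV UNIV_I] obtain N where N: "open N" "x \<in> N" "if x \<in> lift_Q then N \<inter> zeros \<subseteq> lift_Q else N \<inter> lift_Q = {}"
      by (elim exE conjE)
    have "N \<inter> P = {}"
      using that N \<open>x \<in> zeros\<close> by (cases "x \<in> lift_Q") auto
    then show ?thesis using N by auto
  next
    case False
    have "open (- {0} \<inter> F -` (- {0}))"
      by (rule continuous_open_preimage[OF contF]) (simp_all add: open_Compl)
    moreover have "x \<in> - {0} \<inter> F -` (- {0})" using that(1) False by simp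
    moreover have "(- {0} \<inter> F -` (- {0})) \<inter> P = {}" using that(3) lift_Q_subset by (auto simp: zeros_def)
    ultimately show ?thesis by blast
  qed
  have *: "closed (insert 0 P)" if P: "P = lift_Q \<or> P = zeros - lift_Q" for P
    unfolding closed_def
  proof (subst open_subopen, intro ballI)
    fix x assume "x \<in> - insert 0 P"
    then obtain N where "open N" "x \<in> N" "N \<inter> P = {}"
      using sep[of x P] P by auto
    then show "\<exists>T. open T \<and> x \<in> T \<and> T \<subseteq> - insert 0 P"
      using \<open>x \<in> - insert 0 P\<close> by (intro exI[of _ "N - {0}"]) auto
  qed
  show "closed (insert 0 lift_Q)" "closed (insert 0 (zeros - lift_Q))"
    using *[of lift_Q] *[of "zeros - lift_Q"] by simp_all
qed

text \<open>A homogeneous Urysohn function: 0 exactly on the cone over \<open>Q\<close> and 1 on the rest of the zero set.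
  The origin is added to both sets to make them closed and nonempty.\<close>
definition phase :: "'a \<Rightarrow> real" where
  "phase x = infdist x (insert 0 lift_Q) / (infdist x (insert 0 lift_Q) + infdist x (insert 0 (zeros - lift_Q)))"

lemma phase_denominator:
  assumes "x \<noteq> 0"
  shows "infdist x (insert 0 lift_Q) + infdist x (insert 0 (zeros - lift_Q)) > 0"
proof (rule ccontr)
  assume "\<not> ?thesis"
  then have "infdist x (insert 0 lift_Q) = 0" "infdist x (insert 0 (zeros - lift_Q)) = 0"
    using infdist_nonneg[of x "insert 0 lift_Q"] infdist_nonneg[of x "insert 0 (zeros - lift_Q)"]
    by linarith+
  then have "x \<in> insert 0 lift_Q" "x \<in> insert 0 (zeros - lift_Q)"
    using closed_parts in_closed_iff_infdist_zero by blast+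
  then show False using assms by auto
qed

lemma phase_bounds: "x \<noteq> 0 \<Longrightarrow> 0 \<le> phase x" "x \<noteq> 0 \<Longrightarrow> phase x \<le> 1"
  using phase_denominator[of x] infdist_nonneg[of x "insert 0 lift_Q"] infdist_nonneg[of x "insert 0 (zeros - lift_Q)"]
  by (auto simp: phase_def field_simps)

lemma phase_eq_0: "x \<noteq> 0 \<Longrightarrow> phase x = 0 \<longleftrightarrow> x \<in> lift_Q"
  using phase_denominator[of x] closed_parts(1) in_closed_iff_infdist_zero[of "insert 0 lift_Q" x]
  by (simp add: phase_def)

lemma phase_eq_1:
  assumes "x \<in> zeros - lift_Q" shows "phase x = 1"
proof -
  have "infdist x (insert 0 (zeros - lift_Q)) = 0" using assms by simp
  moreover have "x \<noteq> 0" using assms by (simp add: zeros_def)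
  ultimately show ?thesis using phase_denominator[of x] by (simp add: phase_def)
qed

lemma phase_scaleR:
  assumes "c \<noteq> 0" shows "phase (c *\<^sub>R x) = phase x"
proof -
  have "infdist (c *\<^sub>R x) (insert 0 lift_Q) = \<bar>c\<bar> * infdist x (insert 0 lift_Q)"
    by (rule infdist_scaleR[OF closed_parts(1)]) (use lift_Q_scaleR in fastforce)+
  moreover have "infdist (c *\<^sub>R x) (insert 0 (zeros - lift_Q)) = \<bar>c\<bar> * infdist x (insert 0 (zeros - lift_Q))"
  proof (rule infdist_scaleR[OF closed_parts(2)])
    fix y d assume y: "y \<in> insert 0 (zeros - lift_Q)"
    show "d *\<^sub>R y \<in> insert 0 (zeros - lift_Q)"
    proof (cases "d = 0 \<or> y = 0")
      case False
      then have "d *\<^sub>R y \<in> zeros" using y zeros_scaleR by auto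
      moreover have "d *\<^sub>R y \<notin> lift_Q"
        using y False lift_Q_scaleR[of "d *\<^sub>R y" "inverse d"] by auto
      ultimately show ?thesis by simp
    qed auto
  qed simp
  ultimately show ?thesis
    using assms by (simp add: phase_def flip: distrib_left)
qed

lemma continuous_phase: "continuous_on (- {0}) phase"
  unfolding phase_def using phase_denominator by (intro continuous_intros) force

text \<open>The second coordinate of the collapse map to the circle. The jump of the sign of \<open>F\<close> is
  harmless: on the zero set the phase is 0 or 1, where the sine vanishes.\<close>
definition side :: "'a \<Rightarrow> real" where "side x = sgn (F x) * sin (pi * phase x)"

lemma continuous_side: "continuous_on (- {0}) side"
proof (subst continuous_on_eq_continuous_at)
  have cont_at: "isCont f x" if "continuous_on (- {0}) f" "x \<noteq> 0" for f :: "'a \<Rightarrow> real" and x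
    using that by (simp add: continuous_on_eq_continuous_at open_Compl)
  show "\<forall>x\<in>- {0}. isCont side x"
  proof
  fix x :: 'a assume x: "x \<in> - {0}"
  have sin: "(\<lambda>y. sin (pi * phase y)) \<midarrow>x\<rightarrow> sin (pi * phase x)"
    using cont_at[OF continuous_phase, of x] x by (intro tendsto_intros) (simp add: isCont_def)
  have F: "F \<midarrow>x\<rightarrow> F x"
    using cont_at[OF contF, of x] x by (simp add: isCont_def)
  show "isCont side x"
  proof (cases "F x = 0")
    case True
    then have zero: "sin (pi * phase x) = 0"
      using x phase_eq_0[of x] phase_eq_1[of x] by (cases "x \<in> lift_Q") (auto simp: zeros_def)
    have "side \<midarrow>x\<rightarrow> 0"
    proof (rule Lim_null_comparison)
      show "(\<lambda>y. \<bar>sin (pi * phase y)\<bar>) \<midarrow>x\<rightarrow> 0"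
        using tendsto_rabs[OF sin] zero by simp
      show "\<forall>\<^sub>F y in at x. norm (side y) \<le> \<bar>sin (pi * phase y)\<bar>"
        by (rule always_eventually) (auto simp: side_def abs_mult sgn_if)
    qed
    then show ?thesis using zero by (simp add: isCont_def side_def)
  next
    case False
    have "side \<midarrow>x\<rightarrow> side x"
      unfolding side_def by (intro tendsto_intros sin tendsto_sgn F False)
    then show ?thesis by (simp add: isCont_def)
  qed
  qed
qed (simp add: open_Compl)

text \<open>The Pontryagin-Thom collapse for the co-orientation of \<open>Q\<close> by the sign of \<open>F\<close>, with values
  \<open>cis (\<plusminus> \<pi> phase)\<close>. It has the value 1 exactly on the cone over \<open>Q\<close>, so a lift is constant there
  and takes this value nowhere else; near \<open>Q\<close> it is larger than the constant where \<open>F\<close> is positive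
  and smaller where \<open>F\<close> is negative.\<close>
lemma not_connected_complement: "\<not> connected_space rest"
proof -
  define \<theta> where "\<theta> x = Complex (cos (pi * phase x)) (side x)" for x
  have "continuous_on (- {0}) \<theta>"
    unfolding \<theta>_def Complex_eq by (intro continuous_intros continuous_side continuous_phase)
  moreover have "norm (\<theta> x) = 1" if "x \<noteq> 0" for x
  proof (cases "F x = 0")
    case True
    then show ?thesis
      using that phase_eq_0[of x] phase_eq_1[of x]
      by (cases "x \<in> lift_Q") (auto simp: zeros_def \<theta>_def side_def complex_norm)
  next
    case False
    then show ?thesis
      by (simp add: \<theta>_def side_def complex_norm power_mult_distrib sgn_if)
  qed
  moreover have "\<theta> (c *\<^sub>R x) = \<theta> x" if "x \<noteq> 0" "c \<noteq> 0" for x c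
    using that sgnF[of x c] by (simp add: \<theta>_def side_def phase_scaleR)
  ultimately obtain L where L: "continuous_on (- {0}) L" "\<And>x. x \<noteq> 0 \<Longrightarrow> \<theta> x = cis (L x)"
    "\<And>x c. x \<noteq> 0 \<Longrightarrow> c \<noteq> 0 \<Longrightarrow> L (c *\<^sub>R x) = L x"
    using homogeneous_circle_map_lifts[OF dim] by metis
  have \<theta>1: "\<theta> x = 1 \<longleftrightarrow> x \<in> lift_Q" if "x \<noteq> 0" for x
  proof
    assume "\<theta> x = 1"
    then have "cos (pi * phase x) = cos 0" by (simp add: \<theta>_def complex_eq_iff)
    moreover have "0 \<le> pi * phase x" "pi * phase x \<le> pi"
      using phase_bounds[OF that] by (simp_all add: mult_left_le)
    ultimately have "pi * phase x = 0"
      using cos_inj_pi[of "pi * phase x" 0] by simp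
    then show "x \<in> lift_Q" using phase_eq_0[OF that] by simp
  next
    assume "x \<in> lift_Q"
    then show "\<theta> x = 1"
      using phase_eq_0[OF that] by (simp add: \<theta>_def side_def complex_eq_iff)
  qed
  have int: "\<exists>n::int. L x = 2 * pi * n" if "x \<in> lift_Q" for x
    using that \<theta>1[of x] L(2)[of x] sin_cos_eq_iff[of "L x" 0] by (auto simp: lift_Q_def complex_eq_iff)
  obtain q where q: "q \<in> lift_Q" using lift_Q_nonempty by auto
  have nz: "x \<noteq> 0" if "x \<in> lift_Q" for x using that by (simp add: lift_Q_def)
  define c where "c = L q"
  have near: "\<exists>N. open N \<and> x \<in> N \<and> 0 \<notin> N \<and> (\<forall>y\<in>N. \<bar>L y - L x\<bar> < pi)" if "x \<noteq> 0" for x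
  proof -
    have "open (- {0} \<inter> L -` ball (L x) pi)"
      by (rule continuous_open_preimage[OF L(1)]) (simp_all add: open_Compl)
    then show ?thesis
      using that by (intro exI[of _ "- {0} \<inter> L -` ball (L x) pi"]) (auto simp: dist_real_def abs_minus_commute)
  qed
  have "{x \<in> lift_Q. L x = c} = lift_Q"
  proof (rule saturated_clopen)
    show "{x \<in> lift_Q. L x = c} \<noteq> {}" using q c_def by auto
  next
    fix x assume x: "x \<in> lift_Q"
    from near[OF nz[OF x]] obtain N where N: "open N" "x \<in> N" "\<And>y. y \<in> N \<Longrightarrow> \<bar>L y - L x\<bar> < pi"
      by auto
    have "L y = c \<longleftrightarrow> L x = c" if y: "y \<in> N" "y \<in> lift_Q" for y
    proof -
      obtain m n :: int where mn: "L y = 2 * pi * m" "L x = 2 * pi * n"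
        using int x y by metis
      have "\<bar>2 * pi * (m - n)\<bar> < pi" using N(3)[OF y(1)] mn by (simp add: algebra_simps)
      then have "pi * (2 * \<bar>real_of_int (m - n)\<bar>) < pi * 1" by (simp add: abs_mult)
      then have "2 * \<bar>real_of_int (m - n)\<bar> < 1"
        using pi_gt_zero mult_less_cancel_left_pos by blast
      then have "real_of_int \<bar>m - n\<bar> < 1" by simp
      then have "\<bar>m - n\<bar> < 1" by (simp only: of_int_less_1_iff)
      then have "m = n" by simp
      then show ?thesis using mn by simp
    qed
    then show "\<exists>N. open N \<and> x \<in> N \<and> (N \<inter> lift_Q \<subseteq> {x \<in> lift_Q. L x = c} \<or> N \<inter> {x \<in> lift_Q. L x = c} = {})"
      using N(1,2) by (intro exI[of _ N]) (cases "L x = c"; auto)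
  qed (use L(3) lift_Q_scaleR nz in auto)
  then have Lc: "L x = c" if "x \<in> lift_Q" for x using that by blast
  have cisc: "cis c = 1" using L(2)[OF nz[OF q]] \<theta>1[OF nz[OF q]] q c_def by simp
  have Lc_iff: "L x = c \<longleftrightarrow> x \<in> lift_Q" if "x \<noteq> 0" for x
    using Lc L(2)[OF that] \<theta>1[OF that] cisc by metis
  define P where "P s = {x. x \<noteq> 0 \<and> s * (L x - c) > 0}" for s :: real
  have open_P: "open (P s)" for s
  proof -
    have "open (- {0} \<inter> (\<lambda>x. s * (L x - c)) -` {0<..})"
      by (rule continuous_open_preimage) (intro continuous_intros L | simp add: open_Compl)+
    moreover have "- {0} \<inter> (\<lambda>x. s * (L x - c)) -` {0<..} = P s" by (auto simp: P_def)
    ultimately show ?thesis by simp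
  qed
  have op: "openin X (\<Psi> ` P s)" for s
    using open_image[OF open_P[of s]] by (simp add: P_def)
  have sub: "\<Psi> ` P s \<subseteq> topspace X - Q" for s
  proof
    fix y assume "y \<in> \<Psi> ` P s"
    then obtain x where x: "x \<in> P s" "y = \<Psi> x" by blast
    then have "x \<noteq> 0" "x \<notin> lift_Q" using Lc by (auto simp: P_def)
    then show "y \<in> topspace X - Q" using x by (auto simp: topspace_eq lift_Q_def)
  qed
  have op_rest: "openin rest (\<Psi> ` P s)" for s
    using op[of s] sub[of s] by (metis inf.absorb_iff2 openin_subtopology_Int2)
  have "P s \<noteq> {}" if s: "s \<in> {1, -1}" for s
  proof -
    obtain N where N: "open N" "q \<in> N" "0 \<notin> N" "\<And>y. y \<in> N \<Longrightarrow> \<bar>L y - L q\<bar> < pi"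
      using near[OF nz[OF q]] by auto
    have "q \<in> zeros" using q lift_Q_subset by auto
    from zeros_local[OF this N(1,2)] obtain N' where N': "N' \<subseteq> N" "N' \<inter> zeros \<subseteq> lift_Q"
        "\<forall>s\<in>{1, -1}. connected {x \<in> N'. s * F x > 0} \<and> {x \<in> N'. s * F x > 0} \<noteq> {}"
      using q by auto
    then have "{x \<in> N'. s * F x > 0} \<noteq> {}" using s by blast
    then obtain x where x: "x \<in> N" "s * F x > 0" using N' by blast
    have "x \<noteq> 0" using x N by auto
    have "x \<notin> zeros" using x by (auto simp: zeros_def)
    then have "0 < phase x" "x \<notin> lift_Q"
      using phase_bounds[OF \<open>x \<noteq> 0\<close>] phase_eq_0[OF \<open>x \<noteq> 0\<close>] lift_Q_subset by fastforce+
    have "cis (L x - c) = \<theta> x" using L(2)[OF \<open>x \<noteq> 0\<close>] cisc by (simp flip: cis_divide)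
    then have "sin (L x - c) = side x" by (simp add: \<theta>_def complex_eq_iff)
    then have sins: "s * sin (L x - c) = sin (pi * phase x)"
      using x s by (auto simp: side_def)
    have "sin (pi * phase x) \<ge> 0"
      using phase_bounds[OF \<open>x \<noteq> 0\<close>] by (intro sin_ge_zero) (auto simp: mult_left_le)
    have "L x \<noteq> c" using Lc_iff \<open>x \<noteq> 0\<close> \<open>x \<notin> lift_Q\<close> by simp
    \<comment> \<open>Within distance \<open>\<pi>\<close>, the sine has the sign of its argument.\<close>
    have "\<bar>L x - c\<bar> < pi" using N(4)[OF x(1)] c_def by simp
    have "s * (L x - c) > 0"
    proof (rule ccontr)
      assume "\<not> ?thesis"
      then have "s * (L x - c) < 0" using \<open>L x \<noteq> c\<close> s by auto
      then have "0 < - (s * (L x - c))" "- (s * (L x - c)) < pi"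
        using \<open>\<bar>L x - c\<bar> < pi\<close> s by auto
      then have "sin (- (s * (L x - c))) > 0" by (rule sin_gt_zero)
      then have "s * sin (L x - c) < 0" using s by (auto simp: sin_diff mult.commute)
      then show False using sins \<open>sin (pi * phase x) \<ge> 0\<close> by simp
    qed
    then show ?thesis using \<open>x \<noteq> 0\<close> by (auto simp: P_def)
  qed
  then have ne: "\<Psi> ` P 1 \<noteq> {}" "\<Psi> ` P (-1) \<noteq> {}" by auto
  have disj: "\<Psi> ` P 1 \<inter> \<Psi> ` P (-1) = {}"
  proof (rule ccontr)
    assume "\<not> ?thesis"
    then obtain x y where xy: "x \<in> P 1" "y \<in> P (-1)" "\<Psi> x = \<Psi> y" by blast
    then obtain d where d: "y = d *\<^sub>R x" using fibre[of x y] by (auto simp: P_def)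
    then have "L y = L x" using L(3)[of x d] xy by (auto simp: P_def)
    then show False using xy by (simp add: P_def)
  qed
  have cover: "topspace rest \<subseteq> \<Psi> ` P 1 \<union> \<Psi> ` P (-1)"
  proof
    fix y assume "y \<in> topspace rest"
    then obtain x where x: "y = \<Psi> x" "x \<noteq> 0" "x \<notin> lift_Q" by (auto simp: topspace_eq lift_Q_def)
    then have "L x \<noteq> c" using Lc_iff by simp
    then have "x \<in> P 1 \<or> x \<in> P (-1)" using x by (auto simp: P_def)
    then show "y \<in> \<Psi> ` P 1 \<union> \<Psi> ` P (-1)" using x by blast
  qed
  show ?thesis
    unfolding connected_space_def using op_rest[of 1] op_rest[of "-1"] ne disj cover by blast
qed

lemma topspace_rest: "topspace rest = \<Psi> ` (- insert 0 lift_Q)"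
proof
  show "topspace rest \<subseteq> \<Psi> ` (- insert 0 lift_Q)"
    by (auto simp: topspace_eq lift_Q_def)
  show "\<Psi> ` (- insert 0 lift_Q) \<subseteq> topspace rest"
    by (auto simp: topspace_eq lift_Q_def)
qed

lemma connectedin_rest_image:
  assumes "connected C" "C \<subseteq> - insert 0 lift_Q"
  shows "connectedin rest (\<Psi> ` C)"
  unfolding connectedin_subtopology
proof
  show "connectedin X (\<Psi> ` C)" using assms by (intro connectedin_image) auto
  show "\<Psi> ` C \<subseteq> topspace X - Q" using assms(2) by (auto simp: topspace_eq lift_Q_def)
qed

lemma component_subset:
  assumes "connectedin rest C" "x \<in> C" "x \<in> connected_component_of_set rest p"
  shows "C \<subseteq> connected_component_of_set rest p"
proof -
  have "connected_component_of rest p x" using assms(3) by simp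
  moreover have "connected_component_of rest x y" if "y \<in> C" for y
    using assms(1,2) that unfolding connected_component_of_def by blast
  ultimately show ?thesis by (metis connected_component_of_trans mem_Collect_eq subsetI)
qed

text \<open>Neighbouring points of \<open>Q\<close> have overlapping local sides, so the component of the complement
  which contains the local side is locally constant along \<open>Q\<close>.\<close>
lemma one_component_on_each_side:
  assumes N: "\<And>q. q \<in> lift_Q \<Longrightarrow> open (N q) \<and> q \<in> N q \<and> 0 \<notin> N q \<and> connected {x \<in> N q. s * F x > 0}"
    and s: "s \<in> {1, -1}"
  obtains p where "p \<in> topspace rest" "\<And>q. q \<in> lift_Q \<Longrightarrow> \<Psi> ` {x \<in> N q. s * F x > 0} \<subseteq> connected_component_of_set rest p"
proof -
  define A where "A q = {x \<in> N q. s * F x > 0}" for q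
  have A_sub: "A q \<subseteq> - insert 0 lift_Q" if "q \<in> lift_Q" for q
    using N[OF that] lift_Q_subset by (auto simp: A_def zeros_def)
  have con: "connectedin rest (\<Psi> ` A q)" if "q \<in> lift_Q" for q
    using N[OF that] A_sub[OF that] by (intro connectedin_rest_image) (auto simp: A_def)
  have near: "\<exists>x\<in>M. s * F x > 0" if q: "q \<in> lift_Q" and "open M" "q \<in> M" for q M
  proof -
    have "q \<in> zeros" using q lift_Q_subset by auto
    from zeros_local[OF this that(2,3)] obtain M' where "M' \<subseteq> M"
        "\<forall>s\<in>{1, -1}. connected {x \<in> M'. s * F x > 0} \<and> {x \<in> M'. s * F x > 0} \<noteq> {}" by blast
    then show ?thesis using s by blast
  qed
  obtain q0 where q0: "q0 \<in> lift_Q" using lift_Q_nonempty by auto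
  obtain x0 where x0: "x0 \<in> A q0"
    using near[OF q0, of "N q0"] N[OF q0] by (auto simp: A_def)
  define p where "p = \<Psi> x0"
  have p: "p \<in> topspace rest"
    unfolding p_def topspace_rest using x0 A_sub[OF q0] by blast
  define K where "K = connected_component_of_set rest p"
  have step: "\<Psi> ` A q' \<subseteq> K" if q: "q \<in> lift_Q" "q' \<in> lift_Q" and K: "\<Psi> ` A q \<subseteq> K"
      and c: "c \<noteq> 0" "x \<in> A q" "c *\<^sub>R x \<in> A q'" for q q' c x
  proof -
    have "x \<noteq> 0" using c(2) A_sub[OF q(1)] by auto
    then have "\<Psi> (c *\<^sub>R x) = \<Psi> x" using c by (simp add: \<Psi>_scaleR)
    then have "\<Psi> (c *\<^sub>R x) \<in> K" using K c(2) by auto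
    then show ?thesis
      unfolding K_def using con[OF q(2)] c(3) component_subset by blast
  qed
  have "{q \<in> lift_Q. \<Psi> ` A q \<subseteq> K} = lift_Q"
  proof (rule saturated_clopen)
    have "p \<in> connected_component_of_set rest p" using p by (simp add: connected_component_of_refl)
    moreover have "p \<in> \<Psi> ` A q0" using x0 p_def by blast
    ultimately have "\<Psi> ` A q0 \<subseteq> K"
      unfolding K_def using con[OF q0] component_subset by blast
    then show "{q \<in> lift_Q. \<Psi> ` A q \<subseteq> K} \<noteq> {}" using q0 by blast
  next
    fix q c assume "q \<in> {q \<in> lift_Q. \<Psi> ` A q \<subseteq> K}" and c: "c \<noteq> (0::real)"
    then have q: "q \<in> lift_Q" "\<Psi> ` A q \<subseteq> K" by auto
    have cq: "c *\<^sub>R q \<in> lift_Q" using q c lift_Q_scaleR by auto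
    have "open ((*\<^sub>R) (inverse c) ` N (c *\<^sub>R q) \<inter> N q)"
      using N[OF q(1)] N[OF cq] c by (intro open_Int open_scaling) auto
    moreover have "q \<in> (*\<^sub>R) (inverse c) ` N (c *\<^sub>R q) \<inter> N q"
      using N[OF q(1)] N[OF cq] c by (auto intro!: image_eqI[of _ _ "c *\<^sub>R q"])
    ultimately obtain x where x: "x \<in> (*\<^sub>R) (inverse c) ` N (c *\<^sub>R q)" "x \<in> N q" "s * F x > 0"
      using near[OF q(1)] by blast
    then have cx: "c *\<^sub>R x \<in> N (c *\<^sub>R q)" using c by auto
    have "x \<noteq> 0" using x N[OF q(1)] by auto
    then have "sgn (F (c *\<^sub>R x)) = sgn (F x)" using c by (rule sgnF)
    then have "s * F (c *\<^sub>R x) > 0" using x(3) s by (auto simp: sgn_if split: if_splits)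
    then have "c *\<^sub>R x \<in> A (c *\<^sub>R q)" "x \<in> A q" using x cx by (auto simp: A_def)
    then show "c *\<^sub>R q \<in> {q \<in> lift_Q. \<Psi> ` A q \<subseteq> K}"
      using step[OF q(1) cq q(2) c] cq by blast
  next
    fix q assume q: "q \<in> lift_Q"
    have "\<Psi> ` A q \<subseteq> K \<longleftrightarrow> \<Psi> ` A q' \<subseteq> K" if q': "q' \<in> N q" "q' \<in> lift_Q" for q'
    proof -
      obtain x where "x \<in> N q \<inter> N q'" "s * F x > 0"
        using near[OF q'(2), of "N q \<inter> N q'"] N[OF q] N[OF q'(2)] q'(1) by (auto simp: open_Int)
      then have "x \<in> A q" "x \<in> A q'" by (auto simp: A_def)
      then show ?thesis
        using step[OF q q'(2) _ one_neq_zero, of x] step[OF q'(2) q _ one_neq_zero, of x] by auto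
    qed
    then show "\<exists>N. open N \<and> q \<in> N \<and> (N \<inter> lift_Q \<subseteq> {q \<in> lift_Q. \<Psi> ` A q \<subseteq> K} \<or> N \<inter> {q \<in> lift_Q. \<Psi> ` A q \<subseteq> K} = {})"
      using N[OF q] by (intro exI[of _ "N q"]) (cases "\<Psi> ` A q \<subseteq> K"; blast)
  qed auto
  then have "\<Psi> ` A q \<subseteq> K" if "q \<in> lift_Q" for q using that by blast
  with p that show thesis by (simp add: A_def K_def)
qed

text \<open>Otherwise the component would be open and closed in the punctured space, which is connected.\<close>
lemma component_adheres:
  assumes "y \<in> - insert 0 lift_Q"
  shows "\<exists>q\<in>lift_Q. \<forall>N. open N \<longrightarrow> q \<in> N \<longrightarrow> N \<inter> connected_component_set (- insert 0 lift_Q) y \<noteq> {}"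
proof (rule ccontr)
  assume "\<not> ?thesis"
  then have far: "\<exists>N. open N \<and> q \<in> N \<and> N \<inter> connected_component_set (- insert 0 lift_Q) y = {}" if "q \<in> lift_Q" for q
    using that by blast
  let ?C = "connected_component_set (- insert 0 lift_Q)"
  have op: "open (?C x)" for x
    by (rule open_connected_component) (use closed_parts in \<open>simp add: open_Compl\<close>)
  have "open (- insert 0 (?C y))"
  proof (subst open_subopen, intro ballI)
    fix x assume x: "x \<in> - insert 0 (?C y)"
    show "\<exists>T. open T \<and> x \<in> T \<and> T \<subseteq> - insert 0 (?C y)"
    proof (cases "x \<in> lift_Q")
      case True
      then obtain N where "open N" "x \<in> N" "N \<inter> ?C y = {}" using far by blast
      then show ?thesis using x by (intro exI[of _ "N - {0}"]) (auto simp: open_delete)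
    next
      case False
      then have "x \<in> ?C x" using x by (simp add: connected_component_refl_eq)
      moreover have "?C x \<inter> ?C y = {}"
        using x False connected_component_disjoint by (metis ComplD insertCI)
      moreover have "0 \<notin> ?C x" using connected_component_subset by fastforce
      ultimately show ?thesis using op[of x] by (intro exI[of _ "?C x"]) auto
    qed
  qed
  moreover have "connected (- {0::'a})"
    by (rule connected_punctured_universe) (use dim in auto)
  moreover have "?C y \<inter> - insert 0 (?C y) \<inter> - {0} = {}" "- {0} \<subseteq> ?C y \<union> - insert 0 (?C y)" by auto
  moreover have "y \<in> ?C y \<inter> - {0}"
    using assms by (simp add: connected_component_refl_eq)
  then have "?C y \<inter> - {0} \<noteq> {}" by blast
  moreover have "- insert 0 (?C y) \<inter> - {0} \<noteq> {}"
  proof -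
    obtain q where "q \<in> lift_Q" using lift_Q_nonempty by auto
    moreover have "q \<notin> ?C y" using \<open>q \<in> lift_Q\<close> connected_component_subset by fastforce
    ultimately show ?thesis by (auto simp: lift_Q_def)
  qed
  ultimately show False using op[of y] unfolding connected_def by blast
qed

text \<open>Every point of the complement can be joined within it to a local side of \<open>Q\<close>, and all the local
  sides of the same sign lie in one component; the two signs give different components, as the
  complement is disconnected.\<close>
theorem is_oval_component: "is_oval X Q"
proof -
  have "\<exists>N. \<forall>q\<in>lift_Q. open (N q) \<and> q \<in> N q \<and> 0 \<notin> N q \<and> N q \<inter> zeros \<subseteq> lift_Q \<and>
      (\<forall>s\<in>{1, -1}. connected {x \<in> N q. s * F x > 0})"
  proof (rule bchoice, rule ballI)
    fix q assume "q \<in> lift_Q"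
    then have "q \<in> zeros" using lift_Q_subset by auto
    from zeros_local[OF this open_UNIV UNIV_I]
    obtain M where M: "open M" "q \<in> M" "0 \<notin> M" "if q \<in> lift_Q then M \<inter> zeros \<subseteq> lift_Q else M \<inter> lift_Q = {}"
        "\<forall>s\<in>{1, -1}. connected {x \<in> M. s * F x > 0} \<and> {x \<in> M. s * F x > 0} \<noteq> {}"
      by (elim exE conjE)
    have "M \<inter> zeros \<subseteq> lift_Q" using M(4) \<open>q \<in> lift_Q\<close> by (simp only: if_True)
    with M(1-3,5)
    show "\<exists>M. open M \<and> q \<in> M \<and> 0 \<notin> M \<and> M \<inter> zeros \<subseteq> lift_Q \<and>
        (\<forall>s\<in>{1, -1}. connected {x \<in> M. s * F x > 0})"
      by (intro exI[of _ M] conjI) simp_all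
  qed
  then obtain N where N: "open (N q)" "q \<in> N q" "0 \<notin> N q" "N q \<inter> zeros \<subseteq> lift_Q"
      "\<forall>s\<in>{1, -1}. connected {x \<in> N q. s * F x > 0}" if "q \<in> lift_Q" for q by blast
  have "\<exists>p. p \<in> topspace rest \<and> (\<forall>q\<in>lift_Q. \<Psi> ` {x \<in> N q. s * F x > 0} \<subseteq> connected_component_of_set rest p)"
    if s: "s \<in> {1, -1}" for s
  proof -
    have N': "open (N q) \<and> q \<in> N q \<and> 0 \<notin> N q \<and> connected {x \<in> N q. s * F x > 0}" if "q \<in> lift_Q" for q
      using N[OF that] s by blast
    show ?thesis
    proof (rule one_component_on_each_side[of N s, OF N' s])
      fix p assume "p \<in> topspace rest"
        "\<And>q. q \<in> lift_Q \<Longrightarrow> \<Psi> ` {x \<in> N q. s * F x > 0} \<subseteq> connected_component_of_set rest p"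
      then show ?thesis by blast
    qed
  qed
  then obtain p where p: "p s \<in> topspace rest" "q \<in> lift_Q \<Longrightarrow> \<Psi> ` {x \<in> N q. s * F x > 0} \<subseteq> connected_component_of_set rest (p s)"
    if "s \<in> {1, -1}" for s :: real and q by metis
  let ?K = "\<lambda>s. connected_component_of_set rest (p s)"
  have cover: "x \<in> ?K 1 \<union> ?K (-1)" if x: "x \<in> topspace rest" for x
  proof -
    obtain y where y: "x = \<Psi> y" "y \<in> - insert 0 lift_Q" using x unfolding topspace_rest by (rule imageE)
    let ?C = "connected_component_set (- insert 0 lift_Q) y"
    obtain q where q: "q \<in> lift_Q" "\<And>N. open N \<Longrightarrow> q \<in> N \<Longrightarrow> N \<inter> ?C \<noteq> {}"
      using component_adheres[OF y(2)] by blast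
    then obtain z where z: "z \<in> N q" "z \<in> ?C" using N(1,2)[OF q(1)] by blast
    have z': "z \<in> - insert 0 lift_Q" using z(2) connected_component_subset by blast
    then have "F z \<noteq> 0" using z(1) N(4)[OF q(1)] by (auto simp: zeros_def)
    then obtain s :: real where s: "s \<in> {1, -1}" "s * F z > 0"
      by (cases "F z > 0") (force dest: spec[of _ 1] spec[of _ "-1"])+
    then have "\<Psi> z \<in> ?K s" using p(2)[OF s(1) q(1)] z(1) by blast
    moreover have "connectedin rest (\<Psi> ` ?C)"
      by (rule connectedin_rest_image) (auto intro: connected_connected_component simp: connected_component_subset)
    moreover have "\<Psi> z \<in> \<Psi> ` ?C" "\<Psi> y \<in> \<Psi> ` ?C"
      using z(2) y(2) by (auto simp: connected_component_refl_eq)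
    ultimately have "\<Psi> y \<in> ?K s" using component_subset by blast
    then show ?thesis using s y by auto
  qed
  have comps: "connected_components_of rest = {?K 1, ?K (-1)}"
  proof
    show "{?K 1, ?K (-1)} \<subseteq> connected_components_of rest"
      using p(1) by (simp add: connected_component_in_connected_components_of)
    show "connected_components_of rest \<subseteq> {?K 1, ?K (-1)}"
    proof
      fix C assume "C \<in> connected_components_of rest"
      then obtain x where x: "x \<in> topspace rest" "C = connected_component_of_set rest x"
        by (auto simp: connected_components_of_def)
      then obtain s :: real where "x \<in> ?K s" "s \<in> {1, -1}" using cover by blast
      then have "C = ?K s" using x connected_component_of_eq[of rest "p s" x] connected_component_of_equiv
        by (metis mem_Collect_eq)
      then show "C \<in> {?K 1, ?K (-1)}" using \<open>s \<in> {1, -1}\<close> by auto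
    qed
  qed
  have "?K 1 \<noteq> ?K (-1)"
  proof
    assume "?K 1 = ?K (-1)"
    then have "connected_components_of rest = {?K 1}" using comps by simp
    then show False using not_connected_complement by (simp add: connected_components_of_eq_singleton)
  qed
  then show ?thesis using comps by (simp add: is_oval_def)
qed

end

theorem (in two_sided_hypersurface) all_components_ovals:
  assumes "Q \<in> connected_components_of (subtopology X (\<Psi> ` {x. x \<noteq> 0 \<and> F x = 0}))"
  shows "is_oval X Q"
proof -
  interpret two_sided_component X \<Psi> F Q
    by unfold_locales (use assms in \<open>simp add: zeros_def\<close>)
  show ?thesis by (rule is_oval_component)
qed

section \<open>Sign regions of a maximum of signed monomials\<close>

lemma continuous_on_Max_image:
  fixes f :: "'v \<Rightarrow> 'a::topological_space \<Rightarrow> real"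
  assumes "finite A" "A \<noteq> {}" "\<And>v. v \<in> A \<Longrightarrow> continuous_on S (f v)"
  shows "continuous_on S (\<lambda>x. Max ((\<lambda>v. f v x) ` A))"
  using assms
proof (induction rule: finite_ne_induct)
  case (insert v A)
  then have "continuous_on S (\<lambda>x. max (f v x) (Max ((\<lambda>v. f v x) ` A)))"
    by (intro continuous_on_max) auto
  then show ?case using insert by simp
qed simp

lemma small_multiple:
  fixes \<eta> :: "'a::real_normed_vector"
  assumes "r > 0"
  obtains e where "e > 0" "e *\<^sub>R \<eta> \<in> ball 0 r"
proof
  have pos: "0 < 2 * (norm \<eta> + 1)" by (simp add: add_nonneg_pos)
  show "r / (2 * (norm \<eta> + 1)) > 0" using assms pos by (rule divide_pos_pos)
  have "r * norm \<eta> < r * (2 * (norm \<eta> + 1))"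
    using assms by (intro mult_strict_left_mono) (simp_all add: add_nonneg_pos)
  then show "(r / (2 * (norm \<eta> + 1))) *\<^sub>R \<eta> \<in> ball 0 r"
    using assms pos by (simp add: divide_less_eq)
qed

text \<open>Terms \<open>coef v * \<Prod>i. X\<^sub>i ^ expo v i\<close> of the same even degree, among them a multiple of each pure
  power, so that at no point except the origin do all of them vanish.\<close>
locale signed_terms =
  fixes A :: "'v set" and coef :: "'v \<Rightarrow> real" and expo :: "'v \<Rightarrow> 'n::finite \<Rightarrow> nat" and deg :: nat
  assumes finite_A: "finite A"
    and coef: "\<And>v. v \<in> A \<Longrightarrow> coef v \<noteq> 0"
    and degree: "\<And>v. v \<in> A \<Longrightarrow> (\<Sum>i\<in>UNIV. expo v i) = deg"
    and even_deg: "even deg"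
    and corner: "\<And>i. \<exists>v\<in>A. expo v i = deg"
begin

definition term_at :: "'v \<Rightarrow> real ^ 'n \<Rightarrow> real" where
  "term_at v X = coef v * (\<Prod>i\<in>UNIV. X $ i ^ expo v i)"

text \<open>The largest plus the smallest value of the terms, both of them written as maxima. Near a point, its sign
  is that of the terms with the largest absolute value, if these have only one sign.\<close>
definition F :: "real ^ 'n \<Rightarrow> real" where
  "F X = Max ((\<lambda>v. term_at v X) ` A) - Max ((\<lambda>v. - term_at v X) ` A)"

definition dominant :: "real ^ 'n \<Rightarrow> 'v set" where
  "dominant X = {v \<in> A. \<forall>w\<in>A. \<bar>term_at w X\<bar> \<le> \<bar>term_at v X\<bar>}"

text \<open>The exponent as a linear form on logarithmic coordinates.\<close>
definition lin :: "'v \<Rightarrow> real ^ 'n \<Rightarrow> real" where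
  "lin v \<eta> = (\<Sum>i\<in>UNIV. real (expo v i) * \<eta> $ i)"

lemma A_nonempty: "A \<noteq> {}"
  using corner by blast

lemma continuous_term_at: "continuous_on S (term_at v)"
  unfolding term_at_def by (intro continuous_intros)

lemma continuous_F: "continuous_on S F"
  unfolding F_def
  by (intro continuous_on_diff continuous_on_Max_image finite_A A_nonempty continuous_on_minus continuous_term_at)

lemma term_at_scaleR: "v \<in> A \<Longrightarrow> term_at v (c *\<^sub>R X) = c ^ deg * term_at v X"
  by (simp add: term_at_def power_mult_distrib prod.distrib power_sum[symmetric] degree)

lemma Max_mult:
  assumes "finite B" "B \<noteq> {}" "0 < (c::real)"
  shows "Max ((\<lambda>v. c * f v) ` B) = c * Max (f ` B)"
  using mono_Max_commute[of "(*) c" "f ` B"] assms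
  by (simp add: image_image monoI)

lemma sgn_F_scaleR:
  assumes "c \<noteq> 0"
  shows "sgn (F (c *\<^sub>R X)) = sgn (F X)"
proof -
  have pos: "c ^ deg > 0" using assms even_deg by (simp add: zero_less_power_eq)
  have "F (c *\<^sub>R X) = Max ((\<lambda>v. c ^ deg * term_at v X) ` A) - Max ((\<lambda>v. c ^ deg * (- term_at v X)) ` A)"
    unfolding F_def by (simp add: term_at_scaleR cong: image_cong_simp)
  also have "\<dots> = c ^ deg * F X"
    unfolding F_def Max_mult[OF finite_A A_nonempty pos] by (simp only: right_diff_distrib)
  finally show ?thesis using pos by (metis mult_1 sgn_mult sgn_pos)
qed

lemma dominant_nonempty: "dominant X \<noteq> {}"
proof -
  have "Max ((\<lambda>v. \<bar>term_at v X\<bar>) ` A) \<in> (\<lambda>v. \<bar>term_at v X\<bar>) ` A"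
    using finite_A A_nonempty by (intro Max_in) auto
  then obtain v where "v \<in> A" "Max ((\<lambda>v. \<bar>term_at v X\<bar>) ` A) = \<bar>term_at v X\<bar>" by auto
  then have "v \<in> dominant X"
    using finite_A by (auto simp: dominant_def dest!: sym[of "Max _"])
  then show ?thesis by auto
qed

lemma dominant_subset: "dominant X \<subseteq> A" by (auto simp: dominant_def)

lemma dominant_nonzero:
  assumes "X \<noteq> 0" "v \<in> dominant X"
  shows "term_at v X \<noteq> 0"
proof -
  obtain i where i: "X $ i \<noteq> 0" using assms(1) by (auto simp: vec_eq_iff)
  obtain w where w: "w \<in> A" "expo w i = deg" using corner by blast
  have "(\<Sum>j\<in>UNIV. expo w j) = expo w i + (\<Sum>j\<in>UNIV - {i}. expo w j)"
    by (simp add: sum.remove)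
  then have "expo w j = 0" if "j \<noteq> i" for j
    using degree[OF w(1)] w(2) that by simp
  then have "(\<Prod>j\<in>UNIV. X $ j ^ expo w j) \<noteq> 0"
    using i by (auto simp: prod_zero_iff) (metis power_0 zero_neq_one)
  then have "\<bar>term_at w X\<bar> > 0" using coef[OF w(1)] by (simp add: term_at_def)
  moreover have "\<bar>term_at w X\<bar> \<le> \<bar>term_at v X\<bar>" using w assms(2) by (auto simp: dominant_def)
  ultimately show ?thesis by auto
qed

text \<open>The sum of the maximum and the minimum is positive exactly if no negative term attains the largest
  absolute value.\<close>
lemma sign_F:
  assumes X: "X \<noteq> 0" and s: "s \<in> {1, -1}"
  shows "s * F X > 0 \<longleftrightarrow> (\<forall>v\<in>dominant X. s * term_at v X > 0)"
proof -
  obtain d where d: "d \<in> dominant X" using dominant_nonempty by auto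
  define M where "M = \<bar>term_at d X\<bar>"
  have M: "M > 0" using dominant_nonzero[OF X d] by (simp add: M_def)
  have le: "\<bar>term_at v X\<bar> \<le> M" if "v \<in> A" for v
    using d that by (auto simp: dominant_def M_def)
  have dom: "v \<in> dominant X \<longleftrightarrow> v \<in> A \<and> \<bar>term_at v X\<bar> = M" for v
    using d le by (force simp: dominant_def M_def)
  define mx where "mx t = Max ((\<lambda>v. t * term_at v X) ` A)" for t
  have F: "s * F X = mx s - mx (- s)"
    using s by (auto simp: F_def mx_def)
  have ub: "mx t \<le> M" if "t \<in> {1, -1}" for t
    unfolding mx_def using finite_A A_nonempty le that
    by (subst Max_le_iff) (auto intro: order_trans[OF abs_ge_self] order_trans[OF abs_ge_minus_self])
  have eq: "mx t = M \<longleftrightarrow> (\<exists>v\<in>dominant X. t * term_at v X > 0)" if t: "t \<in> {1, -1}" for t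
  proof
    assume "mx t = M"
    moreover have "mx t \<in> (\<lambda>v. t * term_at v X) ` A"
      unfolding mx_def using finite_A A_nonempty by (intro Max_in) auto
    ultimately obtain v where v: "v \<in> A" "t * term_at v X = M" by auto
    then have "\<bar>term_at v X\<bar> = M" using t M by auto
    then have "v \<in> dominant X" using v dom by blast
    moreover have "t * term_at v X > 0" using v M by simp
    ultimately show "\<exists>v\<in>dominant X. t * term_at v X > 0" by blast
  next
    assume "\<exists>v\<in>dominant X. t * term_at v X > 0"
    then obtain v where v: "v \<in> A" "\<bar>term_at v X\<bar> = M" "t * term_at v X > 0" using dom by auto
    then have "t * term_at v X = M" using t by auto
    moreover have "t * term_at v X \<le> mx t"
      unfolding mx_def using finite_A v by (intro Max_ge) auto
    ultimately show "mx t = M" using ub[OF t] by simp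
  qed
  have nz: "term_at v X \<noteq> 0" if "v \<in> dominant X" for v using dominant_nonzero[OF X that] .
  have ms: "- s \<in> {1, -1}" using s by auto
  have "mx s = M \<or> mx (- s) = M"
    using eq[OF s] eq[OF ms] d nz[OF d] s by (cases "term_at d X > 0") force+
  then have "s * F X > 0 \<longleftrightarrow> mx (- s) \<noteq> M"
    using F ub[OF s] ub[OF ms] by auto
  also have "\<dots> \<longleftrightarrow> (\<forall>v\<in>dominant X. s * term_at v X > 0)"
    unfolding eq[OF ms] using nz s by (auto simp: not_less less_le)
  finally show ?thesis .
qed

lemma F_eq_0:
  assumes X: "X \<noteq> 0"
  shows "F X = 0 \<longleftrightarrow> (\<forall>s\<in>{1,-1}. \<exists>v\<in>dominant X. s * term_at v X > 0)"
proof -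
  have nz: "term_at v X \<noteq> 0" if "v \<in> dominant X" for v using dominant_nonzero[OF X that] .
  have "F X = 0 \<longleftrightarrow> \<not> (1 * F X > 0) \<and> \<not> (-1 * F X > 0)" by auto
  also have "\<dots> \<longleftrightarrow> (\<exists>v\<in>dominant X. \<not> 1 * term_at v X > 0) \<and> (\<exists>v\<in>dominant X. \<not> -1 * term_at v X > 0)"
    using sign_F[OF X, of 1] sign_F[OF X, of "-1"] by simp
  also have "\<dots> \<longleftrightarrow> (\<forall>s\<in>{1,-1}. \<exists>v\<in>dominant X. s * term_at v X > 0)"
  proof -
    have "\<not> t * term_at v X > 0 \<longleftrightarrow> - t * term_at v X > 0" if "v \<in> dominant X" "t \<in> {1, -1}" for v t
      using nz[OF that(1)] that(2) by auto
    then show ?thesis by fastforce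
  qed
  finally show ?thesis .
qed

lemma dominant_expo_eq_0:
  assumes "X \<noteq> 0" "v \<in> dominant X" "X $ i = 0"
  shows "expo v i = 0"
proof -
  have "X $ i ^ expo v i \<noteq> 0"
    using dominant_nonzero[OF assms(1,2)] by (auto simp: term_at_def)
  then show ?thesis using assms(3) by (cases "expo v i") auto
qed

lemma dominant_abs_eq: "v \<in> dominant X \<Longrightarrow> w \<in> dominant X \<Longrightarrow> \<bar>term_at v X\<bar> = \<bar>term_at w X\<bar>"
  unfolding dominant_def by (simp add: antisym)

lemma dominant_near:
  obtains N where "open N" "q \<in> N" "\<And>X. X \<in> N \<Longrightarrow> dominant X \<subseteq> dominant q"
proof -
  obtain d where d: "d \<in> dominant q" using dominant_nonempty by auto
  define N where "N = (\<Inter>v\<in>A - dominant q. {X. \<bar>term_at v X\<bar> < \<bar>term_at d X\<bar>})"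
  have "open N"
    unfolding N_def using finite_A
    by (intro open_INT ballI open_Collect_less continuous_intros continuous_term_at) auto
  moreover have "q \<in> N"
  proof -
    have "\<bar>term_at v q\<bar> < \<bar>term_at d q\<bar>" if v: "v \<in> A" "v \<notin> dominant q" for v
    proof (rule ccontr)
      assume "\<not> ?thesis"
      then have "\<bar>term_at w q\<bar> \<le> \<bar>term_at v q\<bar>" if "w \<in> A" for w
        using d that by (force simp: dominant_def)
      then show False using v by (simp add: dominant_def)
    qed
    then show ?thesis by (auto simp: N_def)
  qed
  moreover have "dominant X \<subseteq> dominant q" if X: "X \<in> N" for X
  proof
    fix v assume v: "v \<in> dominant X"
    have "d \<in> A" using d dominant_subset by blast
    then have "\<bar>term_at d X\<bar> \<le> \<bar>term_at v X\<bar>" using v by (simp add: dominant_def)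
    moreover have "v \<in> A" using v dominant_subset by blast
    ultimately show "v \<in> dominant q"
      using X by (force simp: N_def not_less[symmetric])
  qed
  ultimately show thesis by (rule that)
qed

text \<open>Logarithmic coordinates around \<open>q\<close> in the directions where \<open>q\<close> does not vanish; the coordinates
  that vanish at \<open>q\<close> are left unchanged. The terms that do not vanish at \<open>q\<close> do not involve the latter, so
  each of them is a constant times the exponential of a linear form.\<close>
definition chart :: "real ^ 'n \<Rightarrow> real ^ 'n \<Rightarrow> real ^ 'n" where
  "chart q \<eta> = (\<chi> i. if q $ i = 0 then \<eta> $ i else q $ i * exp (\<eta> $ i))"

lemma chart_0: "chart q 0 = q" by (simp add: chart_def vec_eq_iff)

lemma continuous_chart: "continuous_on S (chart q)"
  unfolding chart_def
proof (intro continuous_on_vec_lambda)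
  fix i show "continuous_on S (\<lambda>\<eta>. if q $ i = 0 then \<eta> $ i else q $ i * exp (\<eta> $ i))"
    by (cases "q $ i = 0") (auto intro!: continuous_intros)
qed

lemma open_chart_image:
  assumes "open B"
  shows "open (chart q ` B)"
proof -
  define W where "W = (\<Inter>i\<in>{i. q $ i \<noteq> 0}. {X. 0 < X $ i / q $ i})"
  define G where "G X = (\<chi> i. if q $ i = 0 then X $ i else ln (X $ i / q $ i))" for X
  have "open W"
    unfolding W_def by (intro open_INT ballI open_Collect_less continuous_intros) auto
  moreover have "continuous_on W G"
    unfolding G_def
  proof (intro continuous_on_vec_lambda)
    fix i show "continuous_on W (\<lambda>X. if q $ i = 0 then X $ i else ln (X $ i / q $ i))"
    proof (cases "q $ i = 0")
      case False
      then have "X $ i / q $ i \<noteq> 0" if "X \<in> W" for X using that by (force simp: W_def)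
      with False show ?thesis by (auto intro!: continuous_intros)
    qed (auto intro!: continuous_intros)
  qed
  ultimately have "open (W \<inter> G -` B)" using assms by (intro continuous_open_preimage)
  moreover have "chart q ` B = W \<inter> G -` B"
  proof (intro equalityI subsetI)
    fix X assume "X \<in> chart q ` B"
    then obtain \<eta> where "\<eta> \<in> B" "X = chart q \<eta>" by auto
    moreover have "G (chart q \<eta>) = \<eta>" by (simp add: G_def chart_def vec_eq_iff)
    ultimately show "X \<in> W \<inter> G -` B" by (auto simp: W_def chart_def)
  next
    fix X assume X: "X \<in> W \<inter> G -` B"
    have "X = chart q (G X)"
      using X by (auto simp: G_def chart_def vec_eq_iff W_def)
    then show "X \<in> chart q ` B" using X by blast
  qed
  ultimately show ?thesis by simp
qed

lemma term_at_chart: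
  assumes "term_at v q \<noteq> 0"
  shows "term_at v (chart q \<eta>) = term_at v q * exp (lin v \<eta>)"
proof -
  have "chart q \<eta> $ i ^ expo v i = q $ i ^ expo v i * exp (real (expo v i) * \<eta> $ i)" for i
  proof (cases "q $ i = 0")
    case True
    have "(\<Prod>i\<in>UNIV. q $ i ^ expo v i) \<noteq> 0" using assms by (simp add: term_at_def)
    then have "q $ i ^ expo v i \<noteq> 0" by (simp add: prod_zero_iff)
    then have "expo v i = 0" using True by (cases "expo v i") auto
    then show ?thesis by simp
  next
    case False
    then show ?thesis by (simp add: chart_def power_mult_distrib exp_of_nat_mult)
  qed
  then show ?thesis
    by (simp add: term_at_def prod.distrib exp_sum lin_def)
qed

lemma lin_scaleR: "lin v (c *\<^sub>R \<eta>) = c * lin v \<eta>"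
  by (simp add: lin_def sum_distrib_left algebra_simps)

lemma lin_add: "lin v (\<eta> + \<eta>') = lin v \<eta> + lin v \<eta>'"
  by (simp add: lin_def sum.distrib algebra_simps)

text \<open>Near \<open>q\<close> only the terms that dominate at \<open>q\<close> compete. As their absolute values agree at \<open>q\<close>, the
  competition is between linear forms.\<close>
lemma chart_ball:
  assumes q: "q \<noteq> 0" and V: "open V" "q \<in> V"
  obtains r where "r > 0" "chart q ` ball 0 r \<subseteq> V" "0 \<notin> chart q ` ball 0 r"
    "\<And>\<eta>. \<eta> \<in> ball 0 r \<Longrightarrow> dominant (chart q \<eta>) = {v \<in> dominant q. \<forall>w\<in>dominant q. lin w \<eta> \<le> lin v \<eta>}"
proof -
  obtain N where N: "open N" "q \<in> N" "\<And>X. X \<in> N \<Longrightarrow> dominant X \<subseteq> dominant q"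
    using dominant_near[of q] by metis
  have "open (chart q -` (N \<inter> V - {0}))"
    using N(1) V(1) by (intro open_vimage open_delete continuous_chart) auto
  moreover have "0 \<in> chart q -` (N \<inter> V - {0})" using N V q by (simp add: chart_0)
  ultimately obtain r where r: "r > 0" "ball 0 r \<subseteq> chart q -` (N \<inter> V - {0})"
    using open_contains_ball by blast
  have dom: "dominant (chart q \<eta>) = {v \<in> dominant q. \<forall>w\<in>dominant q. lin w \<eta> \<le> lin v \<eta>}" (is "_ = ?R")
    if "\<eta> \<in> ball 0 r" for \<eta>
  proof -
    have sub: "dominant (chart q \<eta>) \<subseteq> dominant q" using that r N(3) by blast
    obtain d where d: "d \<in> dominant (chart q \<eta>)" using dominant_nonempty by auto
    have abs: "\<bar>term_at v (chart q \<eta>)\<bar> = \<bar>term_at d q\<bar> * exp (lin v \<eta>)" if "v \<in> dominant q" for v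
    proof -
      have "\<bar>term_at v q\<bar> = \<bar>term_at d q\<bar>" using that d sub by (blast intro: dominant_abs_eq)
      then show ?thesis using term_at_chart[OF dominant_nonzero[OF q that]] by (simp add: abs_mult)
    qed
    have pos: "\<bar>term_at d q\<bar> > 0" using dominant_nonzero[OF q] d sub by auto
    show ?thesis
    proof (intro equalityI subsetI)
      fix v assume v: "v \<in> dominant (chart q \<eta>)"
      then have "v \<in> dominant q" using sub by auto
      moreover have "lin w \<eta> \<le> lin v \<eta>" if "w \<in> dominant q" for w
      proof -
        have "\<bar>term_at w (chart q \<eta>)\<bar> \<le> \<bar>term_at v (chart q \<eta>)\<bar>"
          using v that by (auto simp: dominant_def)
        then show ?thesis using abs that \<open>v \<in> dominant q\<close> pos by simp
      qed
      ultimately show "v \<in> ?R" by auto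
    next
      fix v assume v: "v \<in> ?R"
      then have "lin d \<eta> \<le> lin v \<eta>" "v \<in> dominant q" using d sub by auto
      then have "\<bar>term_at d (chart q \<eta>)\<bar> \<le> \<bar>term_at v (chart q \<eta>)\<bar>" using abs d sub pos by auto
      then show "v \<in> dominant (chart q \<eta>)"
        using d v by (fastforce simp: dominant_def)
    qed
  qed
  have "chart q ` ball 0 r \<subseteq> V" "0 \<notin> chart q ` ball 0 r" using r(2) by auto
  then show thesis by (rule that[OF r(1) _ _ dom])
qed

end

text \<open>The exponents that dominate at a point with nonzero coordinates are affinely independent, in dual
  form: linear forms with arbitrary differences of values on them exist.\<close>
locale generic_signed_terms = signed_terms A coef expo deg
  for A :: "'v set" and coef :: "'v \<Rightarrow> real" and expo :: "'v \<Rightarrow> 'n::finite \<Rightarrow> nat" and deg :: nat +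
  assumes interpolation_torus: "\<And>X c. (\<And>i. X $ i \<noteq> 0) \<Longrightarrow>
      \<exists>\<eta> k. \<forall>v\<in>dominant X. lin v \<eta> = c v + k"
begin

text \<open>A point with vanishing coordinates can be moved off the coordinate planes without changing the
  dominant terms, since none of these involves the vanishing coordinates.\<close>
lemma interpolation:
  assumes "q \<noteq> 0"
  shows "\<exists>\<eta> k. \<forall>v\<in>dominant q. lin v \<eta> = c v + k"
proof -
  obtain r where r: "r > 0"
    "\<And>\<eta>. \<eta> \<in> ball 0 r \<Longrightarrow> dominant (chart q \<eta>) = {v \<in> dominant q. \<forall>w\<in>dominant q. lin w \<eta> \<le> lin v \<eta>}"
    by (rule chart_ball[OF assms open_UNIV UNIV_I]) (rule that)
  define \<zeta> :: "real ^ 'n" where "\<zeta> = (\<chi> i. if q $ i = 0 then 1 else 0)"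
  obtain e where e: "e > 0" and \<eta>: "e *\<^sub>R \<zeta> \<in> ball 0 r" using small_multiple[OF r(1)] by blast
  have zero: "lin v \<zeta> = 0" if "v \<in> dominant q" for v
    unfolding lin_def using dominant_expo_eq_0[OF assms that] by (intro sum.neutral) (auto simp: \<zeta>_def)
  have "dominant (chart q (e *\<^sub>R \<zeta>)) = dominant q"
    using r(2)[OF \<eta>] zero by (auto simp: lin_scaleR)
  moreover have "chart q (e *\<^sub>R \<zeta>) $ i \<noteq> 0" for i
    using e by (simp add: chart_def \<zeta>_def)
  ultimately show ?thesis using interpolation_torus by metis
qed

text \<open>In a small logarithmic ball, the side of sign \<open>s\<close> is the union over the dominant terms \<open>v\<close> of sign
  \<open>s\<close> of the convex set where \<open>v\<close> beats all dominant terms of the other sign. By interpolation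
  these sets have a common point, so the union is connected. The zero set is a cone with apex \<open>q\<close>.\<close>
lemma local_sides:
  assumes q: "q \<noteq> 0" "F q = 0" and V: "open V" "q \<in> V"
  shows "\<exists>N. open N \<and> q \<in> N \<and> N \<subseteq> V \<and> connected {x \<in> N. F x = 0} \<and>
        (\<forall>s\<in>{1, -1}. connected {x \<in> N. s * F x > 0} \<and> {x \<in> N. s * F x > 0} \<noteq> {})"
proof -
  obtain r where r: "r > 0" "chart q ` ball 0 r \<subseteq> V" "0 \<notin> chart q ` ball 0 r"
    "\<And>\<eta>. \<eta> \<in> ball 0 r \<Longrightarrow> dominant (chart q \<eta>) = {v \<in> dominant q. \<forall>w\<in>dominant q. lin w \<eta> \<le> lin v \<eta>}"
    by (rule chart_ball[OF q(1) V]) (rule that)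
  let ?B = "ball 0 r"
  define D where "D s = {v \<in> dominant q. s * term_at v q > 0}" for s
  define C where "C s v = {\<eta> \<in> ?B. \<forall>w\<in>D (- s). lin w \<eta> < lin v \<eta>}" for s v
  have D_cover: "v \<in> D s \<or> v \<in> D (- s)" if "v \<in> dominant q" "s \<in> {1, -1}" for v s
    using that dominant_nonzero[OF q(1) that(1)] by (auto simp: D_def)
  have D_ne: "D s \<noteq> {}" if "s \<in> {1, -1}" for s
    using F_eq_0[OF q(1)] q(2) that by (auto simp: D_def)
  have fin: "finite (dominant q)" using finite_A dominant_subset finite_subset by blast
  have region: "{\<eta> \<in> ?B. s * F (chart q \<eta>) > 0} = (\<Union>v\<in>D s. C s v)" if s: "s \<in> {1, -1}" for s
  proof -
    have "s * F (chart q \<eta>) > 0 \<longleftrightarrow> (\<exists>v\<in>D s. \<forall>w\<in>D (- s). lin w \<eta> < lin v \<eta>)" if \<eta>: "\<eta> \<in> ?B" for \<eta>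
    proof -
      have "chart q \<eta> \<noteq> 0" using r(3) \<eta> by (metis image_eqI)
      then have "s * F (chart q \<eta>) > 0 \<longleftrightarrow> (\<forall>v\<in>dominant (chart q \<eta>). s * term_at v (chart q \<eta>) > 0)"
        using s by (rule sign_F)
      also have "\<dots> \<longleftrightarrow> dominant (chart q \<eta>) \<subseteq> D s"
        using r(4)[OF \<eta>] by (auto simp: D_def term_at_chart dominant_nonzero[OF q(1)] mult.assoc[symmetric] zero_less_mult_iff)
      also have "\<dots> \<longleftrightarrow> (\<exists>v\<in>D s. \<forall>w\<in>D (- s). lin w \<eta> < lin v \<eta>)"
      proof
        assume sub: "dominant (chart q \<eta>) \<subseteq> D s"
        obtain v where v: "v \<in> dominant (chart q \<eta>)" using dominant_nonempty by auto
        have "lin w \<eta> < lin v \<eta>" if w: "w \<in> D (- s)" for w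
        proof (rule ccontr)
          assume "\<not> ?thesis"
          then have "w \<in> dominant (chart q \<eta>)" using v w r(4)[OF \<eta>] by (force simp: D_def)
          then have "w \<in> D s" using sub by auto
          then show False using w by (auto simp: D_def)
        qed
        then show "\<exists>v\<in>D s. \<forall>w\<in>D (- s). lin w \<eta> < lin v \<eta>" using v sub by blast
      next
        assume "\<exists>v\<in>D s. \<forall>w\<in>D (- s). lin w \<eta> < lin v \<eta>"
        then obtain v where v: "v \<in> D s" "\<And>w. w \<in> D (- s) \<Longrightarrow> lin w \<eta> < lin v \<eta>" by auto
        show "dominant (chart q \<eta>) \<subseteq> D s"
        proof
          fix w assume w: "w \<in> dominant (chart q \<eta>)"
          then have "w \<in> dominant q" "lin v \<eta> \<le> lin w \<eta>" using r(4)[OF \<eta>] v(1) by (auto simp: D_def)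
          then show "w \<in> D s" using v(2)[of w] D_cover[OF _ s, of w] by force
        qed
      qed
      finally show ?thesis .
    qed
    then show ?thesis by (auto simp: C_def)
  qed
  have convex_C: "convex (C s v)" for s v
  proof -
    have "C s v = ?B \<inter> (\<Inter>w\<in>D (- s). {\<eta>. lin w \<eta> - lin v \<eta> < 0})" by (auto simp: C_def)
    moreover have "convex {\<eta>. lin w \<eta> - lin v \<eta> < 0}" for w
    proof -
      have "linear (\<lambda>\<eta>. lin w \<eta> - lin v \<eta>)"
        by (rule linearI) (simp_all add: lin_add lin_scaleR algebra_simps)
      then have "convex ((\<lambda>\<eta>. lin w \<eta> - lin v \<eta>) -` {..<0})" by (rule convex_linear_vimage) simp
      then show ?thesis by (simp add: vimage_def)
    qed
    ultimately show ?thesis by (auto intro!: convex_Int convex_INT)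
  qed
  have common: "\<exists>\<eta>. \<forall>v\<in>D s. \<eta> \<in> C s v" if s: "s \<in> {1, -1}" for s
  proof -
    obtain \<eta> k where \<eta>: "\<forall>v\<in>dominant q. lin v \<eta> = (if v \<in> D s then 1 else 0) + k"
      using interpolation[OF q(1), of "\<lambda>v. if v \<in> D s then 1 else 0"] by blast
    obtain e where e: "e > 0" "e *\<^sub>R \<eta> \<in> ?B" using small_multiple[OF r(1)] by blast
    have "lin w (e *\<^sub>R \<eta>) < lin v (e *\<^sub>R \<eta>)" if "v \<in> D s" "w \<in> D (- s)" for v w
    proof -
      have "w \<notin> D s" using that by (auto simp: D_def)
      moreover have "v \<in> dominant q" "w \<in> dominant q" using that by (auto simp: D_def)
      ultimately have "lin w \<eta> < lin v \<eta>" using \<eta> that by simp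
      then show ?thesis using e by (simp add: lin_scaleR)
    qed
    then have "\<forall>v\<in>D s. e *\<^sub>R \<eta> \<in> C s v" using e by (auto simp: C_def)
    then show ?thesis by blast
  qed
  have side: "connected {\<eta> \<in> ?B. s * F (chart q \<eta>) > 0}" "{\<eta> \<in> ?B. s * F (chart q \<eta>) > 0} \<noteq> {}" if s: "s \<in> {1, -1}" for s
  proof -
    show "connected {\<eta> \<in> ?B. s * F (chart q \<eta>) > 0}"
      unfolding region[OF s]
      by (rule connected_Union) (use common[OF s] convex_C in \<open>auto intro: convex_connected\<close>)
    show "{\<eta> \<in> ?B. s * F (chart q \<eta>) > 0} \<noteq> {}"
      unfolding region[OF s] using common[OF s] D_ne[OF s] by blast
  qed
  have zero_iff: "F (chart q \<eta>) = 0 \<longleftrightarrow> (\<forall>s\<in>{1,-1}. \<eta> \<notin> (\<Union>v\<in>D s. C s v))" if \<eta>: "\<eta> \<in> ?B" for \<eta>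
  proof -
    have iff: "\<eta> \<in> (\<Union>v\<in>D s. C s v) \<longleftrightarrow> s * F (chart q \<eta>) > 0" if "s \<in> {1, -1}" for s
      unfolding region[OF that, symmetric] using \<eta> by simp
    show ?thesis using iff[of 1] iff[of "-1"] by (auto simp del: UN_iff)
  qed
  have zero: "connected {\<eta> \<in> ?B. F (chart q \<eta>) = 0}"
  proof (rule starlike_imp_connected)
    have "closed_segment 0 \<eta> \<subseteq> {\<eta> \<in> ?B. F (chart q \<eta>) = 0}" if \<eta>: "\<eta> \<in> ?B" "F (chart q \<eta>) = 0" for \<eta>
    proof
      fix \<zeta> assume "\<zeta> \<in> closed_segment 0 \<eta>"
      then obtain u where u: "0 \<le> u" "u \<le> 1" "\<zeta> = u *\<^sub>R \<eta>" by (auto simp: closed_segment_def)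
      have "norm \<zeta> < r" using u \<eta> mult_left_le_one_le[of "norm \<eta>" u] by auto
      then have B: "\<zeta> \<in> ?B" by simp
      show "\<zeta> \<in> {\<eta> \<in> ?B. F (chart q \<eta>) = 0}"
      proof (cases "u = 0")
        case True
        then show ?thesis using u B q by (simp add: chart_0)
      next
        case False
        then have "\<zeta> \<in> C s v \<longleftrightarrow> \<eta> \<in> C s v" for s v
          using u B \<eta> by (auto simp: C_def lin_scaleR)
        then show ?thesis using zero_iff[OF B] zero_iff[OF \<eta>(1)] \<eta>(2) B by simp
      qed
    qed
    moreover have "0 \<in> {\<eta> \<in> ?B. F (chart q \<eta>) = 0}" using r q by (simp add: chart_0)
    ultimately show "starlike {\<eta> \<in> ?B. F (chart q \<eta>) = 0}" unfolding starlike_def by blast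
  qed
  let ?N = "chart q ` ?B"
  have img: "{x \<in> ?N. P x} = chart q ` {\<eta> \<in> ?B. P (chart q \<eta>)}" for P by auto
  have "connected {x \<in> ?N. F x = 0}"
    unfolding img by (intro connected_continuous_image continuous_chart zero)
  moreover have "connected {x \<in> ?N. s * F x > 0}" if "s \<in> {1, -1}" for s
    unfolding img by (intro connected_continuous_image continuous_chart side that)
  moreover have "{x \<in> ?N. s * F x > 0} \<noteq> {}" if "s \<in> {1, -1}" for s
    unfolding img using side(2)[OF that] by blast
  moreover have "q \<in> ?N" using r(1) by (intro image_eqI[of _ _ 0]) (auto simp: chart_0)
  ultimately show ?thesis
    using r(2) open_chart_image[OF open_ball] by (intro exI[of _ ?N]) blast
qed

text \<open>Interpolation gives a direction in which one positive and one negative dominant term stay equal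
  and beat all the others. The coordinates that vanish at \<open>q\<close> are moved away from 0 at the same
  time.\<close>
lemma zeros_with_two_dominant_terms_dense:
  assumes q: "q \<noteq> 0" "F q = 0" and V: "open V" "q \<in> V"
  obtains X v w where "X \<in> V" "\<And>i. X $ i \<noteq> 0" "dominant X = {v, w}" "term_at v X > 0" "term_at w X < 0"
proof -
  obtain r where r: "r > 0" "chart q ` ball 0 r \<subseteq> V" "0 \<notin> chart q ` ball 0 r"
    "\<And>\<eta>. \<eta> \<in> ball 0 r \<Longrightarrow> dominant (chart q \<eta>) = {v \<in> dominant q. \<forall>w\<in>dominant q. lin w \<eta> \<le> lin v \<eta>}"
    by (rule chart_ball[OF q(1) V]) (rule that)
  obtain v where v: "v \<in> dominant q" "term_at v q > 0" using F_eq_0[OF q(1)] q(2) by auto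
  obtain w where w: "w \<in> dominant q" "term_at w q < 0" using F_eq_0[OF q(1)] q(2) by auto
  obtain \<eta> k where \<eta>: "\<forall>u\<in>dominant q. lin u \<eta> = (if u \<in> {v, w} then 1 else 0) + k"
    using interpolation[OF q(1), of "\<lambda>u. if u \<in> {v, w} then 1 else 0"] by blast
  define \<zeta> :: "real ^ 'n" where "\<zeta> = (\<chi> i. if q $ i = 0 then 1 else \<eta> $ i)"
  have lin: "lin u \<zeta> = lin u \<eta>" if "u \<in> dominant q" for u
    unfolding lin_def using dominant_expo_eq_0[OF q(1) that] by (intro sum.cong) (auto simp: \<zeta>_def)
  obtain e where e: "e > 0" "e *\<^sub>R \<zeta> \<in> ball 0 r" using small_multiple[OF r(1)] by blast
  define X where "X = chart q (e *\<^sub>R \<zeta>)"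
  have lin': "lin u (e *\<^sub>R \<zeta>) = e * ((if u \<in> {v, w} then 1 else 0) + k)" if "u \<in> dominant q" for u
    using \<eta> lin that by (simp add: lin_scaleR)
  have "dominant X = {v, w}"
    unfolding X_def r(4)[OF e(2)]
  proof (intro equalityI subsetI)
    fix u assume "u \<in> {u \<in> dominant q. \<forall>w\<in>dominant q. lin w (e *\<^sub>R \<zeta>) \<le> lin u (e *\<^sub>R \<zeta>)}"
    then have u: "u \<in> dominant q" "lin v (e *\<^sub>R \<zeta>) \<le> lin u (e *\<^sub>R \<zeta>)" using v by auto
    show "u \<in> {v, w}"
    proof (rule ccontr)
      assume "u \<notin> {v, w}"
      then have "e * (1 + k) \<le> e * k" using u lin'[OF v(1)] lin'[OF u(1)] by auto
      then show False using e by simp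
    qed
  next
    fix u assume u: "u \<in> {v, w}"
    have "lin x (e *\<^sub>R \<zeta>) \<le> e * (1 + k)" if "x \<in> dominant q" for x
      unfolding lin'[OF that] using e by (intro mult_left_mono) auto
    then show "u \<in> {u \<in> dominant q. \<forall>w\<in>dominant q. lin w (e *\<^sub>R \<zeta>) \<le> lin u (e *\<^sub>R \<zeta>)}"
      using u v(1) w(1) lin'[OF v(1)] lin'[OF w(1)] by auto
  qed
  moreover have "term_at v X > 0" "term_at w X < 0"
    using v w by (simp_all add: X_def term_at_chart mult_neg_pos)
  moreover have "X $ i \<noteq> 0" for i
    using e by (simp add: X_def chart_def \<zeta>_def)
  moreover have "X \<in> V" using r(2) e(2) X_def by blast
  ultimately show thesis using that by blast
qed

end

section \<open>Lattice pairing and sign characters of reflections\<close>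

text \<open>The logarithm and the exponential between \<open>[0, \<infinity>)\<close> and \<open>[-\<infinity>, \<infinity>)\<close>. The toric charts take
  values in the latter, the homogeneous coordinates in the former.\<close>
definition elog :: "real \<Rightarrow> ereal" where
  "elog x = (if x \<le> 0 then - \<infinity> else ereal (ln x))"

definition eexp :: "ereal \<Rightarrow> real" where
  "eexp y = (if y = - \<infinity> then 0 else exp (real_of_ereal y))"

lemma eexp_elog: "x \<ge> 0 \<Longrightarrow> eexp (elog x) = x"
  by (auto simp: eexp_def elog_def)

lemma continuous_elog: "continuous_on UNIV elog"
proof (rule continuous_onI_mono)
  have "y \<in> range elog" if "y < \<infinity>" for y
  proof (cases y)
    case (real r)
    then have "y = elog (exp r)" by (simp add: elog_def)
    then show ?thesis by blast
  next
    case MInf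
    then have "y = elog 0" by (simp add: elog_def)
    then show ?thesis by blast
  qed (use that in simp)
  moreover have "elog x < \<infinity>" for x by (simp add: elog_def)
  ultimately have "range elog = {..<\<infinity>}" by (auto simp del: ereal_infty_less)
  then show "open (range elog)" by simp
qed (auto simp: elog_def)

lemma elog_less_iff:
  assumes "y \<ge> 0" "x \<noteq> \<infinity>"
  shows "elog y < x \<longleftrightarrow> y < eexp x"
proof (cases x)
  case (real r)
  then show ?thesis
    using assms exp_less_cancel_iff[of "ln y" r] by (cases "y = 0") (simp_all add: elog_def eexp_def)
qed (use assms in \<open>auto simp: elog_def eexp_def\<close>)

lemma less_elog_iff:
  assumes "y > 0" "x \<noteq> \<infinity>"
  shows "x < elog y \<longleftrightarrow> eexp x < y"
proof (cases x)
  case (real r)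
  then show ?thesis
    using assms exp_less_cancel_iff[of r "ln y"] by (simp add: elog_def eexp_def)
qed (use assms in \<open>auto simp: elog_def eexp_def\<close>)

lemma eexp_nonneg: "eexp x \<ge> 0"
  by (simp add: eexp_def)

lemma continuous_eexp: "continuous_on {..<\<infinity>} eexp"
  unfolding continuous_on_def
proof (intro ballI order_tendstoI)
  fix x y assume x: "x \<in> {..<\<infinity>::ereal}"
  have id: "((\<lambda>z. z) \<longlongrightarrow> x) (at x within {..<\<infinity>})" by (rule tendsto_ident_at)
  have fin: "\<forall>\<^sub>F z in at x within {..<\<infinity>}. z \<noteq> (\<infinity>::ereal)" by (simp add: eventually_at_filter)
  {
    assume y: "y < eexp x"
    show "\<forall>\<^sub>F z in at x within {..<\<infinity>}. y < eexp z"
    proof (cases "y < 0")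
      case True
      then show ?thesis using eexp_nonneg by (intro always_eventually) (auto intro: less_le_trans)
    next
      case False
      then have "elog y < x" using x y elog_less_iff[of y x] by auto
      then have "\<forall>\<^sub>F z in at x within {..<\<infinity>}. elog y < z" by (rule order_tendstoD(1)[OF id])
      then show ?thesis using fin
        by eventually_elim (use False elog_less_iff[of y] in auto)
    qed
  next
    assume y: "eexp x < y"
    have y0: "y > 0" using y eexp_nonneg[of x] by linarith
    then have "x < elog y" using x y less_elog_iff[of y x] by auto
    then have "\<forall>\<^sub>F z in at x within {..<\<infinity>}. z < elog y" by (rule order_tendstoD(2)[OF id])
    then show "\<forall>\<^sub>F z in at x within {..<\<infinity>}. eexp z < y" using fin
      by eventually_elim (use y0 less_elog_iff[of y] in auto)
  }
qed

definition bit_sign :: "bit \<Rightarrow> real" where "bit_sign b = (if b = 0 then 1 else - 1)"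

text \<open>The sign \<open>(-1)^(\<epsilon>\<^sub>1 v\<^sub>1 + \<epsilon>\<^sub>2 v\<^sub>2)\<close> by which the reflection \<open>\<epsilon>\<close> acts on the monomial with
  exponent \<open>v\<close>.\<close>
definition character :: "reflection \<Rightarrow> lat \<Rightarrow> real" where
  "character \<epsilon> v = bit_sign (fst \<epsilon> * of_int (fst v) + snd \<epsilon> * of_int (snd v))"

lemma bit_sign_add: "bit_sign (a + b) = bit_sign a * bit_sign b"
  by (cases a; cases b) (auto simp: bit_sign_def)

lemma character_cases: "character \<epsilon> v = 1 \<or> character \<epsilon> v = -1"
  by (auto simp: character_def bit_sign_def)

lemma character_square: "character \<epsilon> v * character \<epsilon> v = 1"
  using character_cases[of \<epsilon> v] by auto

lemma character_add: "character \<epsilon> (v + w) = character \<epsilon> v * character \<epsilon> w"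
  by (simp only: character_def bit_sign_add[symmetric] fst_add snd_add of_int_add distrib_left add_ac)

lemma character_add_left: "character (\<epsilon> + \<epsilon>') v = character \<epsilon> v * character \<epsilon>' v"
  by (simp only: character_def bit_sign_add[symmetric] fst_add snd_add distrib_right add_ac)

lemma character_0: "character \<epsilon> 0 = 1" "character 0 v = 1"
  by (simp_all add: character_def bit_sign_def)

definition pairing :: "lat \<Rightarrow> lat \<Rightarrow> int" where
  "pairing v w = fst v * fst w + snd v * snd w"

lemma character_mod2: "character (mod2 \<alpha>) v = bit_sign (of_int (pairing v \<alpha>))"
  by (simp add: character_def mod2_def pairing_def mult.commute)

lemma pairing_commute: "pairing v w = pairing w v"
  by (simp add: pairing_def mult.commute)

lemma emb_diff: "emb (v - w) = emb v - emb w"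
  by (simp add: emb_def)

lemma emb_inner: "emb v \<bullet> emb w = real_of_int (pairing v w)"
  by (simp add: emb_def pairing_def)

lemma emb_0: "emb 0 = 0" by (simp add: emb_def zero_prod_def)

lemma inj_emb: "inj emb" by (auto simp: inj_def emb_def prod_eq_iff)

section \<open>Normal cones of a multiple of a unimodular triangle\<close>

text \<open>The polygon \<open>D\<close> below is \<open>t + m T\<close>, where \<open>T\<close> is the unimodular triangle with vertices \<open>h i\<close>. The
  index type \<open>3\<close> has the elements 1, 2 and 3.\<close>
locale unimodular_triangle =
  fixes h :: "3 \<Rightarrow> lat" and t :: lat and m :: nat
  assumes h1: "h 1 = 0"
    and unimodular: "\<bar>fst (h 2) * snd (h 3) - fst (h 3) * snd (h 2)\<bar> = 1"
    and m: "m > 0"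
begin

definition V :: "3 \<Rightarrow> plane" where "V i = emb t + real m *\<^sub>R emb (h i)"

definition D :: "plane set" where "D = convex hull (range V)"

definition det :: int where "det = fst (h 2) * snd (h 3) - fst (h 3) * snd (h 2)"

lemma det_square: "det * det = 1"
  using unimodular unfolding det_def by (metis abs_mult_self_eq mult_1)

abbreviation ht :: "3 \<Rightarrow> plane \<Rightarrow> real" where "ht i u \<equiv> emb (h i) \<bullet> u"

text \<open>As \<open>h 2, h 3\<close> is a basis of the lattice, the values at \<open>h\<close> of a lattice form vanishing at
  \<open>h 1 = 0\<close> are arbitrary; Cramer's rule, with \<open>1 / det = det\<close>.\<close>
lemma dual_int: obtains \<alpha> where "\<And>i. pairing (h i) \<alpha> = c i - c 1"
proof
  define x y where "x = c 2 - c 1" and "y = c 3 - c 1"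
  define \<alpha> where "\<alpha> = (det * (x * snd (h 3) - y * snd (h 2)), det * (y * fst (h 2) - x * fst (h 3)))"
  have "pairing (h 2) \<alpha> = det * det * x" "pairing (h 3) \<alpha> = det * det * y"
    by (simp_all add: \<alpha>_def pairing_def det_def algebra_simps)
  then have "pairing (h i) \<alpha> = c i - c 1" for i
    using exhaust_3[of i] by (auto simp: det_square x_def y_def h1 pairing_def)
  then show "\<And>i. pairing (h i) \<alpha> = c i - c 1" .
qed

lemma dual_real: obtains u where "\<And>i. ht i u = c i - c 1"
proof
  define x y where "x = c 2 - c 1" and "y = c 3 - c 1"
  define u :: plane where "u = (det * (x * snd (h 3) - y * snd (h 2)), det * (y * fst (h 2) - x * fst (h 3)))"
  have "ht 2 u = real_of_int (det * det) * x" "ht 3 u = real_of_int (det * det) * y"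
    by (simp_all add: u_def emb_def det_def algebra_simps)
  then have "ht i u = c i - c 1" for i
    using exhaust_3[of i] by (auto simp: det_square x_def y_def h1 emb_0)
  then show "\<And>i. ht i u = c i - c 1" .
qed

lemma barycentric:
  obtains n :: "3 \<Rightarrow> int" where "(\<Sum>i\<in>UNIV. n i) = 0" "emb v = (\<Sum>i\<in>UNIV. real_of_int (n i) *\<^sub>R emb (h i))"
proof
  define x y where "x = det * (fst v * snd (h 3) - snd v * fst (h 3))"
    and "y = det * (snd v * fst (h 2) - fst v * snd (h 2))"
  define n :: "3 \<Rightarrow> int" where "n i = (if i = 2 then x else if i = 3 then y else - x - y)" for i
  show "(\<Sum>i\<in>UNIV. n i) = 0" by (simp add: sum_3 n_def)
  have "x * fst (h 2) + y * fst (h 3) = det * det * fst v" "x * snd (h 2) + y * snd (h 3) = det * det * snd v"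
    by (simp_all add: x_def y_def det_def algebra_simps)
  then have "fst v = x * fst (h 2) + y * fst (h 3)" "snd v = x * snd (h 2) + y * snd (h 3)"
    by (simp_all add: det_square)
  then show "emb v = (\<Sum>i\<in>UNIV. real_of_int (n i) *\<^sub>R emb (h i))"
    by (simp add: sum_3 n_def h1 emb_0) (simp add: emb_def)
qed

text \<open>The linear form that reads off the coefficient of \<open>h i\<close> in combinations with coefficient sum 0. As
  \<open>h 1 = 0\<close> contributes nothing, its coefficient is recovered as minus the sum of the other two.\<close>
lemma coordinate_form:
  obtains u where "\<And>l. ht l u = (if l = i then 1 else 0) - (if 1 = i then 1 else 0)"
    "\<And>c x. (\<Sum>l\<in>UNIV. c l) = 0 \<Longrightarrow> x = (\<Sum>l\<in>UNIV. c l *\<^sub>R emb (h l)) \<Longrightarrow> x \<bullet> u = c i"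
proof -
  obtain u where u: "\<And>l. ht l u = (if l = i then 1 else 0) - (if 1 = i then 1 else 0)"
    using dual_real[of "\<lambda>l. if l = i then 1 else 0"] by metis
  have "x \<bullet> u = c i" if c: "(\<Sum>l\<in>UNIV. c l) = 0" and x: "x = (\<Sum>l\<in>UNIV. c l *\<^sub>R emb (h l))" for c x
  proof -
    have "x \<bullet> u = (\<Sum>l\<in>UNIV. (if l = i then c l else 0) - c l * (if 1 = i then 1 else 0))"
      unfolding x inner_sum_left inner_scaleR_left u by (intro sum.cong) auto
    then show ?thesis by (simp add: sum_subtractf sum_distrib_right[symmetric] c)
  qed
  with u show thesis by (rule that)
qed

lemma inj_V: "inj V"
proof (rule injI, rule ccontr)
  fix i j assume "V i = V j" "i \<noteq> j"
  obtain u where u: "\<And>l. ht l u = (if l = i then 1 else 0) - (if 1 = i then 1 else 0)"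
    using coordinate_form[of i] by metis
  have "emb (h i) = emb (h j)" using \<open>V i = V j\<close> m by (simp add: V_def)
  then show False using u[of i] u[of j] \<open>i \<noteq> j\<close> by simp
qed

lemma affine_independent: "\<not> affine_dependent (range V)"
proof
  assume "affine_dependent (range V)"
  then obtain U where U: "sum U (range V) = 0" "\<exists>v\<in>range V. U v \<noteq> 0" "(\<Sum>v\<in>range V. U v *\<^sub>R v) = 0"
    by (auto simp: affine_dependent_explicit_finite)
  then obtain i where i: "U (V i) \<noteq> 0" by auto
  obtain u :: plane where u: "\<And>c x. (\<Sum>l\<in>UNIV. c l) = 0 \<Longrightarrow> x = (\<Sum>l\<in>UNIV. c l *\<^sub>R emb (h l)) \<Longrightarrow> x \<bullet> u = c i"
    using coordinate_form[of i] by metis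
  have s0: "(\<Sum>j\<in>UNIV. U (V j)) = 0"
    using U(1) by (simp add: sum.reindex[OF inj_V])
  have "0 = (\<Sum>j\<in>UNIV. U (V j) *\<^sub>R V j)"
    using U(3) by (simp add: sum.reindex[OF inj_V])
  also have "\<dots> = (\<Sum>j\<in>UNIV. U (V j)) *\<^sub>R emb t + real m *\<^sub>R (\<Sum>j\<in>UNIV. U (V j) *\<^sub>R emb (h j))"
    by (simp add: V_def scaleR_add_right sum.distrib scaleR_sum_left scaleR_sum_right mult.commute)
  finally have "0 = (\<Sum>j\<in>UNIV. U (V j) *\<^sub>R emb (h j))" using m s0 by simp
  then have "0 \<bullet> u = U (V i)" using u[OF s0] by simp
  then show False using i by simp
qed

lemma face_iff: "G face_of D \<and> G \<noteq> {} \<longleftrightarrow> (\<exists>I. I \<noteq> {} \<and> G = convex hull (V ` I))"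
proof -
  have "G face_of D \<longleftrightarrow> (\<exists>I. G = convex hull (V ` I))"
    unfolding D_def face_of_convex_hull_affine_independent[OF affine_independent]
    by (auto simp: subset_image_iff)
  then show ?thesis by (metis convex_hull_eq_empty image_is_empty)
qed

text \<open>The directions in which all the vertices with index in \<open>I\<close> are maximal: the normal cone of the
  face spanned by these vertices.\<close>
definition cone :: "3 set \<Rightarrow> plane set" where
  "cone I = {u. \<forall>i\<in>I. \<forall>j. ht j u \<le> ht i u}"

definition lineality :: "3 set \<Rightarrow> plane set" where
  "lineality I = {u. \<forall>i\<in>I. \<forall>j\<in>I. (emb (h i) - emb (h j)) \<bullet> u = 0}"

lemma cone_eqD: "u \<in> cone I \<Longrightarrow> i \<in> I \<Longrightarrow> j \<in> I \<Longrightarrow> ht i u = ht j u"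
  by (rule antisym) (simp_all add: cone_def)

lemma normal_cone_face:
  assumes "I \<noteq> {}"
  shows "normal_cone D (convex hull (V ` I)) = cone I"
proof (intro equalityI subsetI)
  fix u assume u: "u \<in> normal_cone D (convex hull (V ` I))"
  have "ht j u \<le> ht i u" if "i \<in> I" for i j
  proof -
    have "V j \<in> D" "V i \<in> convex hull (V ` I)"
      using that by (auto simp: D_def intro: hull_inc)
    then have "u \<bullet> V j \<le> u \<bullet> V i" using u by (auto simp: normal_cone_def)
    then show ?thesis using m by (simp add: V_def inner_add_right inner_commute)
  qed
  then show "u \<in> cone I" by (auto simp: cone_def)
next
  fix u assume u: "u \<in> cone I"
  obtain i where i: "i \<in> I" using assms by auto
  have "range V \<subseteq> {x. u \<bullet> x \<le> u \<bullet> V i}"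
    using u i m by (auto simp: cone_def V_def inner_add_right inner_commute)
  then have "D \<subseteq> {x. u \<bullet> x \<le> u \<bullet> V i}"
    unfolding D_def by (rule hull_minimal) (rule convex_halfspace_le)
  moreover have "ht i u = ht j u" if "j \<in> I" for j
    using cone_eqD[OF u i that] .
  then have "V ` I \<subseteq> {x. u \<bullet> x = u \<bullet> V i}"
    by (auto simp: V_def inner_add_right inner_commute)
  then have "convex hull (V ` I) \<subseteq> {x. u \<bullet> x = u \<bullet> V i}"
    by (rule hull_minimal) (rule convex_hyperplane)
  ultimately show "u \<in> normal_cone D (convex hull (V ` I))"
    unfolding normal_cone_def by fastforce
qed

lemma dual_fan_eq: "dual_fan D = cone ` {I. I \<noteq> {}}"
proof -
  have "dual_fan D = {normal_cone D G |G. \<exists>I. I \<noteq> {} \<and> G = convex hull (V ` I)}"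
    unfolding dual_fan_def face_iff ..
  also have "\<dots> = {normal_cone D (convex hull (V ` I)) |I. I \<noteq> {}}" by blast
  also have "\<dots> = {cone I |I. I \<noteq> {}}" by (metis normal_cone_face)
  finally show ?thesis by auto
qed

lemma orthogonal_face_iff:
  "orthogonal_to_face \<alpha> (convex hull (V ` I)) \<longleftrightarrow> (\<forall>i\<in>I. \<forall>j\<in>I. pairing (h i) \<alpha> = pairing (h j) \<alpha>)" (is "?L \<longleftrightarrow> ?R")
proof
  assume L: ?L
  show ?R
  proof (intro ballI)
    fix i j assume "i \<in> I" "j \<in> I"
    then have "emb \<alpha> \<bullet> (V i - V j) = 0"
      using L by (auto simp: orthogonal_to_face_def intro: hull_inc)
    then have "emb \<alpha> \<bullet> emb (h i) = emb \<alpha> \<bullet> emb (h j)"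
      using m by (simp add: V_def inner_diff_right inner_add_right)
    then show "pairing (h i) \<alpha> = pairing (h j) \<alpha>"
      by (simp add: emb_inner pairing_commute)
  qed
next
  assume R: ?R
  show ?L
  proof (cases "I = {}")
    case False
    then obtain i where i: "i \<in> I" by auto
    have "pairing (h j) \<alpha> = pairing (h i) \<alpha>" if "j \<in> I" for j using R i that by blast
    then have "V ` I \<subseteq> {x. emb \<alpha> \<bullet> x = emb \<alpha> \<bullet> V i}"
      by (auto simp: V_def inner_add_right emb_inner pairing_commute[of \<alpha>])
    then have sub: "convex hull (V ` I) \<subseteq> {x. emb \<alpha> \<bullet> x = emb \<alpha> \<bullet> V i}"
      by (rule hull_minimal) (rule convex_hyperplane)
    have "emb \<alpha> \<bullet> x = emb \<alpha> \<bullet> V i" if "x \<in> convex hull (V ` I)" for x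
      using subsetD[OF sub that] by simp
    then show ?thesis unfolding orthogonal_to_face_def by (simp add: inner_diff_right)
  qed (simp add: orthogonal_to_face_def)
qed

lemma cone_interior_point:
  obtains u where "u \<in> cone I" "\<And>i j. i \<in> I \<Longrightarrow> j \<notin> I \<Longrightarrow> ht j u < ht i u"
proof -
  obtain u where u: "\<And>l. ht l u = (if l \<in> I then 1 else 0) - (if 1 \<in> I then 1 else 0)"
    using dual_real[of "\<lambda>l. if l \<in> I then 1 else 0"] by metis
  show thesis by (rule that[of u]) (auto simp: cone_def u)
qed

lemma cone_subset_iff:
  assumes "I \<noteq> {}"
  shows "cone I \<subseteq> cone J \<longleftrightarrow> J \<subseteq> I"
proof
  assume sub: "cone I \<subseteq> cone J"
  obtain i where i: "i \<in> I" using assms by auto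
  obtain u where u: "u \<in> cone I" "\<And>i j. i \<in> I \<Longrightarrow> j \<notin> I \<Longrightarrow> ht j u < ht i u"
    using cone_interior_point[of I] by metis
  show "J \<subseteq> I"
  proof
    fix j assume "j \<in> J"
    then have "ht i u \<le> ht j u" using sub u(1) by (auto simp: cone_def)
    then show "j \<in> I" using u(2)[OF i, of j] by force
  qed
qed (auto simp: cone_def)

lemma cone_inj: "I \<noteq> {} \<Longrightarrow> J \<noteq> {} \<Longrightarrow> cone I = cone J \<longleftrightarrow> I = J"
  using cone_subset_iff by (metis subset_antisym subset_refl)

text \<open>A vector of the subspace enters the cone after adding a large multiple of a point in the
  relative interior of the cone.\<close>
lemma span_cone:
  assumes "I \<noteq> {}"
  shows "span (cone I) = lineality I"
proof
  have "subspace (lineality I)"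
    by (auto simp: subspace_def lineality_def inner_add_right)
  moreover have "cone I \<subseteq> lineality I"
  proof
    fix u assume "u \<in> cone I"
    from cone_eqD[OF this] have "(emb (h i) - emb (h j)) \<bullet> u = 0" if "i \<in> I" "j \<in> I" for i j
      unfolding inner_diff_left right_minus_eq using that .
    then show "u \<in> lineality I" by (simp add: lineality_def)
  qed
  ultimately show "span (cone I) \<subseteq> lineality I" by (rule span_minimal[rotated])
next
  show "lineality I \<subseteq> span (cone I)"
  proof
    fix u assume u: "u \<in> lineality I"
    obtain w where w: "w \<in> cone I" "\<And>i j. i \<in> I \<Longrightarrow> j \<notin> I \<Longrightarrow> ht j w < ht i w"
      using cone_interior_point[of I] by metis
    obtain i where i: "i \<in> I" using assms by auto
    \<comment> \<open>The multiple of \<open>w\<close> after which no vertex outside \<open>I\<close> exceeds those in \<open>I\<close>.\<close>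
    define c where "c = Max ((\<lambda>j. if j \<in> I then 0 else
        (ht j u - ht i u) / (ht i w - ht j w)) ` UNIV)"
    have wI: "ht j w = ht i w" if "j \<in> I" for j
      using cone_eqD[OF w(1) that i] .
    have uI: "ht j u = ht i u" if "j \<in> I" for j
    proof -
      have "(emb (h j) - emb (h i)) \<bullet> u = 0" using u i that unfolding lineality_def by blast
      then show ?thesis by (simp add: inner_diff_left)
    qed
    have le: "ht j (u + c *\<^sub>R w) \<le> ht i (u + c *\<^sub>R w)" for j
    proof (cases "j \<in> I")
      case False
      then have "(ht j u - ht i u) / (ht i w - ht j w) \<le> c"
        unfolding c_def by (intro Max_ge) (auto intro!: image_eqI[of _ _ j])
      then show ?thesis
        using w(2)[OF i False] by (simp add: inner_add_right divide_le_eq algebra_simps)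
    qed (simp add: wI uI inner_add_right)
    moreover have "ht j (u + c *\<^sub>R w) = ht i (u + c *\<^sub>R w)" if "j \<in> I" for j
      using that by (simp add: wI uI inner_add_right)
    ultimately have "u + c *\<^sub>R w \<in> cone I" by (auto simp: cone_def)
    then have "(u + c *\<^sub>R w) - c *\<^sub>R w \<in> span (cone I)"
      using w(1) by (intro span_diff span_scale span_base)
    then show "u \<in> span (cone I)" by simp
  qed
qed

lemma convex_cone: "convex (cone I)"
proof -
  have "cone I = (\<Inter>i\<in>I. \<Inter>j. {u. (emb (h j) - emb (h i)) \<bullet> u \<le> 0})"
    by (auto simp: cone_def inner_diff_left)
  then show ?thesis by (auto intro!: convex_INT convex_halfspace_le)
qed

text \<open>If \<open>x\<close> lies strictly between \<open>a\<close> and \<open>b\<close> and all vertices in \<open>I\<close> are maximal at \<open>x\<close>, then they tie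
  with those in \<open>J\<close> at \<open>a\<close> and at \<open>b\<close> as well, since there they are not larger.\<close>
lemma cone_face_iff:
  assumes "I \<noteq> {}" "J \<noteq> {}"
  shows "cone I face_of cone J \<longleftrightarrow> J \<subseteq> I"
proof
  assume "cone I face_of cone J"
  then show "J \<subseteq> I" using cone_subset_iff[OF assms(1)] face_of_imp_subset by blast
next
  assume sub: "J \<subseteq> I"
  show "cone I face_of cone J"
    unfolding face_of_def
  proof (intro conjI ballI impI)
    show "cone I \<subseteq> cone J" using sub by (auto simp: cone_def)
    show "convex (cone I)" by (rule convex_cone)
    fix a b x assume a: "a \<in> cone J" and b: "b \<in> cone J" and x: "x \<in> cone I" "x \<in> open_segment a b"
    obtain s where s: "0 < s" "s < 1" "x = (1 - s) *\<^sub>R a + s *\<^sub>R b"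
      using x(2) by (auto simp: in_segment)
    obtain j where j: "j \<in> J" using assms(2) by auto
    have "ht i a = ht j a \<and> ht i b = ht j b" if i: "i \<in> I" for i
    proof -
      have le: "ht i a \<le> ht j a" "ht i b \<le> ht j b"
        using a b j by (auto simp: cone_def)
      have "ht j x \<le> ht i x" using x(1) i by (auto simp: cone_def)
      then have "(1 - s) * (ht j a - ht i a) + s * (ht j b - ht i b) \<le> 0"
        by (simp add: s(3) inner_add_right algebra_simps)
      moreover have "0 \<le> (1 - s) * (ht j a - ht i a)" "0 \<le> s * (ht j b - ht i b)"
        using s le by (auto intro: mult_nonneg_nonneg)
      ultimately have "(1 - s) * (ht j a - ht i a) = 0" "s * (ht j b - ht i b) = 0"
        by linarith+
      then show ?thesis using s by auto
    qed
    then have eq: "ht i a = ht j a" "ht i b = ht j b" if "i \<in> I" for i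
      using that by blast+
    have "ht l a \<le> ht j a" "ht l b \<le> ht j b" for l
      using a b j by (auto simp: cone_def)
    then show "a \<in> cone I" "b \<in> cone I" by (simp_all add: cone_def eq)
  qed
qed

section \<open>Homogeneous coordinates on the real toric surface\<close>

definition supp :: "real ^ 3 \<Rightarrow> 3 set" where "supp X = {i. X $ i \<noteq> 0}"

text \<open>The point of the tropical toric surface with homogeneous coordinates \<open>\<bar>X i\<bar>\<close>. The indices of the nonzero
  coordinates determine the stratum, and the ratios of these coordinates the coset of the span of the
  cone.\<close>
definition pt :: "real ^ 3 \<Rightarrow> toric_point" where
  "pt X = (cone (supp X), {u. \<forall>i\<in>supp X. \<forall>j\<in>supp X.
      (emb (h i) - emb (h j)) \<bullet> u = ln \<bar>X $ i\<bar> - ln \<bar>X $ j\<bar>})"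

lemma supp_nonempty: "X \<noteq> 0 \<Longrightarrow> supp X \<noteq> {}"
  by (auto simp: supp_def vec_eq_iff)

lemma pt_coset:
  assumes "\<And>i j. i \<in> supp X \<Longrightarrow> j \<in> supp X \<Longrightarrow> (emb (h i) - emb (h j)) \<bullet> x = ln \<bar>X $ i\<bar> - ln \<bar>X $ j\<bar>"
  shows "snd (pt X) = (+) x ` lineality (supp X)"
proof (intro equalityI subsetI)
  fix u assume u: "u \<in> snd (pt X)"
  have "(emb (h i) - emb (h j)) \<bullet> (u - x) = 0" if "i \<in> supp X" "j \<in> supp X" for i j
  proof -
    have "(emb (h i) - emb (h j)) \<bullet> u = ln \<bar>X $ i\<bar> - ln \<bar>X $ j\<bar>" using u that by (simp add: pt_def)
    then show ?thesis unfolding inner_diff_right using assms[OF that] by simp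
  qed
  then have "u - x \<in> lineality (supp X)" by (simp add: lineality_def)
  then show "u \<in> (+) x ` lineality (supp X)" by (intro image_eqI[of _ _ "u - x"]) auto
next
  fix u assume "u \<in> (+) x ` lineality (supp X)"
  then obtain w where w: "u = x + w" "w \<in> lineality (supp X)" by auto
  have "(emb (h i) - emb (h j)) \<bullet> u = ln \<bar>X $ i\<bar> - ln \<bar>X $ j\<bar>" if "i \<in> supp X" "j \<in> supp X" for i j
  proof -
    have "(emb (h i) - emb (h j)) \<bullet> w = 0" using w(2) that unfolding lineality_def by blast
    then show ?thesis unfolding w(1) inner_add_right using assms[OF that] by simp
  qed
  then show "u \<in> snd (pt X)" by (simp add: pt_def)
qed

lemma pt_representative:
  assumes "X \<noteq> 0"
  obtains x where "x \<in> snd (pt X)" "snd (pt X) = (+) x ` lineality (supp X)"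
proof -
  obtain x where x: "\<And>i. ht i x = ln \<bar>X $ i\<bar> - ln \<bar>X $ 1\<bar>"
    using dual_real[of "\<lambda>i. ln \<bar>X $ i\<bar>"] by metis
  have "(emb (h i) - emb (h j)) \<bullet> x = ln \<bar>X $ i\<bar> - ln \<bar>X $ j\<bar>" for i j
    by (simp add: inner_diff_left x)
  then show thesis using that[of x] pt_coset[of X x] by (simp add: pt_def)
qed

lemma pt_in: "X \<noteq> 0 \<Longrightarrow> pt X \<in> toric_points (dual_fan D)"
proof -
  assume X: "X \<noteq> 0"
  obtain x where "snd (pt X) = (+) x ` span (cone (supp X))"
    using pt_representative[OF X] span_cone[OF supp_nonempty[OF X]] by metis
  moreover have "fst (pt X) = cone (supp X)" by (simp add: pt_def)
  moreover have "cone (supp X) \<in> dual_fan D" using supp_nonempty[OF X] by (simp add: dual_fan_eq)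
  ultimately show ?thesis unfolding toric_points_def by (metis (mono_tags, lifting) mem_Collect_eq prod.collapse)
qed

lemma pt_surj:
  assumes "p \<in> toric_points (dual_fan D)"
  obtains X where "X \<noteq> 0" "\<And>i. 0 \<le> X $ i" "pt X = p"
proof -
  obtain I x where I: "I \<noteq> {}" and p: "p = (cone I, (+) x ` span (cone I))"
    using assms by (auto simp: toric_points_def dual_fan_eq)
  define X :: "real ^ 3" where "X = (\<chi> i. if i \<in> I then exp (ht i x) else 0)"
  have supp: "supp X = I" by (auto simp: supp_def X_def)
  have "snd (pt X) = (+) x ` lineality (supp X)"
    by (rule pt_coset) (simp add: supp, simp add: X_def inner_diff_left)
  then have "pt X = p" unfolding p span_cone[OF I] using supp by (simp add: prod_eq_iff) (simp add: pt_def)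
  moreover have "X \<noteq> 0" using I supp by (auto simp: supp_def)
  ultimately show thesis by (intro that[of X]) (auto simp: X_def)
qed

lemma pt_eq_iff:
  assumes X: "X \<noteq> 0" and Y: "Y \<noteq> 0"
  shows "pt X = pt Y \<longleftrightarrow> (\<exists>c>0. \<forall>i. \<bar>Y $ i\<bar> = c * \<bar>X $ i\<bar>)"
proof
  assume eq: "pt X = pt Y"
  then have "cone (supp X) = cone (supp Y)" by (simp add: pt_def)
  then have s: "supp X = supp Y" using cone_inj[OF supp_nonempty[OF X] supp_nonempty[OF Y]] by simp
  obtain x where x: "x \<in> snd (pt X)" using pt_representative[OF X] by metis
  then have x': "x \<in> snd (pt Y)" using eq by simp
  obtain j where j: "j \<in> supp X" using supp_nonempty[OF X] by auto
  define c where "c = \<bar>Y $ j\<bar> / \<bar>X $ j\<bar>"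
  have nzj: "X $ j \<noteq> 0" "Y $ j \<noteq> 0" using j s by (auto simp: supp_def)
  have "\<bar>Y $ i\<bar> = c * \<bar>X $ i\<bar>" for i
  proof (cases "i \<in> supp X")
    case True
    then have nzi: "X $ i \<noteq> 0" "Y $ i \<noteq> 0" using s by (auto simp: supp_def)
    have "(emb (h i) - emb (h j)) \<bullet> x = ln \<bar>X $ i\<bar> - ln \<bar>X $ j\<bar>"
      using x True j unfolding pt_def by simp
    moreover have "(emb (h i) - emb (h j)) \<bullet> x = ln \<bar>Y $ i\<bar> - ln \<bar>Y $ j\<bar>"
      using x' True j s unfolding pt_def by simp
    ultimately have "ln (\<bar>X $ i\<bar> / \<bar>X $ j\<bar>) = ln (\<bar>Y $ i\<bar> / \<bar>Y $ j\<bar>)"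
      using nzi nzj by (simp add: ln_div)
    then have "\<bar>X $ i\<bar> / \<bar>X $ j\<bar> = \<bar>Y $ i\<bar> / \<bar>Y $ j\<bar>"
      using nzi nzj by (subst (asm) ln_inj_iff) auto
    then show ?thesis using nzi nzj by (simp add: c_def field_simps)
  next
    case False
    then have "i \<notin> supp Y" using s by simp
    with False show ?thesis by (simp add: supp_def)
  qed
  moreover have "c > 0" using nzj by (simp add: c_def)
  ultimately show "\<exists>c>0. \<forall>i. \<bar>Y $ i\<bar> = c * \<bar>X $ i\<bar>" by blast
next
  assume "\<exists>c>0. \<forall>i. \<bar>Y $ i\<bar> = c * \<bar>X $ i\<bar>"
  then obtain c where c: "c > 0" "\<And>i. \<bar>Y $ i\<bar> = c * \<bar>X $ i\<bar>" by auto
  have s: "supp Y = supp X"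
  proof -
    have "Y $ i = 0 \<longleftrightarrow> X $ i = 0" for i using c(1) c(2)[of i] by auto
    then show ?thesis by (simp add: supp_def)
  qed
  have "ln \<bar>Y $ i\<bar> - ln \<bar>Y $ j\<bar> = ln \<bar>X $ i\<bar> - ln \<bar>X $ j\<bar>" if "i \<in> supp X" "j \<in> supp X" for i j
    using that c(1) by (simp add: c(2) ln_mult supp_def)
  then show "pt X = pt Y" unfolding pt_def s by auto
qed

text \<open>Up to a common factor, the signs of the coordinates of \<open>X\<close> are those of the copy \<open>\<epsilon>\<close>; a vanishing
  coordinate has both signs.\<close>
definition matches :: "reflection \<Rightarrow> real ^ 3 \<Rightarrow> bool" where
  "matches \<epsilon> X \<longleftrightarrow> (\<exists>\<sigma>\<in>{1, -1}. \<forall>i. 0 \<le> \<sigma> * character \<epsilon> (h i) * X $ i)"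

text \<open>The class in the real toric surface of the point with homogeneous coordinates \<open>X\<close>, written as the set
  of its representatives in the four copies.\<close>
definition \<Psi> :: "real ^ 3 \<Rightarrow> (reflection \<times> toric_point) set" where
  "\<Psi> X = {(\<epsilon>, pt X) |\<epsilon>. matches \<epsilon> X}"

lemma character_determined:
  obtains \<alpha> where "\<And>i. character (mod2 \<alpha>) (h i) = (if b i then 1 else -1) * (if b 1 then 1 else -1)"
proof -
  obtain \<alpha> where \<alpha>: "\<And>i. pairing (h i) \<alpha> = (if b i then 0 else 1) - (if b 1 then 0 else 1)"
    using dual_int[of "\<lambda>i. if b i then 0 else 1"] by metis
  show thesis by (rule that[of \<alpha>]) (simp add: character_mod2 \<alpha> bit_sign_def)
qed

lemma matches_ex: "\<exists>\<epsilon>. matches \<epsilon> X"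
proof -
  obtain \<alpha> where \<alpha>: "\<And>i. character (mod2 \<alpha>) (h i) = (if 0 \<le> X $ i then 1 else -1) * (if 0 \<le> X $ 1 then 1 else -1)"
    using character_determined[of "\<lambda>i. 0 \<le> X $ i"] by metis
  have "matches (mod2 \<alpha>) X"
    unfolding matches_def by (intro bexI[of _ "if 0 \<le> X $ 1 then 1 else -1"]) (auto simp: \<alpha>)
  then show ?thesis by blast
qed

lemma reflection_add_self: "\<epsilon> + \<epsilon> = (0 :: reflection)"
  by (cases \<epsilon>) (simp add: zero_prod_def)

text \<open>The reflections that are glued along the stratum of a face are those whose characters agree,
  up to a common sign, at the vertices of the face. Given such reflections, an integer vector
  orthogonal to the face is found by prescribing its pairing with each vertex as 0 or 1, up to a common shift; the
  characters at a basis determine a reflection.\<close>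
lemma glue_iff:
  assumes "I \<noteq> {}"
  shows "(\<exists>\<alpha>. (\<forall>i\<in>I. \<forall>j\<in>I. pairing (h i) \<alpha> = pairing (h j) \<alpha>) \<and> \<epsilon>' = \<epsilon> + mod2 \<alpha>) \<longleftrightarrow>
    (\<exists>\<sigma>\<in>{1, -1}. \<forall>i\<in>I. character \<epsilon>' (h i) = \<sigma> * character \<epsilon> (h i))"
proof
  assume "\<exists>\<alpha>. (\<forall>i\<in>I. \<forall>j\<in>I. pairing (h i) \<alpha> = pairing (h j) \<alpha>) \<and> \<epsilon>' = \<epsilon> + mod2 \<alpha>"
  then obtain \<alpha> where \<alpha>: "\<forall>i\<in>I. \<forall>j\<in>I. pairing (h i) \<alpha> = pairing (h j) \<alpha>" and \<epsilon>: "\<epsilon>' = \<epsilon> + mod2 \<alpha>" by auto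
  obtain j where j: "j \<in> I" using assms by auto
  have "character \<epsilon>' (h i) = character (mod2 \<alpha>) (h j) * character \<epsilon> (h i)" if "i \<in> I" for i
  proof -
    have "pairing (h i) \<alpha> = pairing (h j) \<alpha>" using \<alpha> j that by blast
    then show ?thesis by (simp add: \<epsilon> character_add_left character_mod2)
  qed
  then show "\<exists>\<sigma>\<in>{1, -1}. \<forall>i\<in>I. character \<epsilon>' (h i) = \<sigma> * character \<epsilon> (h i)"
    using character_cases[of "mod2 \<alpha>" "h j"] by (intro bexI[of _ "character (mod2 \<alpha>) (h j)"]) auto
next
  assume "\<exists>\<sigma>\<in>{1, -1}. \<forall>i\<in>I. character \<epsilon>' (h i) = \<sigma> * character \<epsilon> (h i)"
  then obtain \<sigma> :: real where \<sigma>: "\<sigma> \<in> {1, -1}" "\<And>i. i \<in> I \<Longrightarrow> character \<epsilon>' (h i) = \<sigma> * character \<epsilon> (h i)" by blast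
  \<comment> \<open>The pairing of \<open>\<alpha>\<close> with \<open>h i\<close> has to be even, up to the common shift by its value at \<open>h 1 = 0\<close>, exactly if \<open>b i\<close>.\<close>
  define b where "b i \<longleftrightarrow> character \<epsilon>' (h i) = \<sigma> * character \<epsilon> (h i)" for i
  have val: "(if b i then 1 else -1) = \<sigma> * character \<epsilon>' (h i) * character \<epsilon> (h i)" for i
    using \<sigma>(1) character_cases[of \<epsilon> "h i"] character_cases[of \<epsilon>' "h i"] by (auto simp: b_def)
  obtain \<alpha> where \<alpha>: "\<And>i. pairing (h i) \<alpha> = (if b i then 0 else 1) - (if b 1 then 0 else 1)"
    using dual_int[of "\<lambda>i. if b i then 0 else 1"] by metis
  have "character (mod2 \<alpha>) (h i) = (if b i then 1 else -1) * (if b 1 then 1 else -1)" for i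
    by (simp add: character_mod2 \<alpha> bit_sign_def)
  also have "\<dots> i = character (\<epsilon> + \<epsilon>') (h i)" for i
    unfolding val using \<sigma>(1) by (auto simp: h1 character_0 character_add_left)
  finally have eq: "character (mod2 \<alpha>) (h i) = character (\<epsilon> + \<epsilon>') (h i)" for i .
  have "mod2 \<alpha> = \<epsilon> + \<epsilon>'"
  proof -
    let ?\<beta> = "mod2 \<alpha> + (\<epsilon> + \<epsilon>')"
    have one: "character ?\<beta> (h i) = 1" for i
      using eq[of i] character_square[of "\<epsilon> + \<epsilon>'" "h i"] by (simp only: character_add_left[of "mod2 \<alpha>"])
    have dvd: "(of_int det :: bit) = 1"
    proof -
      have "det = 1 \<or> det = -1" using unimodular by (auto simp: det_def abs_if split: if_splits)
      then show ?thesis by auto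
    qed
    obtain x y where xy: "?\<beta> = (x, y)" by (cases ?\<beta>)
    have "x * of_int (fst (h i)) + y * of_int (snd (h i)) = 0" for i
      using one[of i] by (auto simp: xy character_def bit_sign_def split: if_splits)
    then have e: "x * of_int (fst (h 2)) + y * of_int (snd (h 2)) = 0" "x * of_int (fst (h 3)) + y * of_int (snd (h 3)) = 0"
      by blast+
    have "x * of_int det = of_int (snd (h 3)) * (x * of_int (fst (h 2)) + y * of_int (snd (h 2)))
        - of_int (snd (h 2)) * (x * of_int (fst (h 3)) + y * of_int (snd (h 3)))"
      unfolding det_def of_int_diff of_int_mult by (simp only: algebra_simps)
    then have x: "x = 0" unfolding e dvd by simp
    have "y * of_int det = of_int (fst (h 2)) * (x * of_int (fst (h 3)) + y * of_int (snd (h 3)))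
        - of_int (fst (h 3)) * (x * of_int (fst (h 2)) + y * of_int (snd (h 2)))"
      unfolding det_def of_int_diff of_int_mult by (simp only: algebra_simps)
    then have y: "y = 0" unfolding e dvd by simp
    have "mod2 \<alpha> + (\<epsilon> + \<epsilon>') = 0" using xy x y by (simp add: zero_prod_def)
    then show ?thesis
      by (cases "mod2 \<alpha>"; cases "\<epsilon> + \<epsilon>'") (auto simp: zero_prod_def add_eq_0_iff2 dest!: minus_unique)
  qed
  then have "\<epsilon>' = \<epsilon> + mod2 \<alpha>"
    by (simp only: add.assoc[symmetric] reflection_add_self add_0)
  moreover have "\<forall>i\<in>I. \<forall>j\<in>I. pairing (h i) \<alpha> = pairing (h j) \<alpha>"
    using \<sigma>(2) by (simp add: \<alpha> b_def)
  ultimately show "\<exists>\<alpha>. (\<forall>i\<in>I. \<forall>j\<in>I. pairing (h i) \<alpha> = pairing (h j) \<alpha>) \<and> \<epsilon>' = \<epsilon> + mod2 \<alpha>" by blast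
qed

lemma real_proj_pt:
  assumes X: "X \<noteq> 0"
  shows "real_proj D (\<epsilon>, pt X) =
    {(\<epsilon>', pt X) |\<epsilon>'. \<exists>\<sigma>\<in>{1, -1}. \<forall>i\<in>supp X. character \<epsilon>' (h i) = \<sigma> * character \<epsilon> (h i)}"
proof -
  have "(\<epsilon>', p') \<in> real_proj D (\<epsilon>, pt X) \<longleftrightarrow>
      p' = pt X \<and> (\<exists>\<sigma>\<in>{1, -1}. \<forall>i\<in>supp X. character \<epsilon>' (h i) = \<sigma> * character \<epsilon> (h i))" for \<epsilon>' p'
  proof -
    have "(\<epsilon>', p') \<in> real_proj D (\<epsilon>, pt X) \<longleftrightarrow> p' = pt X \<and> (\<exists>\<alpha> G. \<epsilon>' = \<epsilon> + mod2 \<alpha> \<and> (G face_of D \<and> G \<noteq> {}) \<and>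
        pt X \<in> toric_points (dual_fan D) \<and> fst (pt X) = normal_cone D G \<and> orthogonal_to_face \<alpha> G)"
      unfolding real_proj_def copies_glue_def Image_singleton_iff mem_Collect_eq prod.inject by blast
    also have "\<dots> \<longleftrightarrow> p' = pt X \<and> (\<exists>\<alpha> I. \<epsilon>' = \<epsilon> + mod2 \<alpha> \<and> I \<noteq> {} \<and> cone (supp X) = normal_cone D (convex hull (V ` I)) \<and>
        orthogonal_to_face \<alpha> (convex hull (V ` I)))"
      unfolding face_iff using pt_in[OF X] by (simp only: pt_def fst_conv) blast
    also have "\<dots> \<longleftrightarrow> p' = pt X \<and> (\<exists>\<alpha>. \<epsilon>' = \<epsilon> + mod2 \<alpha> \<and> orthogonal_to_face \<alpha> (convex hull (V ` supp X)))"
      using normal_cone_face cone_inj[OF supp_nonempty[OF X]] supp_nonempty[OF X] by metis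
    also have "\<dots> \<longleftrightarrow> p' = pt X \<and> (\<exists>\<sigma>\<in>{1, -1}. \<forall>i\<in>supp X. character \<epsilon>' (h i) = \<sigma> * character \<epsilon> (h i))"
      unfolding orthogonal_face_iff glue_iff[OF supp_nonempty[OF X], symmetric] by blast
    finally show ?thesis .
  qed
  then show ?thesis by auto
qed

lemma matches_iff:
  assumes "matches \<epsilon> X"
  shows "matches \<epsilon>' X \<longleftrightarrow> (\<exists>\<sigma>\<in>{1, -1}. \<forall>i\<in>supp X. character \<epsilon>' (h i) = \<sigma> * character \<epsilon> (h i))"
proof -
  obtain s :: real where s: "s \<in> {1, -1}" "\<And>i. 0 \<le> s * character \<epsilon> (h i) * X $ i"
    using assms unfolding matches_def by blast
  show ?thesis
  proof
    assume "matches \<epsilon>' X"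
    then obtain s' :: real where s': "s' \<in> {1, -1}" "\<And>i. 0 \<le> s' * character \<epsilon>' (h i) * X $ i"
      unfolding matches_def by blast
    have "character \<epsilon>' (h i) = (s' * s) * character \<epsilon> (h i)" if "i \<in> supp X" for i
    proof -
      have "X $ i \<noteq> 0" using that by (simp add: supp_def)
      then show ?thesis
        using s(1) s'(1) s(2)[of i] s'(2)[of i] character_cases[of \<epsilon> "h i"] character_cases[of \<epsilon>' "h i"] by auto
    qed
    then show "\<exists>\<sigma>\<in>{1, -1}. \<forall>i\<in>supp X. character \<epsilon>' (h i) = \<sigma> * character \<epsilon> (h i)"
      using s(1) s'(1) by (intro bexI[of _ "s' * s"]) auto
  next
    assume "\<exists>\<sigma>\<in>{1, -1}. \<forall>i\<in>supp X. character \<epsilon>' (h i) = \<sigma> * character \<epsilon> (h i)"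
    then obtain \<sigma> :: real where \<sigma>: "\<sigma> \<in> {1, -1}" "\<And>i. i \<in> supp X \<Longrightarrow> character \<epsilon>' (h i) = \<sigma> * character \<epsilon> (h i)" by blast
    have "0 \<le> (s * \<sigma>) * character \<epsilon>' (h i) * X $ i" for i
    proof (cases "i \<in> supp X")
      case True
      then show ?thesis using \<sigma>(1) s(2)[of i] \<sigma>(2)[OF True] by auto
    qed (simp add: supp_def)
    then show "matches \<epsilon>' X"
      unfolding matches_def using s(1) \<sigma>(1) by (intro bexI[of _ "s * \<sigma>"]) auto
  qed
qed

lemma real_proj_eq_\<Psi>:
  assumes "X \<noteq> 0" "matches \<epsilon> X"
  shows "real_proj D (\<epsilon>, pt X) = \<Psi> X"
  unfolding real_proj_pt[OF assms(1)] \<Psi>_def matches_iff[OF assms(2)] ..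

text \<open>Homogeneous coordinates in the copy \<open>\<epsilon>\<close> from those in the positive copy.\<close>
definition twist :: "reflection \<Rightarrow> real ^ 3 \<Rightarrow> real ^ 3" where
  "twist \<epsilon> X = (\<chi> i. character \<epsilon> (h i) * X $ i)"

lemma real_proj_eq_\<Psi>_twist:
  assumes "X \<noteq> 0" "\<And>i. 0 \<le> X $ i"
  shows "real_proj D (\<epsilon>, pt X) = \<Psi> (twist \<epsilon> X)" "twist \<epsilon> X \<noteq> 0"
proof -
  have abs: "\<bar>twist \<epsilon> X $ i\<bar> = \<bar>X $ i\<bar>" for i
    using character_cases[of \<epsilon> "h i"] by (auto simp: twist_def)
  show nz: "twist \<epsilon> X \<noteq> 0"
  proof
    assume "twist \<epsilon> X = 0"
    then have "X $ i = 0" for i using abs[of i] by simp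
    then show False using assms(1) by (simp add: vec_eq_iff)
  qed
  have "pt (twist \<epsilon> X) = pt X"
    unfolding pt_eq_iff[OF nz assms(1)] by (intro exI[of _ 1]) (simp add: abs)
  moreover have "matches \<epsilon> (twist \<epsilon> X)"
    unfolding matches_def
    by (intro bexI[of _ 1]) (use assms(2) in \<open>auto simp: twist_def character_square mult.assoc[symmetric]\<close>)
  ultimately show "real_proj D (\<epsilon>, pt X) = \<Psi> (twist \<epsilon> X)"
    using real_proj_eq_\<Psi>[OF nz, of \<epsilon>] by simp
qed

lemma matches_scaleR:
  assumes "c \<noteq> 0" "matches \<epsilon> X" shows "matches \<epsilon> (c *\<^sub>R X)"
proof -
  obtain s :: real where s: "s \<in> {1, -1}" "\<And>i. 0 \<le> s * character \<epsilon> (h i) * X $ i"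
    using assms unfolding matches_def by blast
  have "0 \<le> (s * sgn c) * character \<epsilon> (h i) * (c *\<^sub>R X) $ i" for i
  proof -
    have eq: "(s * sgn c) * character \<epsilon> (h i) * (c *\<^sub>R X) $ i = \<bar>c\<bar> * (s * character \<epsilon> (h i) * X $ i)"
      by (simp add: abs_sgn algebra_simps)
    show ?thesis unfolding eq by (rule mult_nonneg_nonneg[OF abs_ge_zero s(2)])
  qed
  then show ?thesis
    unfolding matches_def using s(1) assms(1) by (intro bexI[of _ "s * sgn c"]) (auto simp: sgn_if)
qed

lemma \<Psi>_eq_iff:
  assumes X: "X \<noteq> 0" and Y: "Y \<noteq> 0"
  shows "\<Psi> X = \<Psi> Y \<longleftrightarrow> (\<exists>c. Y = c *\<^sub>R X)"
proof
  assume eq: "\<Psi> X = \<Psi> Y"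
  obtain \<epsilon> where \<epsilon>: "matches \<epsilon> X" using matches_ex by blast
  then have "(\<epsilon>, pt X) \<in> \<Psi> X" unfolding \<Psi>_def by blast
  then have "(\<epsilon>, pt X) \<in> \<Psi> Y" unfolding eq .
  then have p: "pt X = pt Y" and \<epsilon>': "matches \<epsilon> Y" by (auto simp: \<Psi>_def)
  obtain c where c: "c > 0" "\<And>i. \<bar>Y $ i\<bar> = c * \<bar>X $ i\<bar>" using p pt_eq_iff[OF X Y] by auto
  obtain s :: real where s: "s \<in> {1, -1}" "\<And>i. 0 \<le> s * character \<epsilon> (h i) * X $ i"
    using \<epsilon> unfolding matches_def by blast
  obtain s' :: real where s': "s' \<in> {1, -1}" "\<And>i. 0 \<le> s' * character \<epsilon> (h i) * Y $ i"
    using \<epsilon>' unfolding matches_def by blast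
  have "Y $ i = (s' * s * c) * X $ i" for i
  proof -
    have "s' * character \<epsilon> (h i) * Y $ i = \<bar>Y $ i\<bar>"
      using s'(1) s'(2)[of i] character_cases[of \<epsilon> "h i"] by auto
    moreover have "s * character \<epsilon> (h i) * X $ i = \<bar>X $ i\<bar>"
      using s(1) s(2)[of i] character_cases[of \<epsilon> "h i"] by auto
    ultimately have "s' * character \<epsilon> (h i) * Y $ i = c * (s * character \<epsilon> (h i) * X $ i)" using c(2) by simp
    then show ?thesis using s(1) s'(1) character_cases[of \<epsilon> "h i"] by auto
  qed
  then have "Y = (s' * s * c) *\<^sub>R X" by (simp add: vec_eq_iff)
  then show "\<exists>c. Y = c *\<^sub>R X" ..
next
  assume "\<exists>c. Y = c *\<^sub>R X"
  then obtain c where c: "Y = c *\<^sub>R X" by auto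
  then have "c \<noteq> 0" using Y by auto
  have "pt X = pt Y" unfolding pt_eq_iff[OF X Y] using \<open>c \<noteq> 0\<close> by (intro exI[of _ "\<bar>c\<bar>"]) (simp add: c abs_mult)
  moreover have "matches \<epsilon> X \<longleftrightarrow> matches \<epsilon> Y" for \<epsilon>
    using matches_scaleR[OF \<open>c \<noteq> 0\<close>, of \<epsilon> X] matches_scaleR[of "inverse c" \<epsilon> Y] \<open>c \<noteq> 0\<close> c by auto
  ultimately show "\<Psi> X = \<Psi> Y" by (simp add: \<Psi>_def)
qed

text \<open>With \<open>v = \<Sum> n\<^sub>i h\<^sub>i\<close> and \<open>\<Sum> n\<^sub>i = 0\<close>, the value at a point is the logarithm of the Laurent monomial
  \<open>\<Prod> \<bar>X\<^sub>i\<bar>^n\<^sub>i\<close>; it is \<open>-\<infinity>\<close> as soon as the monomial involves a vanishing coordinate.\<close>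
lemma toric_eval_pt:
  assumes X: "X \<noteq> 0" and n: "(\<Sum>i\<in>UNIV. n i) = 0" "emb v = (\<Sum>i\<in>UNIV. real_of_int (n i) *\<^sub>R emb (h i))"
  shows "toric_eval v (pt X) =
    (if \<forall>i. i \<notin> supp X \<longrightarrow> n i = 0 then ereal (\<Sum>i\<in>supp X. n i * ln \<bar>X $ i\<bar>) else - \<infinity>)"
proof -
  have inner: "emb v \<bullet> u = (\<Sum>i\<in>UNIV. n i * (ht i u))" for u
    by (simp add: n(2) inner_sum_left)
  have n': "(\<Sum>i\<in>UNIV. real_of_int (n i)) = 0" using n(1) by (metis of_int_0 of_int_sum)
  obtain j where j: "j \<in> supp X" using supp_nonempty[OF X] by auto
  have fstp: "fst (pt X) = cone (supp X)" by (simp add: pt_def)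
  have cond: "(\<forall>u\<in>cone (supp X). emb v \<bullet> u = 0) \<longleftrightarrow> (\<forall>i. i \<notin> supp X \<longrightarrow> n i = 0)"
  proof
    assume L: "\<forall>u\<in>cone (supp X). emb v \<bullet> u = 0"
    show "\<forall>i. i \<notin> supp X \<longrightarrow> n i = 0"
    proof (intro allI impI)
      fix i assume i: "i \<notin> supp X"
      obtain u where u: "\<And>l. ht l u = (if l = i then 1 else 0) - (if 1 = i then 1 else 0)"
        and coord: "emb v \<bullet> u = n i" using coordinate_form[of i] n' n(2) by metis
      have "- u \<in> cone (supp X)" using i by (auto simp: cone_def u)
      then have "emb v \<bullet> - u = 0" using L by blast
      then show "n i = 0" using coord by simp
    qed
  next
    assume R: "\<forall>i. i \<notin> supp X \<longrightarrow> n i = 0"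
    show "\<forall>u\<in>cone (supp X). emb v \<bullet> u = 0"
    proof
      fix u assume u: "u \<in> cone (supp X)"
      have "emb v \<bullet> u = (\<Sum>i\<in>UNIV. n i * (ht j u))"
        unfolding inner
      proof (intro sum.cong refl)
        fix i show "n i * (ht i u) = n i * (ht j u)"
          using R cone_eqD[OF u _ j, of i] by (cases "i \<in> supp X") auto
      qed
      then show "emb v \<bullet> u = 0" by (simp add: sum_distrib_right[symmetric] n')
    qed
  qed
  have val: "emb v \<bullet> (SOME x. x \<in> snd (pt X)) = (\<Sum>i\<in>supp X. n i * ln \<bar>X $ i\<bar>)"
    if R: "\<forall>i. i \<notin> supp X \<longrightarrow> n i = 0"
  proof -
    define x where "x = (SOME x. x \<in> snd (pt X))"
    have "x \<in> snd (pt X)" unfolding x_def using pt_representative[OF X] by (metis someI)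
    then have x: "(emb (h i) - emb (h j)) \<bullet> x = ln \<bar>X $ i\<bar> - ln \<bar>X $ j\<bar>" if "i \<in> supp X" for i
      using that j by (simp add: pt_def)
    have "emb v \<bullet> x = (\<Sum>i\<in>supp X. n i * (ht i x))"
      unfolding inner using R by (intro sum.mono_neutral_right) auto
    also have "\<dots> = (\<Sum>i\<in>supp X. n i * ln \<bar>X $ i\<bar> + n i * (ht j x - ln \<bar>X $ j\<bar>))"
    proof (intro sum.cong refl)
      fix i assume "i \<in> supp X"
      then have "ht i x = ln \<bar>X $ i\<bar> + (ht j x - ln \<bar>X $ j\<bar>)"
        using x[of i] by (simp add: inner_diff_left)
      then show "n i * (ht i x) = n i * ln \<bar>X $ i\<bar> + n i * (ht j x - ln \<bar>X $ j\<bar>)"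
        by (simp add: distrib_left)
    qed
    also have "\<dots> = (\<Sum>i\<in>supp X. n i * ln \<bar>X $ i\<bar>) + (\<Sum>i\<in>supp X. real_of_int (n i)) * (ht j x - ln \<bar>X $ j\<bar>)"
      by (simp add: sum.distrib sum_distrib_right)
    also have "(\<Sum>i\<in>supp X. real_of_int (n i)) = (\<Sum>i\<in>UNIV. real_of_int (n i))"
      using R by (intro sum.mono_neutral_left) auto
    finally show ?thesis by (simp add: n' x_def)
  qed
  show ?thesis
    unfolding toric_eval_def fstp cond using val by auto
qed

lemma toric_eval_pt_elog:
  assumes X: "X \<noteq> 0" and n: "(\<Sum>i\<in>UNIV. n i) = 0" "emb v = (\<Sum>i\<in>UNIV. real_of_int (n i) *\<^sub>R emb (h i))"
    and nonneg: "\<And>i. i \<notin> supp X \<Longrightarrow> 0 \<le> n i"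
  shows "toric_eval v (pt X) = elog (\<Prod>i\<in>UNIV. \<bar>X $ i\<bar> powi n i)"
proof (cases "\<forall>i. i \<notin> supp X \<longrightarrow> n i = 0")
  case True
  have "(\<Prod>i\<in>UNIV. \<bar>X $ i\<bar> powi n i) = (\<Prod>i\<in>supp X. \<bar>X $ i\<bar> powi n i)"
    using True by (intro prod.mono_neutral_right) auto
  moreover have "(\<Prod>i\<in>supp X. \<bar>X $ i\<bar> powi n i) > 0"
    by (intro prod_pos zero_less_power_int) (auto simp: supp_def)
  moreover have "ln (\<Prod>i\<in>supp X. \<bar>X $ i\<bar> powi n i) = (\<Sum>i\<in>supp X. n i * ln \<bar>X $ i\<bar>)"
  proof -
    have "ln (\<Prod>i\<in>supp X. \<bar>X $ i\<bar> powi n i) = (\<Sum>i\<in>supp X. ln (\<bar>X $ i\<bar> powi n i))"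
      by (rule ln_prod) (auto simp: supp_def)
    also have "\<dots> = (\<Sum>i\<in>supp X. n i * ln \<bar>X $ i\<bar>)"
      by (intro sum.cong refl) (simp add: supp_def ln_powr flip: powr_real_of_int')
    finally show ?thesis .
  qed
  ultimately show ?thesis
    unfolding toric_eval_pt[OF X n] using True by (auto simp: elog_def)
next
  case False
  then obtain i where i: "i \<notin> supp X" "n i \<noteq> 0" by auto
  then have "\<bar>X $ i\<bar> powi n i = 0" using nonneg[of i] by (auto simp: supp_def power_int_0_left_if)
  then have "(\<Prod>i\<in>UNIV. \<bar>X $ i\<bar> powi n i) = 0" by (intro prod_zero) auto
  then show ?thesis unfolding toric_eval_pt[OF X n] if_not_P[OF False] by (simp only: elog_def) simp
qed

text \<open>The exponents of the chart are those of the Laurent monomials without poles on it. The cone contains the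
  direction in which the coordinate \<open>i\<close> alone tends to 0, and there the monomial must stay bounded.\<close>
lemma chart_exponents_nonneg:
  assumes "v \<in> chart_exponents (cone J)" "i \<notin> J"
    and n: "(\<Sum>i\<in>UNIV. n i) = 0" "emb v = (\<Sum>i\<in>UNIV. real_of_int (n i) *\<^sub>R emb (h i))"
  shows "0 \<le> n i"
proof -
  have n': "(\<Sum>i\<in>UNIV. real_of_int (n i)) = 0" using n(1) by (metis of_int_0 of_int_sum)
  obtain u where u: "\<And>l. ht l u = (if l = i then 1 else 0) - (if 1 = i then 1 else 0)"
    and coord: "emb v \<bullet> u = n i" using coordinate_form[of i] n' n(2) by metis
  have "- u \<in> cone J" using assms(2) by (auto simp: cone_def u)
  then have "emb v \<bullet> - u \<le> 0" using assms(1) by (simp add: chart_exponents_def del: inner_minus_right)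
  then show ?thesis using coord by simp
qed

lemma pt_in_chart_iff:
  assumes "X \<noteq> 0" "J \<noteq> {}"
  shows "pt X \<in> toric_chart (dual_fan D) (cone J) \<longleftrightarrow> J \<subseteq> supp X"
  using pt_in[OF assms(1)] cone_face_iff[OF supp_nonempty[OF assms(1)] assms(2)]
  by (simp add: toric_chart_def pt_def)

lemma topspace_chart: "topspace (chart_topology \<Sigma> \<sigma>) = toric_chart \<Sigma> \<sigma>"
  by (auto simp: chart_topology_def topspace_pullback_topology)

lemma topspace_toric_surface: "topspace (toric_surface (dual_fan D)) = toric_points (dual_fan D)"
proof -
  have "topspace (toric_surface (dual_fan D)) = \<Union>{W. \<exists>\<sigma>\<in>dual_fan D. openin (chart_topology (dual_fan D) \<sigma>) W}"
    unfolding toric_surface_def by (rule topology_generated_by_topspace)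
  also have "\<dots> = (\<Union>\<sigma>\<in>dual_fan D. topspace (chart_topology (dual_fan D) \<sigma>))"
    by (auto simp: topspace_def)
  also have "\<dots> = toric_points (dual_fan D)"
    unfolding topspace_chart
  proof
    show "(\<Union>\<sigma>\<in>dual_fan D. toric_chart (dual_fan D) \<sigma>) \<subseteq> toric_points (dual_fan D)"
      by (auto simp: toric_chart_def)
    show "toric_points (dual_fan D) \<subseteq> (\<Union>\<sigma>\<in>dual_fan D. toric_chart (dual_fan D) \<sigma>)"
    proof
      fix p assume p: "p \<in> toric_points (dual_fan D)"
      then have "fst p \<in> dual_fan D" by (auto simp: toric_points_def)
      moreover from this have "fst p face_of fst p"
        by (auto simp: dual_fan_eq intro!: face_of_refl convex_cone)
      ultimately show "p \<in> (\<Union>\<sigma>\<in>dual_fan D. toric_chart (dual_fan D) \<sigma>)"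
        using p by (auto simp: toric_chart_def intro!: bexI[of _ "fst p"])
    qed
  qed
  finally show ?thesis .
qed

text \<open>In every chart the evaluations are logarithms of Laurent monomials without poles there.\<close>
lemma continuous_pt: "continuous_map (top_of_set (- {0})) (toric_surface (dual_fan D)) pt"
  unfolding toric_surface_def
proof (rule continuous_on_generated_topo)
  show "pt ` topspace (top_of_set (- {0})) \<subseteq> \<Union>{W. \<exists>\<sigma>\<in>dual_fan D. openin (chart_topology (dual_fan D) \<sigma>) W}"
    unfolding topology_generated_by_topspace[symmetric] toric_surface_def[symmetric] topspace_toric_surface
    using pt_in by (intro image_subsetI) simp
next
  fix W assume "W \<in> {W. \<exists>\<sigma>\<in>dual_fan D. openin (chart_topology (dual_fan D) \<sigma>) W}"
  then obtain J where J: "J \<noteq> {}" and W: "openin (chart_topology (dual_fan D) (cone J)) W"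
    by (auto simp: dual_fan_eq)
  define E where "E p = (\<lambda>v\<in>chart_exponents (cone J). toric_eval v p)" for p
  obtain U where U: "openin (product_topology (\<lambda>_. euclidean) (chart_exponents (cone J))) U"
     and WU: "W = E -` U \<inter> toric_chart (dual_fan D) (cone J)"
    using W unfolding chart_topology_def openin_pullback_topology E_def by auto
  define Y where "Y = {X :: real ^ 3. \<forall>j\<in>J. X $ j \<noteq> 0}"
  have Y_supp: "X \<in> Y \<longleftrightarrow> J \<subseteq> supp X" for X by (auto simp: Y_def supp_def)
  have nz: "X \<noteq> 0" if "X \<in> Y" for X using that J by (auto simp: Y_def)
  have "Y = (\<Inter>j\<in>J. {X. X $ j \<noteq> 0})" by (auto simp: Y_def)
  moreover have "open (\<Inter>j\<in>J. {X :: real ^ 3. X $ j \<noteq> 0})"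
    by (intro open_INT ballI open_Collect_neq continuous_intros) auto
  ultimately have openY: "open Y" by simp
  have "continuous_map (top_of_set Y) (product_topology (\<lambda>_. euclidean) (chart_exponents (cone J))) (\<lambda>X. E (pt X))"
    unfolding continuous_map_componentwise
  proof (intro conjI ballI)
    show "(\<lambda>X. E (pt X)) ` topspace (top_of_set Y) \<subseteq> extensional (chart_exponents (cone J))"
      by (auto simp: E_def)
    fix v assume v: "v \<in> chart_exponents (cone J)"
    obtain n where n: "(\<Sum>i\<in>UNIV. n i) = 0" "emb v = (\<Sum>i\<in>UNIV. real_of_int (n i) *\<^sub>R emb (h i))"
      using barycentric by metis
    have nonneg: "0 \<le> n i" if "i \<notin> J" for i
      using chart_exponents_nonneg[OF v that n] .
    have "continuous_on Y (\<lambda>X. \<bar>X $ i\<bar> powi n i)" for i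
    proof (cases "i \<in> J")
      case True
      then show ?thesis by (intro continuous_intros) (auto simp: Y_def)
    next
      case False
      then have eq: "(\<lambda>X :: real ^ 3. \<bar>X $ i\<bar> powi n i) = (\<lambda>X. \<bar>X $ i\<bar> ^ nat (n i))"
        using nonneg[OF False] by (simp add: power_int_def)
      show ?thesis unfolding eq by (intro continuous_intros)
    qed
    then have "continuous_on Y (\<lambda>X. \<Prod>i\<in>UNIV. \<bar>X $ i\<bar> powi n i)"
      by (intro continuous_on_prod)
    then have "continuous_on Y (\<lambda>X. elog (\<Prod>i\<in>UNIV. \<bar>X $ i\<bar> powi n i))"
      by (rule continuous_on_compose2[OF continuous_elog]) auto
    moreover have "E (pt X) v = elog (\<Prod>i\<in>UNIV. \<bar>X $ i\<bar> powi n i)" if "X \<in> Y" for X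
    proof -
      have "0 \<le> n i" if "i \<notin> supp X" for i using nonneg that \<open>X \<in> Y\<close> Y_supp by blast
      then show ?thesis
        using toric_eval_pt_elog[OF nz[OF that] n] v by (simp add: E_def)
    qed
    ultimately have "continuous_on Y (\<lambda>X. E (pt X) v)" by (simp cong: continuous_on_cong)
    then show "continuous_map (top_of_set Y) euclidean (\<lambda>X. E (pt X) v)" by simp
  qed
  then have "openin (top_of_set Y) {X \<in> topspace (top_of_set Y). E (pt X) \<in> U}"
    using U by (rule openin_continuous_map_preimage)
  moreover have "{X \<in> topspace (top_of_set Y). E (pt X) \<in> U} = pt -` W \<inter> - {0}"
  proof -
    have mem: "X \<in> Y \<and> E (pt X) \<in> U \<longleftrightarrow> pt X \<in> W \<and> X \<noteq> 0" for X
      using Y_supp[of X] nz[of X] pt_in_chart_iff[OF _ J, of X] by (cases "X = 0") (auto simp: WU)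
    show ?thesis
    proof (rule set_eqI)
      fix X show "X \<in> {X \<in> topspace (top_of_set Y). E (pt X) \<in> U} \<longleftrightarrow> X \<in> pt -` W \<inter> - {0}"
        using mem[of X] by simp
    qed
  qed
  ultimately have "open (pt -` W \<inter> - {0})"
    using openY by (simp add: openin_open_eq)
  then show "openin (top_of_set (- {0})) (pt -` W \<inter> topspace (top_of_set (- {0})))"
    by (simp add: openin_open_eq open_Compl)
qed

abbreviation "copies \<equiv> sum_topology (\<lambda>\<epsilon>::reflection. toric_surface (dual_fan D)) UNIV"

lemma continuous_real_proj: "continuous_map copies (real_toric_surface D) (real_proj D)"
  unfolding real_toric_surface_def
  by (rule quotient_imp_continuous_map[OF quotient_map_quotient_topology])

lemma continuous_real_proj_pt:
  "continuous_map (top_of_set (- {0})) (real_toric_surface D) (\<lambda>X. real_proj D (\<epsilon>, pt X))"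
proof -
  have "continuous_map (top_of_set (- {0})) (real_toric_surface D) (real_proj D \<circ> (Pair \<epsilon> \<circ> pt))"
    by (intro continuous_map_compose[OF _ continuous_real_proj] continuous_map_compose[OF continuous_pt]
        continuous_map_component_injection) simp
  then show ?thesis by (simp add: o_def)
qed

lemma continuous_\<Psi>: "continuous_map (top_of_set (- {0})) (real_toric_surface D) \<Psi>"
proof (rule pasting_lemma_closed[where I = UNIV and T = "\<lambda>\<epsilon>. {X \<in> - {0}. matches \<epsilon> X}"
      and f = "\<lambda>\<epsilon> X. real_proj D (\<epsilon>, pt X)"])
  show "finite (UNIV :: reflection set)"
  proof -
    have "(UNIV :: bit set) = {0, 1}" by (auto intro: bit.exhaust)
    then have "finite (UNIV :: bit set)" by (metis finite.emptyI finite_insert)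
    then show ?thesis unfolding UNIV_Times_UNIV[symmetric] by (rule finite_cartesian_product) (rule \<open>finite (UNIV :: bit set)\<close>)
  qed
next
  fix \<epsilon>
  have "{X. matches \<epsilon> X} = (\<Union>\<sigma>\<in>{1, -1}. \<Inter>i. {X. 0 \<le> \<sigma> * character \<epsilon> (h i) * X $ i})"
    by (auto simp: matches_def)
  moreover have "closed (\<Union>\<sigma>\<in>{1, -1}. \<Inter>i. {X :: real ^ 3. 0 \<le> \<sigma> * character \<epsilon> (h i) * X $ i})"
    by (intro closed_UN ballI closed_INT closed_Collect_le continuous_intros) auto
  ultimately have "closed {X. matches \<epsilon> X}" by simp
  moreover have "{X \<in> - {0}. matches \<epsilon> X} = - {0} \<inter> {X. matches \<epsilon> X}" by auto
  ultimately show "closedin (top_of_set (- {0})) {X \<in> - {0}. matches \<epsilon> X}"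
    by (metis closedin_closed_Int)
next
  fix \<epsilon>
  show "continuous_map (subtopology (top_of_set (- {0})) {X \<in> - {0}. matches \<epsilon> X}) (real_toric_surface D)
     (\<lambda>X. real_proj D (\<epsilon>, pt X))"
    by (rule continuous_map_from_subtopology[OF continuous_real_proj_pt])
next
  fix \<epsilon> \<epsilon>' X
  assume "X \<in> topspace (top_of_set (- {0})) \<inter> {X \<in> - {0}. matches \<epsilon> X} \<inter> {X \<in> - {0}. matches \<epsilon>' X}"
  then have "X \<noteq> 0" "matches \<epsilon> X" "matches \<epsilon>' X" by auto
  then show "real_proj D (\<epsilon>, pt X) = real_proj D (\<epsilon>', pt X)" by (simp add: real_proj_eq_\<Psi>)
next
  fix X :: "real ^ 3" assume "X \<in> topspace (top_of_set (- {0}))"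
  then have X: "X \<noteq> 0" by simp
  obtain \<epsilon> where "matches \<epsilon> X" using matches_ex by blast
  then show "\<exists>\<epsilon>. \<epsilon> \<in> UNIV \<and> X \<in> {X \<in> - {0}. matches \<epsilon> X} \<and> \<Psi> X = real_proj D (\<epsilon>, pt X)"
    using X by (intro exI[of _ \<epsilon>]) (simp add: real_proj_eq_\<Psi>)
qed

text \<open>A section of \<open>\<Psi>\<close> over the copy \<open>\<epsilon>\<close> of the affine chart where the coordinate \<open>j\<close> can be normalised to 1.
  Its components are exponentials of evaluations, hence continuous.\<close>
definition affine_coords :: "reflection \<Rightarrow> 3 \<Rightarrow> toric_point \<Rightarrow> real ^ 3" where
  "affine_coords \<epsilon> j p = (\<chi> i. character \<epsilon> (h i) * eexp (toric_eval (h i - h j) p))"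

lemma affine_coords_pt:
  assumes X: "X \<noteq> 0" "\<And>i. 0 \<le> X $ i" and j: "j \<in> supp X"
  shows "affine_coords \<epsilon> j (pt X) = (1 / X $ j) *\<^sub>R twist \<epsilon> X"
    and "toric_eval (h i - h j) (pt X) < \<infinity>"
proof -
  have ev: "toric_eval (h i - h j) (pt X) = elog (X $ i / X $ j)" for i
  proof -
    define n :: "3 \<Rightarrow> int" where "n l = (if l = i then 1 else 0) - (if l = j then 1 else 0)" for l
    have n: "(\<Sum>l\<in>UNIV. n l) = 0" by (simp add: n_def sum_subtractf)
    have e: "emb (h i - h j) = (\<Sum>l\<in>UNIV. real_of_int (n l) *\<^sub>R emb (h l))"
    proof -
      have "real_of_int (n l) *\<^sub>R emb (h l) = (if l = i then emb (h l) else 0) - (if l = j then emb (h l) else 0)" for l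
        by (auto simp: n_def)
      then show ?thesis by (simp add: sum_subtractf emb_diff)
    qed
    have nonneg: "0 \<le> n l" if "l \<notin> supp X" for l using that j by (auto simp: n_def)
    have nz: "X $ j \<noteq> 0" using j by (simp add: supp_def)
    have "(\<Prod>l\<in>UNIV. \<bar>X $ l\<bar> powi n l) = X $ i / X $ j"
    proof (cases "i = j")
      case True
      then show ?thesis using nz by (simp add: n_def)
    next
      case False
      have "(\<Prod>l\<in>UNIV. \<bar>X $ l\<bar> powi n l) = (\<Prod>l\<in>UNIV. (if l = i then X $ l else 1) * (if l = j then inverse (X $ l) else 1))"
        using False X(2) by (intro prod.cong refl) (auto simp: n_def power_int_minus)
      also have "\<dots> = X $ i * inverse (X $ j)" by (simp add: prod.distrib)
      finally show ?thesis by (simp add: field_simps)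
    qed
    then show ?thesis using toric_eval_pt_elog[OF X(1) n e nonneg] by simp
  qed
  have pos: "0 < X $ j" using j X(2)[of j] by (simp add: supp_def order_less_le)
  show "affine_coords \<epsilon> j (pt X) = (1 / X $ j) *\<^sub>R twist \<epsilon> X"
    using X(2) pos by (simp add: vec_eq_iff affine_coords_def twist_def ev eexp_elog)
  show "toric_eval (h i - h j) (pt X) < \<infinity>"
    by (simp add: ev elog_def)
qed

lemma pt_in_chart_cases:
  assumes "p \<in> toric_chart (dual_fan D) (cone {j})"
  obtains X where "X \<noteq> 0" "\<And>i. 0 \<le> X $ i" "pt X = p" "j \<in> supp X"
proof -
  have "p \<in> toric_points (dual_fan D)" using assms by (auto simp: toric_chart_def)
  then obtain X where X: "X \<noteq> 0" "\<And>i. 0 \<le> X $ i" "pt X = p" using pt_surj by metis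
  then have "j \<in> supp X" using assms pt_in_chart_iff[OF X(1), of "{j}"] by simp
  with X that show thesis by blast
qed

lemma difference_in_chart_exponents: "h i - h j \<in> chart_exponents (cone {j})"
  by (simp add: chart_exponents_def cone_def emb_diff inner_diff_left)

lemma continuous_affine_coords:
  "continuous_map (chart_topology (dual_fan D) (cone {j})) (top_of_set (- {0})) (affine_coords \<epsilon> j)"
proof -
  let ?T = "chart_topology (dual_fan D) (cone {j})"
  have ev: "continuous_map ?T euclidean (toric_eval (h i - h j))" for i
  proof -
    let ?c = "\<lambda>p. \<lambda>v\<in>chart_exponents (cone {j}). toric_eval v p"
    have "continuous_map ?T euclidean ((\<lambda>f. f (h i - h j)) \<circ> ?c)"
      unfolding chart_topology_def
      by (intro continuous_map_pullback continuous_map_product_projection difference_in_chart_exponents)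
    moreover have "(\<lambda>f. f (h i - h j)) \<circ> ?c = toric_eval (h i - h j)"
      using difference_in_chart_exponents by (simp add: fun_eq_iff)
    ultimately show ?thesis by simp
  qed
  have fin: "toric_eval (h i - h j) p < \<infinity>" if "p \<in> topspace ?T" for i p
    using that affine_coords_pt(2) unfolding topspace_chart by (metis pt_in_chart_cases)
  have comp: "continuous_map ?T euclidean (\<lambda>p. eexp (toric_eval (h i - h j) p))" for i
  proof -
    have "continuous_map ?T (top_of_set {..<\<infinity>}) (toric_eval (h i - h j))"
      using ev[of i] fin by (auto simp: continuous_map_in_subtopology)
    moreover have "continuous_map (top_of_set {..<\<infinity>}) euclidean eexp"
      using continuous_eexp by simp
    ultimately have "continuous_map ?T euclidean (eexp \<circ> toric_eval (h i - h j))"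
      by (rule continuous_map_compose)
    then show ?thesis by (simp add: o_def)
  qed
  have "continuous_map ?T euclidean (affine_coords \<epsilon> j)"
  proof -
    have "affine_coords \<epsilon> j = (\<lambda>p. \<Sum>i\<in>UNIV. (character \<epsilon> (h i) * eexp (toric_eval (h i - h j) p)) *\<^sub>R axis i 1)"
      by (simp add: fun_eq_iff affine_coords_def vec_eq_iff axis_def if_distrib cong: if_cong)
    moreover have "continuous_map ?T euclidean (\<lambda>p. (character \<epsilon> (h i) * eexp (toric_eval (h i - h j) p)) *\<^sub>R (axis i 1 :: real ^ 3))" for i
    proof -
      have "continuous_map euclidean euclidean (\<lambda>x. (character \<epsilon> (h i) * x) *\<^sub>R (axis i 1 :: real ^ 3))"
        by (simp add: continuous_intros)
      from continuous_map_compose[OF comp this] show ?thesis by (simp add: o_def)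
    qed
    ultimately show ?thesis by (simp add: continuous_map_sum)
  qed
  moreover have "affine_coords \<epsilon> j p \<noteq> 0" if "p \<in> topspace ?T" for p
  proof -
    obtain X where X: "X \<noteq> 0" "\<And>i. 0 \<le> X $ i" "pt X = p" "j \<in> supp X"
      using \<open>p \<in> topspace ?T\<close> unfolding topspace_chart by (metis pt_in_chart_cases)
    then have "affine_coords \<epsilon> j p = (1 / X $ j) *\<^sub>R twist \<epsilon> X" using affine_coords_pt(1) by metis
    then show ?thesis using real_proj_eq_\<Psi>_twist(2)[OF X(1,2)] X(4) by (simp add: supp_def)
  qed
  ultimately show ?thesis by (auto simp: continuous_map_in_subtopology)
qed

lemma \<Psi>_affine_coords:
  assumes "p \<in> toric_chart (dual_fan D) (cone {j})"
  shows "\<Psi> (affine_coords \<epsilon> j p) = real_proj D (\<epsilon>, p)"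
proof -
  obtain X where X: "X \<noteq> 0" "\<And>i. 0 \<le> X $ i" "pt X = p" "j \<in> supp X"
    using assms by (metis pt_in_chart_cases)
  have a: "affine_coords \<epsilon> j p = (1 / X $ j) *\<^sub>R twist \<epsilon> X" using affine_coords_pt(1) X by metis
  have nz: "twist \<epsilon> X \<noteq> 0" "1 / X $ j \<noteq> 0" using real_proj_eq_\<Psi>_twist(2)[OF X(1,2)] X(4) by (simp_all add: supp_def)
  then have "\<Psi> (twist \<epsilon> X) = \<Psi> ((1 / X $ j) *\<^sub>R twist \<epsilon> X)"
    by (subst \<Psi>_eq_iff) auto
  then show ?thesis unfolding a using real_proj_eq_\<Psi>_twist(1)[OF X(1,2)] X(3) by simp
qed

lemma topspace_copies: "topspace copies = UNIV \<times> toric_points (dual_fan D)"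
  by (simp add: topspace_toric_surface o_def)

text \<open>A set with open preimage is open because the affine charts cover the surface, and over every copy of
  such a chart \<open>\<Psi>\<close> has the continuous section \<open>affine_coords\<close>.\<close>
theorem quotient_\<Psi>: "quotient_map (top_of_set (- {0})) (real_toric_surface D) \<Psi>"
  unfolding quotient_map_def
proof (intro conjI allI impI)
  have top: "topspace (real_toric_surface D) = real_proj D ` (UNIV \<times> toric_points (dual_fan D))"
    using quotient_imp_surjective_map[OF quotient_map_quotient_topology, of "real_proj D" copies]
    unfolding real_toric_surface_def topspace_copies by simp
  have "\<Psi> ` (- {0}) = real_proj D ` (UNIV \<times> toric_points (dual_fan D))"
  proof (intro equalityI subsetI)
    fix z assume "z \<in> \<Psi> ` (- {0})"
    then obtain X where X: "X \<noteq> 0" "z = \<Psi> X" by auto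
    obtain \<epsilon> where "matches \<epsilon> X" using matches_ex by blast
    then have "z = real_proj D (\<epsilon>, pt X)" using real_proj_eq_\<Psi>[OF X(1)] X(2) by simp
    then show "z \<in> real_proj D ` (UNIV \<times> toric_points (dual_fan D))" using pt_in[OF X(1)] by blast
  next
    fix z assume "z \<in> real_proj D ` (UNIV \<times> toric_points (dual_fan D))"
    then obtain \<epsilon> p where p: "z = real_proj D (\<epsilon>, p)" "p \<in> toric_points (dual_fan D)" by auto
    obtain X where X: "X \<noteq> 0" "\<And>i. 0 \<le> X $ i" "pt X = p" using pt_surj[OF p(2)] by metis
    then show "z \<in> \<Psi> ` (- {0})" using real_proj_eq_\<Psi>_twist[OF X(1,2), of \<epsilon>] p(1) by auto
  qed
  then show surj: "\<Psi> ` topspace (top_of_set (- {0})) = topspace (real_toric_surface D)"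
    using top by simp
  fix U assume U: "U \<subseteq> topspace (real_toric_surface D)"
  show "openin (top_of_set (- {0})) {x \<in> topspace (top_of_set (- {0})). \<Psi> x \<in> U} = openin (real_toric_surface D) U"
  proof
    assume "openin (real_toric_surface D) U"
    with continuous_\<Psi> show "openin (top_of_set (- {0})) {x \<in> topspace (top_of_set (- {0})). \<Psi> x \<in> U}"
      by (rule openin_continuous_map_preimage)
  next
    assume L: "openin (top_of_set (- {0})) {x \<in> topspace (top_of_set (- {0})). \<Psi> x \<in> U}"
    have "openin (toric_surface (dual_fan D)) {p \<in> toric_points (dual_fan D). real_proj D (\<epsilon>, p) \<in> U}" for \<epsilon>
    proof -
      define W where "W j = {p \<in> toric_chart (dual_fan D) (cone {j}). real_proj D (\<epsilon>, p) \<in> U}" for j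
      have "openin (toric_surface (dual_fan D)) (W j)" for j
      proof -
        have "openin (chart_topology (dual_fan D) (cone {j}))
            {p \<in> topspace (chart_topology (dual_fan D) (cone {j})). affine_coords \<epsilon> j p \<in> {x \<in> topspace (top_of_set (- {0})). \<Psi> x \<in> U}}"
          using continuous_affine_coords L by (rule openin_continuous_map_preimage)
        moreover have "{p \<in> topspace (chart_topology (dual_fan D) (cone {j})). affine_coords \<epsilon> j p \<in> {x \<in> topspace (top_of_set (- {0})). \<Psi> x \<in> U}} = W j"
        proof -
          have nz: "affine_coords \<epsilon> j p \<noteq> 0" if "p \<in> topspace (chart_topology (dual_fan D) (cone {j}))" for p
            using continuous_map_image_subset_topspace[OF continuous_affine_coords[of j \<epsilon>]] that by auto
          have "p \<in> {p \<in> topspace (chart_topology (dual_fan D) (cone {j})). affine_coords \<epsilon> j p \<in> {x \<in> topspace (top_of_set (- {0})). \<Psi> x \<in> U}} \<longleftrightarrow> p \<in> W j" for p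
            using nz[of p] \<Psi>_affine_coords[of p j \<epsilon>] unfolding W_def topspace_chart by auto
          then show ?thesis by (rule set_eqI)
        qed
        ultimately have "openin (chart_topology (dual_fan D) (cone {j})) (W j)" by simp
        moreover have "cone {j} \<in> dual_fan D" by (simp add: dual_fan_eq)
        ultimately show ?thesis
          unfolding toric_surface_def by (intro topology_generated_by_Basis) blast
      qed
      then have "openin (toric_surface (dual_fan D)) (\<Union>j. W j)" by blast
      moreover have "(\<Union>j. W j) = {p \<in> toric_points (dual_fan D). real_proj D (\<epsilon>, p) \<in> U}"
      proof (intro equalityI subsetI)
        fix p assume "p \<in> (\<Union>j. W j)"
        then show "p \<in> {p \<in> toric_points (dual_fan D). real_proj D (\<epsilon>, p) \<in> U}"
          by (auto simp: W_def toric_chart_def)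
      next
        fix p assume p: "p \<in> {p \<in> toric_points (dual_fan D). real_proj D (\<epsilon>, p) \<in> U}"
        then obtain X where X: "X \<noteq> 0" "pt X = p" using pt_surj[of p] by blast
        obtain j where "j \<in> supp X" using supp_nonempty[OF X(1)] by auto
        then have "p \<in> toric_chart (dual_fan D) (cone {j})" using pt_in_chart_iff[OF X(1), of "{j}"] X(2) by simp
        then show "p \<in> (\<Union>j. W j)" using p by (auto simp: W_def)
      qed
      ultimately show ?thesis by simp
    qed
    then have "openin copies {z \<in> topspace copies. real_proj D z \<in> U}"
      unfolding openin_sum_topology topspace_copies
      by (auto simp: topspace_toric_surface)
    moreover have "U \<subseteq> real_proj D ` topspace copies"
      using U unfolding top topspace_copies .
    ultimately show "openin (real_toric_surface D) U"
      unfolding real_toric_surface_def openin_quotient_topology by blast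
  qed
qed

end

section \<open>Active exponents of a nonsingular tropical curve\<close>

definition ldet :: "lat \<Rightarrow> lat \<Rightarrow> lat \<Rightarrow> int" where
  "ldet u v w = (fst v - fst u) * (snd w - snd u) - (fst w - fst u) * (snd v - snd u)"

text \<open>Transports the area formula for triangles from the space of vectors of length 2 to the plane of pairs.\<close>
lemma lborel_plane: "(lborel :: plane measure) = distr (lborel :: (real ^ 2) measure) borel (\<lambda>x. (x $ 1, x $ 2))"
proof (rule lborel_eqI)
  fix l u :: plane assume lu: "\<And>b. b \<in> Basis \<Longrightarrow> l \<bullet> b \<le> u \<bullet> b"
  define L U :: "real ^ 2" where "L = vector [fst l, snd l]" and "U = vector [fst u, snd u]"
  have pre: "(\<lambda>x :: real ^ 2. (x $ 1, x $ 2)) -` box l u = box L U"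
    by (auto simp: L_def U_def mem_box Basis_prod_def Basis_vec_def inner_axis inner_prod_def forall_2 split: if_splits)
  have le: "fst l \<le> fst u" "snd l \<le> snd u"
    using lu[of "(1, 0)"] lu[of "(0, 1)"] by (auto simp: Basis_prod_def inner_prod_def)
  have LU: "L $ i \<le> U $ i" for i
    using exhaust_2[of i] le by (auto simp: L_def U_def)
  have meas: "(\<lambda>x :: real ^ 2. (x $ 1, x $ 2)) \<in> borel_measurable borel"
    by (intro borel_measurable_continuous_onI continuous_intros)
  have "emeasure (distr lborel borel (\<lambda>x :: real ^ 2. (x $ 1, x $ 2))) (box l u) = emeasure lborel (box L U)"
    using meas by (subst emeasure_distr) (simp_all add: pre)
  also have "\<dots> = (\<Prod>b\<in>Basis. (U - L) \<bullet> b)"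
    by (rule emeasure_lborel_box) (use LU in \<open>auto simp: Basis_vec_def inner_axis\<close>)
  also have "(\<Prod>b\<in>Basis. (U - L) \<bullet> b) = (fst u - fst l) * (snd u - snd l)"
  proof -
    have B: "(Basis :: (real ^ 2) set) = {axis 1 1, axis 2 1}"
      by (auto simp: Basis_vec_def UNIV_2)
    have ne: "axis 1 1 \<noteq> (axis 2 1 :: real ^ 2)" by (simp add: axis_eq_axis)
    show ?thesis unfolding B using ne by (simp add: inner_axis L_def U_def)
  qed
  also have "\<dots> = (\<Prod>b\<in>Basis. (u - l) \<bullet> b)"
  proof -
    have B: "(Basis :: plane set) = {(1, 0), (0, 1)}" by (auto simp: Basis_prod_def)
    show ?thesis unfolding B by (cases u, cases l) simp
  qed
  finally show "emeasure (distr lborel borel (\<lambda>x :: real ^ 2. (x $ 1, x $ 2))) (box l u) = (\<Prod>b\<in>Basis. (u - l) \<bullet> b)" .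
qed simp

lemma measure_lattice_triangle:
  "measure lebesgue (convex hull {emb u, emb v, emb w}) = \<bar>real_of_int (ldet u v w)\<bar> / 2"
proof -
  let ?f = "\<lambda>x :: real ^ 2. (x $ 1, x $ 2)"
  define g :: "plane \<Rightarrow> real ^ 2" where "g p = vector [fst p, snd p]" for p
  have fg: "?f (g p) = p" for p by (simp add: g_def)
  have gf: "g (?f x) = x" for x by (simp add: g_def vec_eq_iff forall_2)
  have lin: "linear g"
    by (rule linearI) (simp_all add: g_def vec_eq_iff forall_2)
  let ?T = "convex hull {emb u, emb v, emb w}"
  have comp: "compact ?T" by (intro finite_imp_compact_convex_hull) simp
  have bor: "?T \<in> sets borel" using comp by (simp add: compact_imp_closed)
  have pre: "?f -` ?T = convex hull {g (emb u), g (emb v), g (emb w)}"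
  proof -
    have "?f -` ?T = g ` ?T"
      by (auto intro!: image_eqI[of _ g] simp: gf fg)
    also have "\<dots> = convex hull (g ` {emb u, emb v, emb w})"
      by (rule convex_hull_linear_image[OF lin])
    finally show ?thesis by simp
  qed
  have meas: "?f \<in> borel_measurable borel"
    by (intro borel_measurable_continuous_onI continuous_intros)
  have "measure lebesgue ?T = measure lborel ?T" using bor by simp
  also have "\<dots> = measure (distr lborel borel ?f) ?T" by (subst lborel_plane) simp
  also have "\<dots> = measure lborel (convex hull {g (emb u), g (emb v), g (emb w)})"
    using meas bor by (subst measure_distr) (simp_all add: pre)
  also have "\<dots> = \<bar>real_of_int (ldet u v w)\<bar> / 2"
    unfolding content_triangle by (simp add: g_def emb_def ldet_def abs_minus_commute mult.commute)
  finally show ?thesis .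
qed

text \<open>By Cramer's rule the barycentric coordinates of a lattice point are integers, so if they are
  nonnegative with sum 1, one of them is 1.\<close>
lemma lattice_points_of_unimodular_triangle:
  assumes det: "\<bar>ldet u v w\<bar> = 1" and x: "emb x \<in> convex hull {emb u, emb v, emb w}"
  shows "x \<in> {u, v, w}"
proof -
  obtain r s q where c: "0 \<le> r" "0 \<le> s" "0 \<le> q" "r + s + q = 1"
    "emb x = r *\<^sub>R emb u + s *\<^sub>R emb v + q *\<^sub>R emb w"
    using x unfolding convex_hull_3 by auto
  have r: "r = 1 - s - q" using c(4) by simp
  have x1: "real_of_int (fst x - fst u) = s * real_of_int (fst v - fst u) + q * real_of_int (fst w - fst u)"
    using c(5) by (simp add: emb_def r algebra_simps)
  have x2: "real_of_int (snd x - snd u) = s * real_of_int (snd v - snd u) + q * real_of_int (snd w - snd u)"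
    using c(5) by (simp add: emb_def r algebra_simps)
  have "real_of_int (ldet u x w) = s * real_of_int (ldet u v w)"
    unfolding ldet_def of_int_diff[of "_ * _"] of_int_mult x1 x2 by (simp add: algebra_simps)
  then have s: "s = real_of_int (ldet u x w * ldet u v w)"
    using det by (auto simp: abs_if split: if_splits)
  have "real_of_int (ldet u v x) = q * real_of_int (ldet u v w)"
    unfolding ldet_def of_int_diff[of "_ * _"] of_int_mult x1 x2 by (simp add: algebra_simps)
  then have q: "q = real_of_int (ldet u v x * ldet u v w)"
    using det by (auto simp: abs_if split: if_splits)
  obtain i j :: int where ij: "s = i" "q = j" using s q by blast
  have "0 \<le> i" "0 \<le> j" "i + j \<le> 1"
    using c ij by linarith+
  then consider "i = 0" "j = 0" | "i = 1" "j = 0" | "i = 0" "j = 1" by linarith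
  then show ?thesis
  proof cases
    case 1 then have "x = u" using x1 x2 ij by (simp add: prod_eq_iff)
    then show ?thesis by simp
  next
    case 2 then have "x = v" using x1 x2 ij by (simp add: prod_eq_iff)
    then show ?thesis by simp
  next
    case 3 then have "x = w" using x1 x2 ij by (simp add: prod_eq_iff)
    then show ?thesis by simp
  qed
qed

context
  fixes A :: "lat set" and a :: "lat \<Rightarrow> real"
  assumes A: "exponent_set A"
begin

lemma exponents_finite: "finite A" and exponents_nonempty: "A \<noteq> {}"
  using A by (auto simp: exponent_set_def)

lemma active_iff: "m \<in> active A a p \<longleftrightarrow> m \<in> A \<and> (\<forall>n\<in>A. trop_monomial a n p \<le> trop_monomial a m p)"
proof (cases "m \<in> A")
  case True
  have "trop_poly A a p = trop_monomial a m p \<longleftrightarrow> (\<forall>n\<in>A. trop_monomial a n p \<le> trop_monomial a m p)"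
    unfolding trop_poly_def using True exponents_finite
    by (subst Max_eq_iff) auto
  then show ?thesis using True by (simp add: active_def)
qed (simp add: active_def)

lemma active_nonempty: "active A a p \<noteq> {}"
proof -
  have "trop_poly A a p \<in> (\<lambda>m. trop_monomial a m p) ` A"
    unfolding trop_poly_def using exponents_finite exponents_nonempty by (intro Max_in) auto
  then show ?thesis by (auto simp: active_def)
qed

lemma active_subset: "active A a p \<subseteq> A" by (auto simp: active_def)

lemma convex_cell: "convex {q. active A a p \<subseteq> active A a q}"
proof -
  have "{q. active A a p \<subseteq> active A a q} = (\<Inter>m\<in>active A a p. \<Inter>n\<in>A. {q. (emb n - emb m) \<bullet> q \<le> a m - a n})"
    using active_subset[of p]
    by (auto simp: active_iff subset_iff trop_monomial_def inner_diff_left algebra_simps)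
  then show ?thesis by (auto intro!: convex_INT convex_halfspace_le)
qed

text \<open>All points in the relative interior of a cell have the same active exponents: an exponent that is
  active at an interior point but not at \<open>p\<close> would exceed the maximum just beyond the interior point on the
  line from \<open>p\<close>.\<close>
lemma dual_face_cell: "dual_face A a {q. active A a p \<subseteq> active A a q} = convex hull (emb ` active A a p)"
proof -
  let ?F = "{q. active A a p \<subseteq> active A a q}"
  have "p \<in> ?F" by simp
  then have "?F \<noteq> {}" by blast
  then have "rel_interior ?F \<noteq> {}" using convex_cell rel_interior_eq_empty by blast
  then have "(SOME p. p \<in> rel_interior ?F) \<in> rel_interior ?F" by (simp add: some_in_eq)
  then obtain p0 where p0_def: "(SOME p. p \<in> rel_interior ?F) = p0" and p0: "p0 \<in> rel_interior ?F" by metis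
  then have sub: "active A a p \<subseteq> active A a p0" using rel_interior_subset by blast
  obtain m where m: "m \<in> active A a p" using active_nonempty by blast
  have "n \<in> active A a p" if n: "n \<in> active A a p0" for n
  proof (rule ccontr)
    assume "n \<notin> active A a p"
    have nA: "n \<in> A" using n active_subset by blast
    define g where "g x = trop_monomial a n x - trop_monomial a m x" for x
    have "m \<in> active A a p0" using m sub by blast
    then have "trop_monomial a n p0 \<le> trop_monomial a m p0" using nA by (simp add: active_iff)
    moreover have "trop_monomial a m p0 \<le> trop_monomial a n p0"
      using n subsetD[OF active_subset m] by (simp add: active_iff)
    ultimately have eq: "g p0 = 0" by (simp add: g_def)
    have neg: "g p < 0"
    proof (rule ccontr)
      assume "\<not> g p < 0"
      then have "trop_monomial a m p \<le> trop_monomial a n p" by (simp add: g_def)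
      then have "n \<in> active A a p" using m nA by (auto simp: active_iff intro: order_trans)
      with \<open>n \<notin> active A a p\<close> show False by simp
    qed
    obtain e where e: "e > 1" "(1 - e) *\<^sub>R p + e *\<^sub>R p0 \<in> ?F"
      using p0 convex_rel_interior_iff[OF convex_cell \<open>?F \<noteq> {}\<close>] by blast
    have "m \<in> active A a ((1 - e) *\<^sub>R p + e *\<^sub>R p0)" using e(2) m by auto
    then have "g ((1 - e) *\<^sub>R p + e *\<^sub>R p0) \<le> 0" using nA by (simp add: active_iff g_def)
    moreover have "g ((1 - e) *\<^sub>R p + e *\<^sub>R p0) = (1 - e) * g p + e * g p0"
      by (simp add: g_def trop_monomial_def inner_add_right algebra_simps)
    moreover have "(1 - e) * g p > 0" using e(1) neg by (simp add: mult_neg_neg)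
    ultimately show False using eq by simp
  qed
  then have "active A a p0 = active A a p" using sub by blast
  then show ?thesis unfolding dual_face_def p0_def by simp
qed

text \<open>If the exponents active at a point lie on a line, then moving orthogonally to the line keeps them tied
  until another exponent catches up. A point with the largest number of active exponents
  therefore has a dual face of full dimension.\<close>
lemma active_extends_to_full_dimension:
  assumes full: "\<And>u. u \<noteq> 0 \<Longrightarrow> \<exists>v\<in>A. \<exists>w\<in>A. emb v \<bullet> u \<noteq> emb w \<bullet> u"
  obtains p' where "active A a p \<subseteq> active A a p'" "aff_dim (emb ` active A a p') = 2"
proof -
  have "\<exists>p'. active A a p \<subseteq> active A a p' \<and> (\<forall>q. active A a p \<subseteq> active A a q \<longrightarrow> card (active A a q) \<le> card (active A a p'))"
    by (rule ex_has_greatest_nat[where k = p and b = "Suc (card A)"])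
      (auto simp: less_Suc_eq_le intro!: card_mono exponents_finite subsetD[OF active_subset] le_imp_less_Suc)
  then obtain p' where p': "active A a p \<subseteq> active A a p'"
    "\<And>q. active A a p \<subseteq> active A a q \<Longrightarrow> card (active A a q) \<le> card (active A a p')" by blast
  have "\<not> aff_dim (emb ` active A a p') < 2"
  proof
    assume "aff_dim (emb ` active A a p') < 2"
    then obtain u0 b where u0: "u0 \<noteq> 0" "emb ` active A a p' \<subseteq> {x. u0 \<bullet> x = b}"
      using aff_lowdim_subset_hyperplane[of "emb ` active A a p'"] by (auto simp: DIM_prod)
    obtain m where m: "m \<in> active A a p'" using active_nonempty by blast
    have mA: "m \<in> A" using m active_subset by blast
    have "\<exists>w\<in>A. emb w \<bullet> u0 \<noteq> emb m \<bullet> u0" using full[OF u0(1)] by metis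
    then obtain w1 where w1: "w1 \<in> A" "emb w1 \<bullet> u0 \<noteq> emb m \<bullet> u0" by auto
    \<comment> \<open>The orientation in which some exponent grows faster than the active ones.\<close>
    define u where "u = (if emb w1 \<bullet> u0 > emb m \<bullet> u0 then u0 else - u0)"
    have const: "emb v \<bullet> u = emb m \<bullet> u" if "v \<in> active A a p'" for v
    proof -
      have "u0 \<bullet> emb v = b" "u0 \<bullet> emb m = b" using u0(2) that m by auto
      then show ?thesis by (simp add: u_def inner_commute)
    qed
    define W where "W = {w \<in> A. emb m \<bullet> u < emb w \<bullet> u}"
    have "w1 \<in> W" using w1 by (auto simp: W_def u_def)
    have finW: "finite W" using exponents_finite by (simp add: W_def)
    \<comment> \<open>The time at which \<open>w\<close> catches up with \<open>m\<close> when moving from \<open>p'\<close> in the direction \<open>u\<close>.\<close>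
    define r where "r w = (trop_monomial a m p' - trop_monomial a w p') / (emb w \<bullet> u - emb m \<bullet> u)" for w
    obtain w0 where w0: "w0 \<in> W" "\<And>w. w \<in> W \<Longrightarrow> r w0 \<le> r w"
      using finW \<open>w1 \<in> W\<close> by (metis arg_min_if_finite(1) arg_min_least empty_iff)
    define s where "s = r w0"
    have s: "s \<ge> 0" using w0(1) m by (auto simp: s_def r_def W_def active_iff intro!: divide_nonneg_pos)
    define q where "q = p' + s *\<^sub>R u"
    have mono: "trop_monomial a n q = trop_monomial a n p' + s * (emb n \<bullet> u)" for n
      by (simp add: q_def trop_monomial_def inner_add_right)
    have le: "trop_monomial a n q \<le> trop_monomial a m q" if n: "n \<in> A" for n
    proof (cases "n \<in> W")
      case True
      then have "s \<le> r n" "emb m \<bullet> u < emb n \<bullet> u" using w0(2) by (auto simp: s_def W_def)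
      then show ?thesis unfolding mono by (simp add: r_def le_divide_eq algebra_simps)
    next
      case False
      then have "emb n \<bullet> u \<le> emb m \<bullet> u" using n by (auto simp: W_def)
      then have "s * (emb n \<bullet> u) \<le> s * (emb m \<bullet> u)" using s by (rule mult_left_mono)
      moreover have "trop_monomial a n p' \<le> trop_monomial a m p'" using m n by (simp add: active_iff)
      ultimately show ?thesis unfolding mono by simp
    qed
    have "active A a p' \<subseteq> active A a q"
    proof
      fix v assume v: "v \<in> active A a p'"
      have "trop_monomial a v p' = trop_monomial a m p'" using v m by (auto simp: active_iff intro: antisym)
      then have "trop_monomial a v q = trop_monomial a m q" unfolding mono using const[OF v] by simp
      then show "v \<in> active A a q" using v le active_subset by (auto simp: active_iff)
    qed
    moreover have "w0 \<in> active A a q"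
    proof -
      have "emb m \<bullet> u < emb w0 \<bullet> u" "w0 \<in> A" using w0(1) by (auto simp: W_def)
      then have "s * (emb w0 \<bullet> u - emb m \<bullet> u) = trop_monomial a m p' - trop_monomial a w0 p'"
        by (simp add: s_def r_def)
      then have "trop_monomial a w0 q = trop_monomial a m q" unfolding mono by (simp add: algebra_simps)
      then show ?thesis using le \<open>w0 \<in> A\<close> by (simp add: active_iff)
    qed
    moreover have "w0 \<notin> active A a p'" using const[of w0] w0(1) by (auto simp: W_def)
    ultimately have "active A a p' \<subset> active A a q" by auto
    then have card: "card (active A a p') < card (active A a q)"
      using finite_subset[OF active_subset exponents_finite] by (rule psubset_card_mono[rotated])
    have "active A a p \<subseteq> active A a q" using p'(1) \<open>active A a p' \<subset> active A a q\<close> by blast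
    from p'(2)[OF this] show False using card by (rule leD[THEN notE])
  qed
  moreover have "aff_dim (emb ` active A a p') \<le> 2"
    using aff_dim_le_DIM[of "emb ` active A a p'"] by (simp add: DIM_prod)
  ultimately have "aff_dim (emb ` active A a p') = 2" by simp
  with p'(1) show thesis by (rule that)
qed

text \<open>Nonsingularity speaks about triangles of the dual subdivision only; the active exponents of an
  arbitrary point are among those of a vertex of the curve.\<close>
lemma active_subset_unimodular_triangle:
  assumes ns: "nonsingular A a"
    and full: "\<And>u. u \<noteq> 0 \<Longrightarrow> \<exists>v\<in>A. \<exists>w\<in>A. emb v \<bullet> u \<noteq> emb w \<bullet> u"
  obtains u v w where "active A a p \<subseteq> {u, v, w}" "\<bar>ldet u v w\<bar> = 1"
proof -
  obtain p' where p': "active A a p \<subseteq> active A a p'" "aff_dim (emb ` active A a p') = 2"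
    by (rule active_extends_to_full_dimension[OF full])
  let ?T = "convex hull (emb ` active A a p')"
  have T: "?T \<in> dual_subdivision A a"
    unfolding dual_subdivision_def cells_def using dual_face_cell[of p'] by (metis image_eqI rangeI)
  have dimT: "aff_dim ?T = 2" using p'(2) by (simp add: aff_dim_convex_hull)
  then have area: "measure lebesgue ?T = 1 / 2" using ns T unfolding nonsingular_def by blast
  obtain n where "n simplex ?T" using ns T unfolding nonsingular_def triangulation_def by blast
  then obtain C where C: "\<not> affine_dependent C" "int (card C) = n + 1" "?T = convex hull C"
    unfolding simplex_def by blast
  have "aff_dim C = 2" using dimT C(3) by (metis aff_dim_convex_hull)
  then have "card C = 3" using aff_dim_affine_independent[OF C(1)] by simp
  then obtain x y z where xyz: "C = {x, y, z}" by (auto simp: card_3_iff)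
  have "C \<subseteq> emb ` active A a p'"
  proof
    fix x assume "x \<in> C"
    then have "x extreme_point_of ?T"
      unfolding C(3) by (simp add: extreme_point_of_convex_hull_affine_independent[OF C(1)])
    then show "x \<in> emb ` active A a p'" by (rule extreme_point_of_convex_hull)
  qed
  then obtain u v w where uvw: "x = emb u" "y = emb v" "z = emb w" using xyz by auto
  have T_eq: "?T = convex hull {emb u, emb v, emb w}" using C(3) xyz uvw by simp
  have "\<bar>real_of_int (ldet u v w)\<bar> = 1"
    using area unfolding T_eq measure_lattice_triangle by simp
  then have det: "\<bar>ldet u v w\<bar> = 1" by linarith
  have sub: "active A a p' \<subseteq> {u, v, w}"
  proof
    fix m assume "m \<in> active A a p'"
    then have "emb m \<in> ?T" by (intro hull_inc imageI)
    then show "m \<in> {u, v, w}" unfolding T_eq by (rule lattice_points_of_unimodular_triangle[OF det])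
  qed
  show thesis by (rule that[OF subset_trans[OF p'(1) sub] det])
qed

lemma active_interpolation:
  assumes ns: "nonsingular A a"
    and full: "\<And>u. u \<noteq> 0 \<Longrightarrow> \<exists>v\<in>A. \<exists>w\<in>A. emb v \<bullet> u \<noteq> emb w \<bullet> u"
  shows "\<exists>x k. \<forall>v\<in>active A a p. emb v \<bullet> x = c v + k"
proof -
  obtain u v w where uvw: "active A a p \<subseteq> {u, v, w}" "\<bar>ldet u v w\<bar> = 1"
    by (rule active_subset_unimodular_triangle[OF ns full])
  define d where "d = real_of_int (ldet u v w)"
  have d: "d * d = 1" using uvw(2) unfolding d_def by (auto simp: abs_if split: if_splits)
  define y z where "y = c v - c u" and "z = c w - c u"
  define x :: plane where "x = (d * (y * (snd w - snd u) - z * (snd v - snd u)), d * (z * (fst v - fst u) - y * (fst w - fst u)))"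
  have "(emb v - emb u) \<bullet> x = d * d * y" "(emb w - emb u) \<bullet> x = d * d * z"
    by (simp_all add: x_def emb_def d_def ldet_def algebra_simps)
  then have "emb v \<bullet> x = c v + (emb u \<bullet> x - c u)" "emb w \<bullet> x = c w + (emb u \<bullet> x - c u)"
    by (simp_all add: d inner_diff_left y_def z_def)
  then show ?thesis using uvw(1) by (intro exI[of _ x] exI[of _ "emb u \<bullet> x - c u"]) auto
qed

end

section \<open>The real part as a projective zero set\<close>

lemma character_of_nat: "character \<epsilon> (int n * fst v, int n * snd v) = character \<epsilon> v ^ n"
proof (induction n)
  case 0
  then show ?case using character_0(1) by (simp add: zero_prod_def)
next
  case (Suc n)
  have "(int (Suc n) * fst v, int (Suc n) * snd v) = v + (int n * fst v, int n * snd v)"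
    by (cases v) (simp add: algebra_simps)
  then show ?case using Suc by (simp add: character_add del: of_nat_Suc)
qed

lemma sign_at_eq: "real_of_int (sign_at \<delta> \<epsilon> v) = character \<epsilon> v * real_of_int (\<delta> v)"
  by (cases "fst \<epsilon> * of_int (fst v) + snd \<epsilon> * of_int (snd v) = 0")
    (simp_all only: sign_at_def character_def bit_sign_def if_True if_False of_int_minus mult_1 mult_minus1 simp_thms)

text \<open>The situation of the theorem after a choice of an affine lattice transformation that identifies the Newton polygon
  with a multiple of the standard triangle.\<close>
locale real_tropical_curve = unimodular_triangle h t m
  for h :: "3 \<Rightarrow> lat" and t :: lat and m :: nat +
  fixes A :: "lat set" and a :: "lat \<Rightarrow> real" and \<delta> :: "lat \<Rightarrow> int"
  assumes exponents: "exponent_set A" and ns: "nonsingular A a" and signs: "signs A \<delta>"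
    and newton: "newton_polygon A = D" and even_m: "even m"
begin

lemma zero_if_orthogonal:
  assumes "\<And>i. ht i u = 0"
  shows "u = 0"
proof -
  have *: "emb v \<bullet> u = 0" for v
  proof -
    obtain n where "emb v = (\<Sum>i\<in>UNIV. real_of_int (n i) *\<^sub>R emb (h i))" using barycentric by metis
    then show ?thesis using assms by (simp add: inner_sum_left)
  qed
  show ?thesis using *[of "(1, 0)"] *[of "(0, 1)"] by (cases u) (simp add: emb_def zero_prod_def)
qed

lemma expo_exists:
  assumes "v \<in> A"
  shows "\<exists>e :: 3 \<Rightarrow> nat. (\<Sum>i\<in>UNIV. e i) = m \<and> emb v = emb t + (\<Sum>i\<in>UNIV. real (e i) *\<^sub>R emb (h i))"
proof -
  obtain n where n: "(\<Sum>i\<in>UNIV. n i) = 0" "emb (v - t) = (\<Sum>i\<in>UNIV. real_of_int (n i) *\<^sub>R emb (h i))"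
    using barycentric by metis
  have n': "(\<Sum>i\<in>UNIV. real_of_int (n i)) = 0" using n(1) by (metis of_int_0 of_int_sum)
  \<comment> \<open>Adding \<open>m\<close> at the vertex \<open>h 1 = 0\<close> does not change the combination, but makes the sum \<open>m\<close>.\<close>
  define k where "k i = n i + (if i = 1 then int m else 0)" for i
  have nonneg: "0 \<le> k i" for i
  proof -
    obtain u where u: "\<And>l. ht l u = (if l = i then 1 else 0) - (if 1 = i then 1 else 0)"
      and coord: "emb (v - t) \<bullet> u = n i" using coordinate_form[of i] n' n(2) by metis
    have "u \<bullet> V l \<ge> emb t \<bullet> u - real m * (if 1 = i then 1 else 0)" for l
      by (simp add: V_def inner_add_right inner_commute[of u] u)
    then have "range V \<subseteq> {x. u \<bullet> x \<ge> emb t \<bullet> u - real m * (if 1 = i then 1 else 0)}"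
      by blast
    then have "D \<subseteq> {x. u \<bullet> x \<ge> emb t \<bullet> u - real m * (if 1 = i then 1 else 0)}"
      unfolding D_def by (rule hull_minimal) (rule convex_halfspace_ge)
    moreover have "emb v \<in> D"
      using assms newton unfolding newton_polygon_def by (metis hull_inc imageI)
    ultimately have "u \<bullet> emb v \<ge> emb t \<bullet> u - real m * (if 1 = i then 1 else 0)" by blast
    then have "real_of_int (n i) \<ge> - real m * (if 1 = i then 1 else 0)"
      using coord by (simp add: emb_diff inner_diff_left inner_commute[of u])
    then show ?thesis by (auto simp: k_def split: if_splits)
  qed
  have "(\<Sum>i\<in>UNIV. k i) = int m" by (simp add: k_def sum.distrib n(1))
  then have "int (\<Sum>i\<in>UNIV. nat (k i)) = int m" using nonneg by simp
  then have s: "(\<Sum>i\<in>UNIV. nat (k i)) = m" by (simp only: of_nat_eq_iff)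
  have eq: "real (nat (k i)) *\<^sub>R emb (h i) = real_of_int (n i) *\<^sub>R emb (h i)" for i
    using nonneg[of i] by (cases "i = 1") (auto simp: k_def h1 emb_0)
  have "emb v = emb t + (\<Sum>i\<in>UNIV. real (nat (k i)) *\<^sub>R emb (h i))"
    unfolding eq using n(2) by (simp add: emb_diff algebra_simps)
  with s show ?thesis by blast
qed

text \<open>The barycentric coordinates of \<open>v\<close> scaled by \<open>m\<close>: the exponents of the monomial in homogeneous
  coordinates.\<close>
definition expo :: "lat \<Rightarrow> 3 \<Rightarrow> nat" where
  "expo v = (SOME e. (\<Sum>i\<in>UNIV. e i) = m \<and> emb v = emb t + (\<Sum>i\<in>UNIV. real (e i) *\<^sub>R emb (h i)))"

lemma expo:
  assumes "v \<in> A"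
  shows "(\<Sum>i\<in>UNIV. expo v i) = m" "emb v = emb t + (\<Sum>i\<in>UNIV. real (expo v i) *\<^sub>R emb (h i))"
  using someI_ex[OF expo_exists[OF assms]] unfolding expo_def[symmetric] by blast+

text \<open>The vertices of the Newton polygon are extreme points of the convex hull of the exponents.\<close>
lemma corner_in_A: "\<exists>v\<in>A. emb v = V i"
proof -
  have "V i extreme_point_of D"
    unfolding D_def by (simp add: extreme_point_of_convex_hull_affine_independent[OF affine_independent])
  then have "V i extreme_point_of (convex hull (emb ` A))"
    using newton by (simp add: newton_polygon_def)
  then have "V i \<in> emb ` A" by (rule extreme_point_of_convex_hull)
  then show ?thesis by auto
qed

definition coef :: "lat \<Rightarrow> real" where "coef v = real_of_int (\<delta> v) * exp (a v)"

lemma \<delta>_cases: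
  assumes "v \<in> A" shows "\<delta> v = 1 \<or> \<delta> v = -1"
proof -
  have "emb v \<in> newton_polygon A"
    unfolding newton_polygon_def using assms by (intro hull_inc imageI)
  then show ?thesis using signs unfolding signs_def by blast
qed

sublocale signed_terms A coef expo m
proof
  show "finite A" by (rule exponents_finite[OF exponents])
  show "coef v \<noteq> 0" if "v \<in> A" for v using \<delta>_cases[OF that] by (auto simp: coef_def)
  show "(\<Sum>i\<in>UNIV. expo v i) = m" if "v \<in> A" for v using expo(1)[OF that] .
  show "even m" by (rule even_m)
  show "\<exists>v\<in>A. expo v i = m" for i
  proof -
    obtain v where v: "v \<in> A" "emb v = V i" using corner_in_A by blast
    have s: "(\<Sum>l\<in>UNIV. real (expo v l)) = real m" using expo(1)[OF v(1)] by (metis of_nat_sum)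
    define c where "c l = real (expo v l) - (if l = i then real m else 0)" for l
    have c0: "(\<Sum>l\<in>UNIV. c l) = 0" by (simp add: c_def sum_subtractf s)
    have "c l *\<^sub>R emb (h l) = real (expo v l) *\<^sub>R emb (h l) - (if l = i then real m *\<^sub>R emb (h l) else 0)" for l
      by (simp add: c_def scaleR_diff_left)
    then have "0 = (\<Sum>l\<in>UNIV. c l *\<^sub>R emb (h l))"
      using v(2) expo(2)[OF v(1)] by (simp add: V_def sum_subtractf)
    with c0 have "0 = c i" using coordinate_form[of i] inner_zero_left by metis
    then have "real (expo v i) = real m" by (simp add: c_def)
    then show ?thesis using v(1) by auto
  qed
qed

text \<open>Homogeneous coordinates of a point of the open stratum in the positive copy.\<close>
definition position :: "plane \<Rightarrow> real ^ 3" where "position p = (\<chi> i. exp (ht i p))"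

lemma position_pos: "0 < position p $ i" "position p \<noteq> 0"
  by (simp add: position_def) (metis exp_gt_zero less_irrefl position_def vec_lambda_beta zero_index)

lemma character_expo:
  assumes "v \<in> A"
  shows "(\<Prod>i\<in>UNIV. character \<epsilon> (h i) ^ expo v i) = character \<epsilon> t * character \<epsilon> v"
proof -
  let ?s = "\<lambda>i. (int (expo v i) * fst (h i), int (expo v i) * snd (h i))"
  have "emb v = emb (t + (?s 2 + ?s 3))"
    unfolding expo(2)[OF assms] by (simp add: sum_3 h1 emb_0) (simp add: emb_def)
  then have "v = t + (?s 2 + ?s 3)" by (simp add: inj_eq[OF inj_emb])
  then have "character \<epsilon> v = character \<epsilon> t * (character \<epsilon> (h 2) ^ expo v 2 * character \<epsilon> (h 3) ^ expo v 3)"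
    by (metis character_add character_of_nat)
  moreover have "(\<Prod>i\<in>UNIV. character \<epsilon> (h i) ^ expo v i) = character \<epsilon> (h 2) ^ expo v 2 * character \<epsilon> (h 3) ^ expo v 3"
    unfolding UNIV_3 by (simp add: h1 character_0)
  ultimately show ?thesis using character_square[of \<epsilon> t] by (simp add: mult.assoc[symmetric])
qed

text \<open>The dictionary between real and tropical monomials. The factors \<open>\<plusminus> exp (- t \<cdot> p)\<close> do not depend
  on \<open>v\<close>, so they affect neither which terms dominate nor which of them have equal signs.\<close>
lemma term_at_position:
  assumes v: "v \<in> A"
  shows "term_at v (twist \<epsilon> (position p)) =
    character \<epsilon> t * real_of_int (sign_at \<delta> \<epsilon> v) * exp (trop_monomial a v p - emb t \<bullet> p)"
proof -
  have "(\<Prod>i\<in>UNIV. twist \<epsilon> (position p) $ i ^ expo v i) =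
      (\<Prod>i\<in>UNIV. character \<epsilon> (h i) ^ expo v i * exp (real (expo v i) * (ht i p)))"
    by (simp add: twist_def position_def power_mult_distrib exp_of_nat_mult)
  also have "\<dots> = character \<epsilon> t * character \<epsilon> v * exp (\<Sum>i\<in>UNIV. real (expo v i) * (ht i p))"
    by (simp add: prod.distrib character_expo[OF v] exp_sum)
  also have "(\<Sum>i\<in>UNIV. real (expo v i) * (ht i p)) = (emb v - emb t) \<bullet> p"
    unfolding expo(2)[OF v] by (simp add: inner_sum_left)
  finally show ?thesis
    by (simp add: term_at_def coef_def sign_at_eq trop_monomial_def inner_diff_left exp_add exp_diff)
qed

lemma abs_term_at_position:
  assumes v: "v \<in> A"
  shows "\<bar>term_at v (twist \<epsilon> (position p))\<bar> = exp (trop_monomial a v p - emb t \<bullet> p)"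
proof -
  have "\<bar>character \<epsilon> t\<bar> = 1" using character_cases[of \<epsilon> t] by auto
  moreover have "\<bar>real_of_int (sign_at \<delta> \<epsilon> v)\<bar> = 1"
    unfolding sign_at_eq using character_cases[of \<epsilon> v] \<delta>_cases[OF v] by (auto simp: abs_mult)
  ultimately show ?thesis unfolding term_at_position[OF v] by (simp add: abs_mult)
qed

lemma dominant_position: "dominant (twist \<epsilon> (position p)) = active A a p"
proof -
  have "v \<in> dominant (twist \<epsilon> (position p)) \<longleftrightarrow> v \<in> active A a p" for v
    unfolding dominant_def active_iff[OF exponents] mem_Collect_eq
    by (intro conj_cong ball_cong refl) (simp add: abs_term_at_position)
  then show ?thesis by blast
qed

lemma torus_point:
  assumes "\<And>i. X $ i \<noteq> 0"
  obtains c \<epsilon> p where "c \<noteq> 0" "X = c *\<^sub>R twist \<epsilon> (position p)"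
proof -
  obtain p where p: "\<And>i. ht i p = ln \<bar>X $ i\<bar> - ln \<bar>X $ 1\<bar>"
    using dual_real[of "\<lambda>i. ln \<bar>X $ i\<bar>"] by metis
  obtain \<alpha> where \<alpha>: "\<And>i. character (mod2 \<alpha>) (h i) = (if 0 \<le> X $ i then 1 else -1) * (if 0 \<le> X $ 1 then 1 else -1)"
    using character_determined[of "\<lambda>i. 0 \<le> X $ i"] by metis
  have X: "X $ i = X $ 1 * (character (mod2 \<alpha>) (h i) * exp (ht i p))" for i
    using assms[of i] assms[of 1] by (auto simp: \<alpha> p exp_diff)
  have "(X $ 1 *\<^sub>R twist (mod2 \<alpha>) (position p)) $ i = X $ 1 * (character (mod2 \<alpha>) (h i) * exp (ht i p))" for i
    by (simp add: twist_def position_def)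
  then have "X = X $ 1 *\<^sub>R twist (mod2 \<alpha>) (position p)"
    unfolding vec_eq_iff using X by metis
  then show thesis using that assms[of 1] by blast
qed

lemma dominant_scaleR:
  assumes "c \<noteq> 0" shows "dominant (c *\<^sub>R X) = dominant X"
proof -
  have "v \<in> dominant (c *\<^sub>R X) \<longleftrightarrow> v \<in> dominant X" for v
    unfolding dominant_def mem_Collect_eq
    by (intro conj_cong ball_cong refl) (use assms in \<open>simp add: term_at_scaleR abs_mult\<close>)
  then show ?thesis by blast
qed

lemma exponents_span:
  assumes "u \<noteq> 0"
  shows "\<exists>v\<in>A. \<exists>w\<in>A. emb v \<bullet> u \<noteq> emb w \<bullet> u"
proof (rule ccontr)
  assume no: "\<not> ?thesis"
  have "ht i u = 0" for i
  proof -
    obtain v w where vw: "v \<in> A" "emb v = V i" "w \<in> A" "emb w = V 1" using corner_in_A by metis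
    then have "V i \<bullet> u = V 1 \<bullet> u" using no by metis
    then show ?thesis using m by (simp add: V_def h1 emb_0 inner_add_left)
  qed
  then show False using zero_if_orthogonal assms by blast
qed

sublocale generic_signed_terms A coef expo m
proof
  fix X :: "real ^ 3" and c :: "lat \<Rightarrow> real"
  assume X: "\<And>i. X $ i \<noteq> 0"
  obtain d \<epsilon> p where d: "d \<noteq> 0" "X = d *\<^sub>R twist \<epsilon> (position p)" using torus_point[OF X] by metis
  then have dom: "dominant X = active A a p" by (simp add: dominant_scaleR dominant_position)
  obtain u k where u: "\<forall>v\<in>active A a p. emb v \<bullet> u = c v + k"
    using active_interpolation[OF exponents ns exponents_span, of p c] by blast
  define \<eta> :: "real ^ 3" where "\<eta> = (\<chi> i. ht i u)"
  have "lin v \<eta> = c v + (k - emb t \<bullet> u)" if "v \<in> active A a p" for v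
  proof -
    have "v \<in> A" using that active_subset[OF exponents] by blast
    from expo(2)[OF this] have "lin v \<eta> = (emb v - emb t) \<bullet> u"
      by (simp add: lin_def \<eta>_def inner_sum_left)
    then show ?thesis using u that by (simp add: inner_diff_left)
  qed
  then show "\<exists>\<eta> k. \<forall>v\<in>dominant X. lin v \<eta> = c v + k"
    unfolding dom by (intro exI[of _ \<eta>] exI[of _ "k - emb t \<bullet> u"] ballI)
qed

sublocale two_sided_hypersurface "real_toric_surface D" \<Psi> F
proof
  show "3 \<le> DIM(real ^ 3)" by simp
  show "quotient_map (top_of_set (- {0})) (real_toric_surface D) \<Psi>" by (rule quotient_\<Psi>)
  show "\<Psi> x = \<Psi> y \<longleftrightarrow> (\<exists>c. y = c *\<^sub>R x)" if "x \<noteq> 0" "y \<noteq> 0" for x y using \<Psi>_eq_iff[OF that] .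
  show "continuous_on (- {0}) F" by (rule continuous_F)
  show "sgn (F (c *\<^sub>R x)) = sgn (F x)" if "x \<noteq> 0" "c \<noteq> 0" for x c using sgn_F_scaleR[OF that(2)] .
qed (rule local_sides)

lemma pt_position: "pt (position p) = toric_incl p"
proof -
  have supp: "supp (position p) = UNIV" using position_pos(1)[of p] by (auto simp: supp_def less_imp_neq[THEN not_sym])
  have "cone UNIV = {0}"
  proof (intro equalityI subsetI)
    fix u assume u: "u \<in> cone UNIV"
    have "ht i u = 0" for i
      using cone_eqD[OF u, of i 1] by (simp add: h1 emb_0)
    then show "u \<in> {0}" using zero_if_orthogonal by simp
  qed (simp add: cone_def)
  moreover have "{u. \<forall>i\<in>UNIV. \<forall>j\<in>UNIV. (emb (h i) - emb (h j)) \<bullet> u = ln \<bar>position p $ i\<bar> - ln \<bar>position p $ j\<bar>} = {p}"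
  proof (intro equalityI subsetI)
    fix u assume u: "u \<in> {u. \<forall>i\<in>UNIV. \<forall>j\<in>UNIV. (emb (h i) - emb (h j)) \<bullet> u = ln \<bar>position p $ i\<bar> - ln \<bar>position p $ j\<bar>}"
    have "ht i (u - p) = 0" for i
    proof -
      have "(emb (h i) - emb (h 1)) \<bullet> u = ln \<bar>position p $ i\<bar> - ln \<bar>position p $ 1\<bar>" using u by blast
      then show ?thesis by (simp add: h1 emb_0 position_def inner_diff_right)
    qed
    then have "u - p = 0" by (rule zero_if_orthogonal)
    then show "u \<in> {p}" by simp
  qed (simp add: position_def inner_diff_left)
  ultimately show ?thesis by (simp only: pt_def supp toric_incl_def)
qed

lemma real_proj_incl: "real_proj D (\<epsilon>, toric_incl p) = \<Psi> (twist \<epsilon> (position p))" "twist \<epsilon> (position p) \<noteq> 0"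
  using real_proj_eq_\<Psi>_twist[of "position p" \<epsilon>] position_pos[of p]
  by (simp_all add: pt_position less_imp_le)

lemma toric_incl_in: "toric_incl p \<in> topspace (toric_surface (dual_fan D))"
  using pt_in[OF position_pos(2), of p] by (simp add: pt_position topspace_toric_surface)

lemma opposite_signs_imp_zero:
  assumes "v \<in> active A a p" "w \<in> active A a p" "sign_at \<delta> \<epsilon> v \<noteq> sign_at \<delta> \<epsilon> w"
  shows "F (twist \<epsilon> (position p)) = 0"
proof -
  have A: "v \<in> A" "w \<in> A" using assms active_subset[OF exponents] by blast+
  have val: "sign_at \<delta> \<epsilon> x = 1 \<or> sign_at \<delta> \<epsilon> x = -1" if "x \<in> A" for x
    using \<delta>_cases[OF that] by (auto simp: sign_at_def)
  have "\<exists>x\<in>active A a p. s * term_at x (twist \<epsilon> (position p)) > 0" if s: "s \<in> {1, -1}" for s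
  proof -
    have "s * term_at v (twist \<epsilon> (position p)) > 0 \<or> s * term_at w (twist \<epsilon> (position p)) > 0"
      using s val[OF A(1)] val[OF A(2)] assms(3) character_cases[of \<epsilon> t]
      unfolding term_at_position[OF A(1)] term_at_position[OF A(2)] by auto
    then show ?thesis using assms by blast
  qed
  then show ?thesis
    unfolding F_eq_0[OF real_proj_incl(2)] dominant_position by blast
qed

lemma closedin_zeros: "closedin (real_toric_surface D) (\<Psi> ` zeros)"
proof -
  have "open {X. F X \<noteq> 0}"
    by (intro open_Collect_neq continuous_F continuous_on_const)
  then have op: "openin (real_toric_surface D) (\<Psi> ` ({X. F X \<noteq> 0} - {0}))" by (rule open_image)
  have eq: "\<Psi> ` ({X. F X \<noteq> 0} - {0}) = topspace (real_toric_surface D) - \<Psi> ` zeros"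
  proof (intro equalityI subsetI)
    fix z assume "z \<in> \<Psi> ` ({X. F X \<noteq> 0} - {0})"
    then obtain X where X: "X \<noteq> 0" "F X \<noteq> 0" "z = \<Psi> X" by auto
    have "z \<notin> \<Psi> ` zeros"
    proof
      assume "z \<in> \<Psi> ` zeros"
      then obtain Y where Y: "Y \<noteq> 0" "F Y = 0" "\<Psi> Y = \<Psi> X" using X(3) by (auto simp: zeros_def)
      then obtain c where c: "X = c *\<^sub>R Y" using \<Psi>_eq_iff[OF Y(1) X(1)] by blast
      then have "c \<noteq> 0" using X(1) by auto
      then show False using sgnF[OF Y(1), of c] c Y(2) X(2) by (simp add: sgn_0_0)
    qed
    then show "z \<in> topspace (real_toric_surface D) - \<Psi> ` zeros" using X by (auto simp: topspace_eq)
  next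
    fix z assume z: "z \<in> topspace (real_toric_surface D) - \<Psi> ` zeros"
    then obtain X where X: "X \<noteq> 0" "z = \<Psi> X" by (auto simp: topspace_eq)
    then have "F X \<noteq> 0" using z by (auto simp: zeros_def)
    then show "z \<in> \<Psi> ` ({X. F X \<noteq> 0} - {0})" using X by blast
  qed
  have "\<Psi> ` zeros \<subseteq> topspace (real_toric_surface D)" by (auto simp: topspace_eq zeros_def)
  then show ?thesis using op unfolding closedin_def eq by blast
qed

text \<open>The union of the real edges, whose closure is the real part by definition.\<close>
definition phase_union :: "(reflection \<times> toric_point) set set" where
  "phase_union = (\<Union>e\<in>trop_edges A a. \<Union>\<epsilon>\<in>real_phase A a \<delta> e.
           (\<lambda>p. real_proj D (\<epsilon>, p)) ` compact_edge (dual_fan D) e)"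

lemma phase_union_subset: "phase_union \<subseteq> \<Psi> ` zeros"
proof -
  have "real_proj D (\<epsilon>, x) \<in> \<Psi> ` zeros"
    if e: "e \<in> trop_edges A a" and \<epsilon>: "\<epsilon> \<in> real_phase A a \<delta> e" and x: "x \<in> compact_edge (dual_fan D) e" for e \<epsilon> x
  proof -
    obtain p1 where p1: "e = {q. active A a p1 \<subseteq> active A a q}"
      using e by (auto simp: trop_edges_def cells_def)
    obtain v w where vw: "dual_face A a e = closed_segment (emb v) (emb w)" "sign_at \<delta> \<epsilon> v \<noteq> sign_at \<delta> \<epsilon> w"
      using \<epsilon> by (auto simp: real_phase_def)
    have hull: "convex hull (emb ` active A a p1) = closed_segment (emb v) (emb w)"
      using vw(1) unfolding p1 dual_face_cell[OF exponents] .
    have "y \<in> active A a p1" if "y = v \<or> y = w" for y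
    proof -
      have "emb y extreme_point_of convex hull (emb ` active A a p1)"
        unfolding hull using that by (auto simp: extreme_point_of_segment)
      then have "emb y \<in> emb ` active A a p1" by (rule extreme_point_of_convex_hull)
      then show ?thesis by (simp add: inj_image_mem_iff[OF inj_emb])
    qed
    then have zero: "F (twist \<epsilon> (position q)) = 0" if "q \<in> e" for q
      using opposite_signs_imp_zero[OF _ _ vw(2), of q] that p1 by blast
    define K where "K = {y \<in> topspace (toric_surface (dual_fan D)). real_proj D (\<epsilon>, y) \<in> \<Psi> ` zeros}"
    have "continuous_map (toric_surface (dual_fan D)) (real_toric_surface D) (real_proj D \<circ> Pair \<epsilon>)"
      by (intro continuous_map_compose[OF _ continuous_real_proj] continuous_map_component_injection) simp
    then have "closedin (toric_surface (dual_fan D)) K"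
      unfolding K_def using closedin_continuous_map_preimage[OF _ closedin_zeros] by (force simp: o_def)
    moreover have "toric_incl ` e \<subseteq> K"
    proof
      fix y assume "y \<in> toric_incl ` e"
      then obtain q where q: "q \<in> e" "y = toric_incl q" by auto
      then show "y \<in> K"
        unfolding K_def using toric_incl_in real_proj_incl[of \<epsilon> q] zero[OF q(1)] by (auto simp: zeros_def)
    qed
    ultimately have "compact_edge (dual_fan D) e \<subseteq> K"
      unfolding compact_edge_def by (rule closure_of_minimal[rotated])
    then show ?thesis using x by (auto simp: K_def)
  qed
  then show ?thesis unfolding phase_union_def by blast
qed

text \<open>The cell is contained in the line where the two monomials agree, and contains a neighbourhood of
  \<open>p\<close> in that line, because all other monomials are strictly smaller at \<open>p\<close>.\<close>
lemma edge_of_two_active: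
  assumes act: "active A a p = {v, w}" and ne: "v \<noteq> w"
  shows "{q. active A a p \<subseteq> active A a q} \<in> trop_edges A a" (is "?e \<in> _")
proof -
  have vw: "v \<in> A" "w \<in> A" using act active_subset[OF exponents] by blast+
  have "?e \<in> cells A a" by (auto simp: cells_def)
  moreover have "?e \<subseteq> trop_curve A a" using act ne by (auto simp: trop_curve_def)
  moreover have "aff_dim ?e = 1"
  proof -
    define H where "H = {x. (emb v - emb w) \<bullet> x = a w - a v}"
    have nz: "emb v - emb w \<noteq> 0" using ne inj_emb by (auto simp: inj_eq)
    have dimH: "aff_dim H = 1" unfolding H_def using aff_dim_hyperplane[OF nz] by (simp add: DIM_prod)
    have H: "x \<in> H \<longleftrightarrow> trop_monomial a v x = trop_monomial a w x" for x
      by (auto simp: H_def trop_monomial_def inner_diff_left)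
    define O' where "O' = (\<Inter>n\<in>A - {v, w}. {q. trop_monomial a n q < trop_monomial a v q})"
    have "open O'"
      unfolding O'_def trop_monomial_def using finite_A
      by (intro open_INT ballI open_Collect_less continuous_intros) auto
    moreover have "p \<in> O'"
    proof -
      have "trop_monomial a n p < trop_monomial a v p" if "n \<in> A" "n \<notin> {v, w}" for n
      proof (rule ccontr)
        assume "\<not> ?thesis"
        then have "n \<in> active A a p"
          using act that unfolding active_iff[OF exponents]
          by (metis (no_types, lifting) active_iff[OF exponents] insertI1 linorder_not_less order_trans)
        then show False using act that by blast
      qed
      then show ?thesis by (auto simp: O'_def)
    qed
    moreover have eH: "?e \<subseteq> H"
    proof
      fix q assume "q \<in> ?e"
      then have "v \<in> active A a q" "w \<in> active A a q" using act by auto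
      then show "q \<in> H" unfolding H active_iff[OF exponents] using vw by (auto intro: antisym)
    qed
    moreover have "p \<in> H" using eH by auto
    moreover have "convex H" unfolding H_def by (rule convex_hyperplane)
    ultimately have "aff_dim (H \<inter> O') = 1"
      using aff_dim_convex_Int_open[of H O'] dimH by auto
    moreover have "H \<inter> O' \<subseteq> ?e"
    proof
      fix q assume q: "q \<in> H \<inter> O'"
      have eq: "trop_monomial a v q = trop_monomial a w q" using q H by blast
      have "trop_monomial a n q \<le> trop_monomial a v q" if "n \<in> A" for n
        using that q eq by (cases "n \<in> {v, w}") (auto simp: O'_def intro: less_imp_le)
      then show "q \<in> ?e" using act vw eq by (auto simp: active_iff[OF exponents])
    qed
    ultimately show ?thesis
      using aff_dim_subset[OF \<open>H \<inter> O' \<subseteq> ?e\<close>] aff_dim_subset[OF eH] dimH by simp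
  qed
  ultimately show ?thesis by (simp add: trop_edges_def)
qed

text \<open>Zeros in the open stratum with exactly two active exponents lie on a real edge, and they are dense in
  the zero set. This covers the vertices of the curve and the points on the boundary strata.\<close>
lemma zeros_subset_closure: "\<Psi> ` zeros \<subseteq> real_toric_surface D closure_of phase_union"
proof
  fix z assume "z \<in> \<Psi> ` zeros"
  then obtain q where q: "q \<noteq> 0" "F q = 0" "z = \<Psi> q" by (auto simp: zeros_def)
  show "z \<in> real_toric_surface D closure_of phase_union"
    unfolding in_closure_of
  proof (intro conjI allI impI)
    show "z \<in> topspace (real_toric_surface D)" using q by (auto simp: topspace_eq)
    fix T assume T: "z \<in> T \<and> openin (real_toric_surface D) T"
    define N where "N = {x \<in> topspace (top_of_set (- {0})). \<Psi> x \<in> T}"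
    have "openin (top_of_set (- {0})) N"
      unfolding N_def using openin_continuous_map_preimage[OF continuous_\<Psi>] T by blast
    then have "open N" by (simp add: openin_open_eq open_Compl)
    moreover have "q \<in> N" using q T by (simp add: N_def)
    ultimately obtain X v w where X: "X \<in> N" "\<And>i. X $ i \<noteq> 0" "dominant X = {v, w}" "term_at v X > 0" "term_at w X < 0"
      using zeros_with_two_dominant_terms_dense[OF q(1,2)] by metis
    obtain c \<epsilon> p where c: "c \<noteq> 0" "X = c *\<^sub>R twist \<epsilon> (position p)" using torus_point[OF X(2)] by metis
    have act: "active A a p = {v, w}" using X(3) c by (simp add: dominant_scaleR dominant_position)
    have vwA: "v \<in> A" "w \<in> A" using act active_subset[OF exponents] by blast+
    have ne: "v \<noteq> w" using X(4,5) by auto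
    let ?e = "{q. active A a p \<subseteq> active A a q}"
    have pos: "c ^ m > 0" using c(1) even_m by (simp add: zero_less_power_eq)
    have "term_at v (twist \<epsilon> (position p)) > 0" "term_at w (twist \<epsilon> (position p)) < 0"
      using X(4,5) pos unfolding c(2) term_at_scaleR[OF vwA(1)] term_at_scaleR[OF vwA(2)]
      by (simp_all add: zero_less_mult_iff mult_less_0_iff even_m)
    then have signs: "sign_at \<delta> \<epsilon> v \<noteq> sign_at \<delta> \<epsilon> w"
      unfolding term_at_position[OF vwA(1)] term_at_position[OF vwA(2)]
      by (auto simp: zero_less_mult_iff mult_less_0_iff)
    have "dual_face A a ?e = convex hull (emb ` active A a p)" by (rule dual_face_cell[OF exponents])
    also have "\<dots> = closed_segment (emb v) (emb w)" unfolding act by (simp add: segment_convex_hull)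
    finally have "dual_face A a ?e = closed_segment (emb v) (emb w)" .
    then have ph: "\<epsilon> \<in> real_phase A a \<delta> ?e" using signs unfolding real_phase_def by blast
    have "p \<in> ?e" by simp
    then have "toric_incl p \<in> toric_incl ` ?e" by (rule imageI)
    moreover have "toric_incl ` ?e \<subseteq> compact_edge (dual_fan D) ?e"
      unfolding compact_edge_def by (intro closure_of_subset) (use toric_incl_in in blast)
    ultimately have "real_proj D (\<epsilon>, toric_incl p) \<in> phase_union"
      unfolding phase_union_def using edge_of_two_active[OF act ne] ph by blast
    moreover have "real_proj D (\<epsilon>, toric_incl p) = \<Psi> X"
      unfolding c(2) \<Psi>_scaleR[OF real_proj_incl(2) c(1)] by (rule real_proj_incl(1))
    moreover have "\<Psi> X \<in> T" using X(1) by (simp add: N_def)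
    ultimately show "\<exists>y. y \<in> phase_union \<and> y \<in> T" by metis
  qed
qed

lemma real_part_eq: "real_part A a \<delta> = \<Psi> ` {x. x \<noteq> 0 \<and> F x = 0}"
proof -
  have "real_part A a \<delta> = real_toric_surface D closure_of phase_union"
    by (simp add: real_part_def Let_def newton phase_union_def)
  also have "\<dots> = \<Psi> ` zeros"
    using zeros_subset_closure closure_of_minimal[OF phase_union_subset closedin_zeros] by blast
  finally show ?thesis by (simp add: zeros_def)
qed

end

theorem proposition5p9:
  fixes A :: "lat set" and a :: "lat \<Rightarrow> real" and \<delta> :: "lat \<Rightarrow> int"
    and \<Delta> :: "plane set" and \<Sigma> :: "plane set set" and k :: nat
  assumes "exponent_set A" and "nonsingular A a" and "signs A \<delta>"
    and "\<Delta> = newton_polygon A" and "\<Sigma> = dual_fan \<Delta>"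
    and "complete_fan \<Sigma>" and "unimodular_fan \<Sigma>"
    and "strict_even \<Delta>"
    and "k \<ge> 1" and "lattice_transformation \<Delta> (std_triangle (2 * k))"
  shows "\<forall>Q \<in> connected_components_of (subtopology (real_toric_surface \<Delta>) (real_part A a \<delta>)).
           is_oval (real_toric_surface \<Delta>) Q"
proof -
  obtain r s r' s' :: int and t :: lat where det: "\<bar>r * s' - s * r'\<bar> = 1"
    and \<Delta>: "\<Delta> = (\<lambda>(x, y). emb t + (of_int r * x + of_int s * y, of_int r' * x + of_int s' * y)) ` std_triangle (2 * k)"
    using assms(10) unfolding lattice_transformation_def by blast
  define h :: "3 \<Rightarrow> lat" where "h i = (if i = 2 then (r, r') else if i = 3 then (s, s') else 0)" for i
  interpret T: unimodular_triangle h t "2 * k"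
    by unfold_locales (use det assms(9) in \<open>auto simp: h_def\<close>)
  define L :: "plane \<Rightarrow> plane" where "L = (\<lambda>(x, y). (of_int r * x + of_int s * y, of_int r' * x + of_int s' * y))"
  have "linear L"
    by (rule linearI) (auto simp: L_def algebra_simps)
  have "\<Delta> = (+) (emb t) ` (L ` (convex hull {(0, 0), (real (2 * k), 0), (0, real (2 * k))}))"
    unfolding \<Delta> std_triangle_def image_image L_def by (simp add: case_prod_beta')
  also have "\<dots> = convex hull ((+) (emb t) ` (L ` {(0, 0), (real (2 * k), 0), (0, real (2 * k))}))"
    by (simp only: convex_hull_linear_image[OF \<open>linear L\<close>] convex_hull_translation)
  also have "(+) (emb t) ` (L ` {(0, 0), (real (2 * k), 0), (0, real (2 * k))}) = range T.V"
    unfolding UNIV_3 T.V_def by (simp add: L_def h_def emb_def zero_prod_def mult.commute)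
  finally have D: "\<Delta> = T.D" by (simp add: T.D_def)
  interpret real_tropical_curve h t "2 * k" A a \<delta>
    by unfold_locales (use assms D in auto)
  show ?thesis
    unfolding D real_part_eq using all_components_ovals by blast
qed

end
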